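(* Let $n\geqslant 2$, let $D\subset\mathbb{R}^n$ be a domain whose closure $\overline{D}$ is a compact set in $\mathbb{R}^n$, and let $n-1<\alpha\leqslant n$. Let $f:D\rightarrow\mathbb{R}^n$ be a (continuous) open, discrete and closed mapping that is differentiable almost everywhere and has the $N$-Luzin property with respect to the Lebesgue measure in $\mathbb{R}^n$. Let $y_0\in\overline{f(D)}\setminus\{\infty\}$ and $r_0=\sup_{y\in f(D)}|y-y_0|>0$. Suppose that $$m\bigl(f(\{x\in D: J(x,f)=0\})\bigr)=0 .$$ Suppose that for every $\varepsilon\in(0,r_0)$ the mapping $f$ has the $N^{-1}$-property on $S(y_0,r)\cap f(D)$ for almost all $r\in(\varepsilon,r_0)$ relative to the Hausdorff measure $\mathcal{H}^{n-1}$ on $S(y_0,r)$. If the function $$Q(y)=\sum_{x\in f^{-1}(y)}K_{O,\alpha}(x,f)$$ belongs to $L^1(f(D))$, then $f$ satisfies the inverse Poletsky inequality at the point $y_0$ with respect to $\alpha$-modulus with $Q_*(y):=N^{\alpha}(f,D)\cdot Q(y)$.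
   Context: Notation: $m$ is Lebesgue measure in $\mathbb{R}^n$, $\mathcal{H}^{n-1}$ is the $(n-1)$-dimensional Hausdorff measure, $B(y_0,r)=\{y\in\mathbb{R}^n:|y-y_0|<r\}$, $S(y_0,r)=\{y\in\mathbb{R}^n:|y-y_0|=r\}$, and $A(y_0,r_1,r_2)=\{y\in\mathbb{R}^n: r_1<|y-y_0|<r_2\}$. A mapping is open if images of open sets are open, discrete if each point has a discrete set of preimages, closed if the image of every set closed in $D$ is closed in $f(D)$. $N$-Luzin property: $m(E)=0$ implies $m(f(E))=0$ for $E\subset D$. The $N^{-1}$-property on $S(y_0,r)\cap f(D)$ relative to $\mathcal{H}^{n-1}$: if $E\subset S(y_0,r)\cap f(D)$ and $\mathcal{H}^{n-1}(E)=0$, then $\mathcal{H}^{n-1}(f^{-1}(E))=0$. At points $x$ of differentiability of $f$, put $\|f'(x)\|=\max_{h\in\mathbb{R}^n\setminus\{0\}}\frac{|f'(x)h|}{|h|}$ and $J(x,f)=\det f'(x)$; the set $\{x\in D:J(x,f)=0\}$ consists of points of differentiability. The outer dilatation of order $\alpha$ is $$K_{O,\alpha}(x,f)=\begin{cases}\dfrac{\|f'(x)\|^{\alpha}}{|J(x,f)|},& J(x,f)\neq0,\\ 1,& f'(x)=0,\\ \infty,&\text{otherwise.}\end{cases}$$ The multiplicity is $N(f,D)=\sup_{y\in\mathbb{R}^n}\mathrm{card}\{x\in D: f(x)=y\}$; it is finite for open, discrete and closed mappings of $D$. The function $Q(y)=\sum_{x\in f^{-1}(y)}K_{O,\alpha}(x,f)$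 (also denoted $K_{I,\alpha}(y,f^{-1})$) is defined for those $y$ that are not images of points at which $f$ fails to have a total differential; this is almost every $y$, by the $N$-Luzin property. For sets $E,F\subset\overline{\mathbb{R}^n}=\mathbb{R}^n\cup\{\infty\}$ and a domain $G\subset\mathbb{R}^n$, $\Gamma(E,F,G)$ is the family of all paths $\gamma:[a,b]\rightarrow\overline{\mathbb{R}^n}$ with $\gamma(a)\in E$, $\gamma(b)\in F$ and $\gamma(t)\in G$ for $t\in(a,b)$. For $0<r_1<r_2<\sup_{y\in f(D)}|y-y_0|$, $\Gamma_f(y_0,C_1,C_2)$ is the family of all paths $\gamma$ in $D$ such that $f(\gamma)\in\Gamma(C_1,C_2,A(y_0,r_1,r_2))$. $M_\alpha(\Gamma)$ is the usual $\alpha$-modulus of a family of paths: $M_\alpha(\Gamma)=\inf\int_{\mathbb{R}^n}\rho^\alpha\,dm$ over all Borel $\rho:\mathbb{R}^n\to[0,\infty]$ with $\int_\gamma\rho\,ds\geqslant1$ for all locally rectifiable $\gamma\in\Gamma$. Definition. For a Lebesgue measurable function $Q_*$ with values in $[0,\infty]$, $f$ satisfies the inverse Poletsky inequality at $y_0\in\overline{f(D)}\setminus\{\infty\}$ with respect to $\alpha$-modulus (with $Q_*$) if there is $R_0>0$ such that $$M_\alpha(\Gamma_f(y_0,C_1,C_2))\leqslant\int_{A(y_0,r_1,r_2)\cap f(D)}Q_*(y)\,\eta^\alpha(|y-y_0|)\,dm(y)$$ for any $0<r_1<r_2<R_0$, any continua $C_1\subset\overline{B(y_0,r_1)}\cap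 f(D)$ and $C_2\subset f(D)\setminus B(y_0,r_2)$, and any Lebesgue measurable $\eta:(r_1,r_2)\rightarrow[0,\infty]$ with $\int_{r_1}^{r_2}\eta(r)\,dr\geqslant1$. *)

theory Defs
  imports "HOL-Analysis.Analysis"
begin

text \<open>Real powers on \<open>[0,\<infinity>]\<close>, meant for exponents \<open>a > 0\<close>
  (so that \<open>0\<close> and \<open>\<infinity>\<close> are mapped to themselves).\<close>

definition enn_powr :: "ennreal \<Rightarrow> real \<Rightarrow> ennreal" where
  "enn_powr x a = (if x = top then top else ennreal (enn2real x powr a))"

text \<open>The \<open>k\<close>-dimensional Hausdorff outer measure, normalised to agree with Lebesgue measure in
  dimension \<open>k\<close>. The covering sets must be bounded because \<^const>\<open>diameter\<close> is meaningful only
  for those, and the empty set is excluded from the sum because of \<open>0 ^ 0 = 1\<close>.\<close>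

definition hausdorff_content :: "nat \<Rightarrow> real \<Rightarrow> 'a::metric_space set \<Rightarrow> ennreal" where
  "hausdorff_content k \<delta> E =
     (INF C \<in> {C :: nat \<Rightarrow> 'a set. E \<subseteq> (\<Union>i. C i) \<and> (\<forall>i. bounded (C i) \<and> diameter (C i) \<le> \<delta>)}.
        \<Sum>i. if C i = {} then 0
             else ennreal (unit_ball_vol (real k) * (diameter (C i) / 2) ^ k))"

definition hausdorff_measure :: "nat \<Rightarrow> 'a::metric_space set \<Rightarrow> ennreal" where
  "hausdorff_measure k E = (SUP \<delta> \<in> {0<..}. hausdorff_content k \<delta> E)"

definition annulus :: "'a::metric_space \<Rightarrow> real \<Rightarrow> real \<Rightarrow> 'a set" where
  "annulus y0 r1 r2 = {y. r1 < dist y0 y \<and> dist y0 y < r2}"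

definition continuum :: "'a::topological_space set \<Rightarrow> bool" where
  "continuum C \<longleftrightarrow> compact C \<and> connected C \<and> C \<noteq> {}"

text \<open>The triple \<open>(a, b, \<gamma>)\<close> stands for the path \<open>\<gamma> : [a,b] \<rightarrow> 'a\<close>;
  the values of \<open>\<gamma>\<close> off \<open>[a,b]\<close> play no role.\<close>

type_synonym 'a interval_path = "real \<times> real \<times> (real \<Rightarrow> 'a)"

definition is_path :: "'a::topological_space interval_path \<Rightarrow> bool" where
  "is_path = (\<lambda>(a, b, \<gamma>). a < b \<and> continuous_on {a..b} \<gamma>)"

definition arc_length :: "(real \<Rightarrow> 'a::metric_space) \<Rightarrow> real \<Rightarrow> real \<Rightarrow> ennreal" where
  "arc_length \<gamma> a b =
     (SUP (m, t) \<in> {(m :: nat, t :: nat \<Rightarrow> real). mono_on {..m} t \<and> t ` {..m} \<subseteq> {a..b}}.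
        \<Sum>i<m. ennreal (dist (\<gamma> (t i)) (\<gamma> (t (Suc i)))))"

text \<open>All paths considered here have a compact parameter interval; for them local rectifiability
  and rectifiability are the same.\<close>

definition rectifiable :: "'a::metric_space interval_path \<Rightarrow> bool" where
  "rectifiable = (\<lambda>(a, b, \<gamma>). arc_length \<gamma> a b < top)"

text \<open>The normal representation \<open>\<gamma>\<^sup>0 : [0, l(\<gamma>)] \<rightarrow> 'a\<close> of a rectifiable path, characterised by
  \<open>\<gamma> t = \<gamma>\<^sup>0 (s t)\<close>, where \<open>s t\<close> is the length of \<open>\<gamma>\<close> on \<open>[a,t]\<close>. The choice made by \<^const>\<open>inv_into\<close>
  is immaterial, since \<open>\<gamma>\<close> is constant on the level sets of \<open>s\<close>.\<close>

definition normal_rep :: "'a::metric_space interval_path \<Rightarrow> real \<Rightarrow> 'a" where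
  "normal_rep = (\<lambda>(a, b, \<gamma>) u. \<gamma> (inv_into {a..b} (\<lambda>t. arc_length \<gamma> a t) (ennreal u)))"

definition line_integral :: "'a::metric_space interval_path \<Rightarrow> ('a \<Rightarrow> ennreal) \<Rightarrow> ennreal" where
  "line_integral p \<rho> =
     (case p of (a, b, \<gamma>) \<Rightarrow>
        \<integral>\<^sup>+u \<in> {0..enn2real (arc_length \<gamma> a b)}. \<rho> (normal_rep p u) \<partial>lborel)"

definition admissible :: "'a::euclidean_space interval_path set \<Rightarrow> ('a \<Rightarrow> ennreal) \<Rightarrow> bool" where
  "admissible \<Gamma> \<rho> \<longleftrightarrow>
     \<rho> \<in> borel_measurable borel \<and> (\<forall>p\<in>\<Gamma>. rectifiable p \<longrightarrow> 1 \<le> line_integral p \<rho>)"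

definition path_modulus :: "real \<Rightarrow> 'a::euclidean_space interval_path set \<Rightarrow> ennreal" where
  "path_modulus \<alpha> \<Gamma> = (INF \<rho> \<in> {\<rho>. admissible \<Gamma> \<rho>}. \<integral>\<^sup>+x. enn_powr (\<rho> x) \<alpha> \<partial>lborel)"

text \<open>The family \<open>\<Gamma>(E,F,G)\<close>. Since \<open>E\<close>, \<open>F\<close> and \<open>G\<close> are subsets of the finite space, its members
  never pass through the point at infinity.\<close>

definition joining_paths ::
  "'a::topological_space set \<Rightarrow> 'a set \<Rightarrow> 'a set \<Rightarrow> 'a interval_path set" where
  "joining_paths E F G =
     {(a, b, \<gamma>). is_path (a, b, \<gamma>) \<and> \<gamma> a \<in> E \<and> \<gamma> b \<in> F \<and> (\<forall>t\<in>{a<..<b}. \<gamma> t \<in> G)}"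

text \<open>The family \<open>\<Gamma>\<^sub>f(y\<^sub>0,C\<^sub>1,C\<^sub>2)\<close>, with the domain \<open>D\<close> of \<open>f\<close> and the radii made explicit.\<close>

definition lifted_paths ::
  "('a::metric_space \<Rightarrow> 'b::metric_space) \<Rightarrow> 'a set \<Rightarrow> 'b \<Rightarrow> real \<Rightarrow> real \<Rightarrow> 'b set \<Rightarrow> 'b set
    \<Rightarrow> 'a interval_path set" where
  "lifted_paths f D y0 r1 r2 C1 C2 =
     {(a, b, \<gamma>). is_path (a, b, \<gamma>) \<and> \<gamma> ` {a..b} \<subseteq> D \<and>
        (a, b, f \<circ> \<gamma>) \<in> joining_paths C1 C2 (annulus y0 r1 r2)}"

definition discrete_map_on :: "'a::topological_space set \<Rightarrow> ('a \<Rightarrow> 'b) \<Rightarrow> bool" where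
  "discrete_map_on D f \<longleftrightarrow> (\<forall>y. discrete {x\<in>D. f x = y})"

definition N_Luzin :: "'a::euclidean_space set \<Rightarrow> ('a \<Rightarrow> 'a) \<Rightarrow> bool" where
  "N_Luzin D f \<longleftrightarrow> (\<forall>E. E \<subseteq> D \<longrightarrow> E \<in> null_sets lebesgue \<longrightarrow> f ` E \<in> null_sets lebesgue)"

text \<open>The \<open>N\<^sup>-\<^sup>1\<close>-property of \<open>f : D \<rightarrow> 'b\<close> on \<open>S \<inter> f(D)\<close> relative to the \<open>k\<close>-dimensional Hausdorff measure.\<close>

definition N_inverse_on ::
  "nat \<Rightarrow> 'a::metric_space set \<Rightarrow> ('a \<Rightarrow> 'b::metric_space) \<Rightarrow> 'b set \<Rightarrow> bool" where
  "N_inverse_on k D f S \<longleftrightarrow>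
     (\<forall>E. E \<subseteq> S \<inter> f ` D \<longrightarrow> hausdorff_measure k E = 0 \<longrightarrow> hausdorff_measure k (D \<inter> f -` E) = 0)"

definition jacobian_det :: "(real^'n \<Rightarrow> real^'n) \<Rightarrow> real^'n \<Rightarrow> real" where
  "jacobian_det f x = det (jacobian f (at x))"

text \<open>Points where \<open>f\<close> is not differentiable fall under the last case.\<close>

definition outer_dilatation :: "real \<Rightarrow> (real^'n \<Rightarrow> real^'n) \<Rightarrow> real^'n \<Rightarrow> ennreal" where
  "outer_dilatation \<alpha> f x =
     (if f differentiable (at x) \<and> jacobian_det f x \<noteq> 0
        then ennreal (onorm (frechet_derivative f (at x)) powr \<alpha> / \<bar>jacobian_det f x\<bar>)
      else if f differentiable (at x) \<and> frechet_derivative f (at x) = (\<lambda>h. 0) then 1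
      else top)"

text \<open>Only the values at points \<open>y\<close> that are not images of points of non-differentiability matter;
  under the \<open>N\<close>-Luzin property and differentiability almost everywhere this is almost every \<open>y\<close>.\<close>

definition inverse_dilatation ::
  "real \<Rightarrow> (real^'n) set \<Rightarrow> (real^'n \<Rightarrow> real^'n) \<Rightarrow> real^'n \<Rightarrow> ennreal" where
  "inverse_dilatation \<alpha> D f y = (\<Sum>\<^sub>\<infinity>x\<in>{x\<in>D. f x = y}. outer_dilatation \<alpha> f x)"

text \<open>The number of preimages is taken in \<open>[0,\<infinity>]\<close>, because \<^const>\<open>card\<close> is \<open>0\<close> on infinite sets.\<close>

definition multiplicity_on :: "'a set \<Rightarrow> ('a \<Rightarrow> 'b) \<Rightarrow> ennreal" where
  "multiplicity_on D f = (SUP y. emeasure (count_space UNIV) {x\<in>D. f x = y})"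

text \<open>Integrals of non-negative functions here are taken in \<open>[0,\<infinity>]\<close>.
  For \<open>r\<^sub>2\<close> not below \<open>sup |y - y\<^sub>0|\<close> over \<open>y \<in> f(D)\<close>, with \<open>f(D)\<close> open, no continuum \<open>C\<^sub>2\<close> exists,
  so the bound on \<open>r\<^sub>2\<close> that comes with \<open>\<Gamma>\<^sub>f\<close> need not be imposed.\<close>

definition inverse_Poletsky_at ::
  "real \<Rightarrow> 'a::euclidean_space set \<Rightarrow> ('a \<Rightarrow> 'a) \<Rightarrow> ('a \<Rightarrow> ennreal) \<Rightarrow> 'a \<Rightarrow> bool" where
  "inverse_Poletsky_at \<alpha> D f Q y0 \<longleftrightarrow>
     Q \<in> borel_measurable (lebesgue_on (f ` D)) \<and>
     (\<exists>R0>0. \<forall>r1 r2 C1 C2 \<eta>.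
        0 < r1 \<longrightarrow> r1 < r2 \<longrightarrow> r2 < R0 \<longrightarrow>
        continuum C1 \<longrightarrow> C1 \<subseteq> closure (ball y0 r1) \<inter> f ` D \<longrightarrow>
        continuum C2 \<longrightarrow> C2 \<subseteq> f ` D - ball y0 r2 \<longrightarrow>
        \<eta> \<in> borel_measurable (lebesgue_on {r1<..<r2}) \<longrightarrow>
        1 \<le> (\<integral>\<^sup>+r\<in>{r1<..<r2}. \<eta> r \<partial>lebesgue) \<longrightarrow>
        path_modulus \<alpha> (lifted_paths f D y0 r1 r2 C1 C2)
          \<le> (\<integral>\<^sup>+y\<in>annulus y0 r1 r2 \<inter> f ` D. Q y * enn_powr (\<eta> (norm (y - y0))) \<alpha> \<partial>lebesgue))"

end

theory Submission
  imports Defs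
begin

text \<open>Let \<open>u x = \<bar>f x - y0\<bar>\<close>. The natural test function for \<open>\<Gamma>\<^sub>f\<close> is \<open>\<eta>(u) \<parallel>f'\<parallel>\<close> on the set \<open>G\<close> of points of
  differentiability with \<open>J \<noteq> 0\<close>; by the change of variables, the integral of its \<open>\<alpha>\<close>-th power is at most
  \<open>\<integral> Q \<eta>\<^sup>\<alpha>(\<bar>y - y0\<bar>) dy\<close>. The point is its admissibility, that is, absolute continuity of \<open>u\<close> along curves.
  Since \<open>f(D - G)\<close> is a null set, the \<open>N\<^sup>-\<^sup>1\<close>-property on spheres shows that for almost every \<open>r\<close> the level set
  \<open>{u = r}\<close> is contained in \<open>G\<close> up to an \<open>\<H>\<^sup>n\<^sup>-\<^sup>1\<close>-null set. An \<open>\<H>\<^sup>n\<^sup>-\<^sup>1\<close>-null set is missed by almost all of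
  the perturbations \<open>t \<mapsto> c t + \<delta>(c t) h\<close>, \<open>\<bar>h\<bar> < 1\<close>, of a rectifiable curve \<open>c\<close> in \<open>D\<close>. By Fubini, along almost
  every such curve almost every level between the end values of \<open>u\<close> is attained in \<open>G\<close>, where \<open>u\<close> is piecewise
  Lipschitz with constants close to \<open>\<parallel>f'\<parallel>\<close>. So the average over \<open>h\<close> of the test function is admissible up to a
  factor close to \<open>1\<close>, and by Jensen's inequality averaging costs only another such factor, if the Lipschitz
  constant of the gauge \<open>\<delta>\<close> is small.\<close>

section \<open>Change of variables over an arbitrary finite index type\<close>

text \<open>The obstacle is that \<open>f\<close> is merely differentiable almost everywhere:
  nothing makes u absolutely continuous along a given curve. The perturbation helps because h can be
  recovered from the point hit: z = c t + \<delta>(c t) h gives h = (z - c t) / \<delta>(c t), a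
  Lipschitz function of (z, t). When z ranges over an H^(n-1)-null set and t over an interval, these
  h form a Lebesgue null set. Averaging over h then serves every rectifiable curve at once, with no
  exceptional family. The gauge is positive on D and so small that u varies by at most \<epsilon>
  over the ball of radius \<delta> x. Perturbed curves thus stay in D and still cross all levels in
  (r1 + \<epsilon>, r2 - \<epsilon>); monotone convergence recovers (r1, r2). Up to a set with null
  image, G is cut into compact pieces on which norm and Jacobian are comparable to powers of some q
  > 1. Compactness makes the sets of crossed levels Borel, as Fubini requires; constants reduce the
  change of variables to inequalities between measures. One small parameter serves as \<epsilon>, as
  Lipschitz constant of \<delta> and as q - 1.\<close>

text \<open>The change-of-variables theory of \<^theory>\<open>HOL-Analysis.Change_Of_Vars\<close> is only available for
  well-ordered index types. The copy \<open>'a wo\<close> of a finite type carries some well-order.\<close>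

typedef 'a wo = "UNIV :: 'a set" morphisms of_wo to_wo by simp

lemma to_wo_of_wo [simp]: "to_wo (of_wo i) = i"
  by (rule of_wo_inverse)

lemma of_wo_to_wo [simp]: "of_wo (to_wo i) = i"
  by (simp add: to_wo_inverse)

lemma bij_of_wo: "bij of_wo"
  by (rule bijI') (auto simp: of_wo_inject intro: of_wo_to_wo[symmetric])

lemma bij_to_wo: "bij to_wo"
  by (metis bij_betw_byWitness of_wo_to_wo subset_UNIV to_wo_of_wo)

instance wo :: (finite) finite
proof
  have "(UNIV :: 'a wo set) = to_wo ` UNIV"
    by (metis bij_to_wo bij_is_surj)
  then show "finite (UNIV :: 'a wo set)"
    by (metis finite finite_imageI)
qed

definition wo_rank :: "'a::finite wo \<Rightarrow> nat" where
  "wo_rank = (SOME r. inj r)"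

lemma inj_wo_rank: "inj (wo_rank :: 'a::finite wo \<Rightarrow> nat)"
proof -
  have "\<exists>r :: 'a wo \<Rightarrow> nat. inj r"
    using finite_imp_inj_to_nat_seg[of "UNIV :: 'a wo set"] by auto
  then show ?thesis
    unfolding wo_rank_def by (rule someI_ex)
qed

instantiation wo :: (finite) wellorder
begin

definition less_eq_wo :: "'a wo \<Rightarrow> 'a wo \<Rightarrow> bool" where
  "less_eq_wo i j \<longleftrightarrow> wo_rank i \<le> wo_rank j"

definition less_wo :: "'a wo \<Rightarrow> 'a wo \<Rightarrow> bool" where
  "less_wo i j \<longleftrightarrow> wo_rank i < wo_rank j"

instance
proof
  fix i j k :: "'a wo" and P :: "'a wo \<Rightarrow> bool"
  show "(i < j) = (i \<le> j \<and> \<not> j \<le> i)" "i \<le> i" "i \<le> j \<or> j \<le> i"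
    by (auto simp: less_eq_wo_def less_wo_def)
  show "i \<le> j \<Longrightarrow> j \<le> k \<Longrightarrow> i \<le> k"
    by (auto simp: less_eq_wo_def)
  show "i \<le> j \<Longrightarrow> j \<le> i \<Longrightarrow> i = j"
    using inj_wo_rank by (auto simp: less_eq_wo_def inj_def)
  assume step: "\<And>i. (\<And>j. j < i \<Longrightarrow> P j) \<Longrightarrow> P i"
  show "P i"
    by (induction i rule: measure_induct_rule[of wo_rank]) (auto intro: step simp: less_wo_def)
qed

end

section \<open>Transport of vectors, determinants and Lebesgue measure to the copied index
  type\<close>

definition wo_vec :: "'a^'n::finite \<Rightarrow> 'a^('n wo)" where
  "wo_vec x = (\<chi> i. x $ of_wo i)"

definition unwo_vec :: "'a^('n wo) \<Rightarrow> 'a^'n::finite" where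
  "unwo_vec x = (\<chi> i. x $ to_wo i)"

lemma unwo_wo_vec [simp]: "unwo_vec (wo_vec x) = x" "wo_vec (unwo_vec y) = y"
  by (simp_all add: wo_vec_def unwo_vec_def vec_eq_iff)

lemma linear_wo_vec: "linear (wo_vec :: real^'n::finite \<Rightarrow> _)" "linear (unwo_vec :: _ \<Rightarrow> real^'n::finite)"
  by (auto simp: wo_vec_def unwo_vec_def vec_eq_iff intro!: linearI)

lemma wo_vec_axis: "wo_vec (axis (of_wo i) (1::real)) = axis i 1"
  "unwo_vec (axis i (1::real)) = axis (of_wo i) 1"
  by (auto simp: wo_vec_def unwo_vec_def axis_def vec_eq_iff of_wo_inject)

text \<open>Conjugation by \<open>of_wo\<close> is a sign-preserving bijection between the
  permutations of the two index types, so the Leibniz sums agree term by term.\<close>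

lemma det_reindex_wo:
  fixes A :: "real^'n::finite^'n"
  shows "det (\<chi> i j. A $ of_wo i $ of_wo j) = det A"
proof -
  let ?m = "map_permutation (UNIV :: 'n wo set) of_wo"
  have bij: "bij_betw ?m {p. p permutes UNIV} {p. p permutes (UNIV :: 'n set)}"
  proof (rule bij_betw_byWitness[where f' = "map_permutation UNIV to_wo"])
    show "\<forall>p\<in>{p. p permutes UNIV}. map_permutation UNIV to_wo (?m p) = p"
      by (auto intro!: map_permutation_compose_inv[OF bij_of_wo])
    show "\<forall>p\<in>{p. p permutes UNIV}. ?m (map_permutation UNIV to_wo p) = p"
      by (auto intro!: map_permutation_compose_inv[OF bij_to_wo])
    show "?m ` {p. p permutes UNIV} \<subseteq> {p. p permutes UNIV}"
      using map_permutation_permutes[OF bij_of_wo] by auto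
    show "map_permutation UNIV to_wo ` {p. p permutes UNIV} \<subseteq> {p. p permutes (UNIV :: 'n wo set)}"
      using map_permutation_permutes[OF bij_to_wo] by auto
  qed
  have "det A = (\<Sum>p | p permutes (UNIV :: 'n wo set). of_int (sign (?m p)) * (\<Prod>i\<in>UNIV. A $ i $ ?m p i))"
    unfolding det_def
    by (rule sum.reindex_bij_betw[OF bij, of "\<lambda>q. of_int (sign q) * (\<Prod>i\<in>UNIV. A $ i $ q i)", symmetric])
  also have "\<dots> = det (\<chi> i j. A $ of_wo i $ of_wo j)"
    unfolding det_def
  proof (intro sum.cong refl)
    fix p :: "'n wo \<Rightarrow> 'n wo" assume "p \<in> {p. p permutes UNIV}"
    then have p: "p permutes UNIV" by simp
    have "inj (of_wo :: 'n wo \<Rightarrow> 'n)" using bij_of_wo by (rule bij_is_inj)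
    then have m: "?m p (of_wo i) = of_wo (p i)" for i
      by (simp add: map_permutation_apply)
    have "(\<Prod>i\<in>UNIV. A $ i $ ?m p i) = (\<Prod>i\<in>UNIV. A $ of_wo i $ ?m p (of_wo i))"
      using prod.reindex_bij_betw[OF bij_of_wo, of "\<lambda>i. A $ i $ ?m p i"] by simp
    then show "of_int (sign (?m p)) * (\<Prod>i\<in>UNIV. A $ i $ ?m p i)
      = of_int (sign p) * (\<Prod>i\<in>UNIV. (\<chi> i j. A $ of_wo i $ of_wo j) $ i $ p i)"
      using sign_map_permutation[OF \<open>inj of_wo\<close> p] by (simp add: m)
  qed
  finally show ?thesis by simp
qed

lemma det_matrix_wo:
  fixes T :: "real^'n::finite \<Rightarrow> real^'n"
  shows "det (matrix (wo_vec \<circ> T \<circ> unwo_vec)) = det (matrix T)"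
proof -
  have "matrix (wo_vec \<circ> T \<circ> unwo_vec) = (\<chi> i j. matrix T $ of_wo i $ of_wo j)"
    by (simp add: matrix_def vec_eq_iff wo_vec_axis) (simp add: wo_vec_def)
  then show ?thesis
    using det_reindex_wo by metis
qed

text \<open>By \<open>lborel_eqI\<close> it suffices to look at boxes, and the preimage of a box is
  a box with the same side lengths in another order.\<close>

lemma distr_wo_vec: "distr lborel borel (wo_vec :: real^'n::finite \<Rightarrow> _) = lborel"
proof (rule lborel_eqI[symmetric])
  fix l u :: "real^('n wo)"
  assume le: "\<And>b. b \<in> Basis \<Longrightarrow> l \<bullet> b \<le> u \<bullet> b"
  have meas: "(wo_vec :: real^'n \<Rightarrow> _) \<in> borel_measurable borel"
    using linear_wo_vec(1) by (intro borel_measurable_continuous_onI linear_continuous_on) (simp add: linear_conv_bounded_linear)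
  have le': "l $ i \<le> u $ i" for i
    using le[of "axis i 1"] by (simp add: inner_axis axis_in_Basis_iff)
  have vim: "wo_vec -` box l u = box (unwo_vec l) (unwo_vec u :: real^'n)"
    by (auto simp: mem_box_cart wo_vec_def unwo_vec_def) (metis of_wo_to_wo to_wo_of_wo)+
  have prod_Basis: "(\<Prod>b\<in>Basis. x \<bullet> b) = (\<Prod>i\<in>UNIV. x $ i)" for x :: "real^'m::finite"
    by (subst prod.reindex_bij_betw[of "\<lambda>i. axis i 1" UNIV Basis, symmetric])
      (auto simp: inner_axis bij_betw_def inj_on_def axis_eq_axis Basis_vec_def)
  have "emeasure (distr lborel borel wo_vec) (box l u) = emeasure lborel (box (unwo_vec l) (unwo_vec u :: real^'n))"
    using meas by (simp add: emeasure_distr vim)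
  also have "\<dots> = (\<Prod>b\<in>Basis. (unwo_vec u - unwo_vec l :: real^'n) \<bullet> b)"
    by (rule emeasure_lborel_box) (auto simp: Basis_vec_def inner_axis unwo_vec_def le')
  also have "(\<Prod>b\<in>Basis. (unwo_vec u - unwo_vec l :: real^'n) \<bullet> b) = (\<Prod>b\<in>Basis. (u - l) \<bullet> b)"
    unfolding prod_Basis
    using prod.reindex_bij_betw[OF bij_to_wo, of "\<lambda>i. (u - l) $ i"] by (simp add: unwo_vec_def)
  finally show "emeasure (distr lborel borel wo_vec) (box l u) = (\<Prod>b\<in>Basis. (u - l) \<bullet> b)" .
qed simp

lemma fsigma_imp_sets_borel:
  assumes "fsigma S" shows "S \<in> sets borel"
  using assms by (rule fsigma.cases) auto

lemma image_wo_vec: "wo_vec ` S = unwo_vec -` S" "unwo_vec ` T = wo_vec -` T"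
  by (auto simp: image_iff) (metis unwo_wo_vec)+

text \<open>\<open>distr_wo_vec\<close> settles Borel sets. A Lebesgue set is an F-sigma set
  together with a null set, and the linear map sends null sets to null sets.\<close>

lemma lebesgue_wo_vec:
  fixes S :: "(real^'n::finite) set"
  assumes "S \<in> sets lebesgue"
  shows "wo_vec ` S \<in> sets lebesgue" "emeasure lebesgue (wo_vec ` S) = emeasure lebesgue S"
proof -
  have card: "CARD('n wo) = CARD('n)"
    by (rule bij_betw_same_card[OF bij_of_wo])
  have diff: "(wo_vec :: real^'n \<Rightarrow> _) differentiable_on X" for X
    by (simp add: linear_imp_differentiable_on linear_wo_vec)
  show "wo_vec ` S \<in> sets lebesgue"
    using assms by (rule differentiable_image_in_sets_lebesgue) (simp_all add: card diff)
  have cont: "continuous_on UNIV (wo_vec :: real^'n \<Rightarrow> _)" "continuous_on UNIV (unwo_vec :: _ \<Rightarrow> real^'n)"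
    using linear_wo_vec by (auto intro!: linear_continuous_on simp: linear_conv_bounded_linear)
  obtain C T where CT: "fsigma C" "T \<in> null_sets lebesgue" "C \<union> T = S"
    using lebesgue_set_almost_fsigma[OF assms] by metis
  have C: "C \<in> sets borel"
    using CT(1) by (rule fsigma_imp_sets_borel)
  have WC: "wo_vec ` C \<in> sets borel"
    unfolding image_wo_vec using borel_measurable_continuous_onI[OF cont(2)] C
    by (metis measurable_sets_borel)
  have WT: "wo_vec ` T \<in> null_sets lebesgue"
    using CT(2) negligible_differentiable_image_negligible[OF _ _ diff, of T]
    by (simp add: negligible_iff_null_sets card)
  have "emeasure lebesgue (wo_vec ` S) = emeasure lebesgue (wo_vec ` C \<union> wo_vec ` T)"
    by (simp add: CT(3)[symmetric] image_Un)
  also have "\<dots> = emeasure lebesgue (wo_vec ` C)"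
    by (rule emeasure_Un_null_set) (use WC WT in auto)
  also have "\<dots> = emeasure lborel (wo_vec ` C)"
    using WC by simp
  also have "\<dots> = emeasure (distr lborel borel wo_vec) (wo_vec ` C)"
    by (simp add: distr_wo_vec)
  also have "\<dots> = emeasure lborel C"
  proof -
    have "wo_vec -` (wo_vec ` C) = C"
      by (auto simp: image_iff) (metis unwo_wo_vec(1))
    then show ?thesis
      using WC borel_measurable_continuous_onI[OF cont(1)] by (simp add: emeasure_distr)
  qed
  also have "\<dots> = emeasure lebesgue C"
    using C by simp
  also have "\<dots> = emeasure lebesgue S"
    unfolding CT(3)[symmetric] by (rule emeasure_Un_null_set[symmetric]) (use C CT in auto)
  finally show "emeasure lebesgue (wo_vec ` S) = emeasure lebesgue S" .
qed

lemma has_derivative_wo: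
  fixes f :: "real^'n::finite \<Rightarrow> real^'n"
  assumes "(f has_derivative f') (at x within S)"
  shows "((wo_vec \<circ> f \<circ> unwo_vec) has_derivative (wo_vec \<circ> f' \<circ> unwo_vec)) (at (wo_vec x) within wo_vec ` S)"
proof -
  have lin: "bounded_linear (wo_vec :: real^'n \<Rightarrow> _)" "bounded_linear (unwo_vec :: _ \<Rightarrow> real^'n)"
    using linear_wo_vec by (simp_all add: linear_conv_bounded_linear)
  have 1: "((\<lambda>y. f (unwo_vec y)) has_derivative (\<lambda>h. f' (unwo_vec h))) (at (wo_vec x) within wo_vec ` S)"
    using bounded_linear_imp_has_derivative[OF lin(2)]
    by (rule has_derivative_in_compose) (simp add: image_image assms)
  show ?thesis
    using bounded_linear.has_derivative[OF lin(1) 1] by (simp add: o_def)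
qed

text \<open>Conjugating \<open>f\<close> by \<open>wo_vec\<close> changes neither the determinant
  nor measurability. This allows points to be sorted by the size of the Jacobian.\<close>

lemma det_derivative_measurable:
  fixes f :: "real^'n::finite \<Rightarrow> real^'n"
  assumes S: "S \<in> sets lebesgue" and der: "\<And>x. x \<in> S \<Longrightarrow> (f has_derivative f' x) (at x within S)"
    and B: "B \<in> sets borel"
  shows "{x\<in>S. det (matrix (f' x)) \<in> B} \<in> sets lebesgue"
proof -
  let ?S = "wo_vec ` S"
  let ?g' = "\<lambda>y. wo_vec \<circ> f' (unwo_vec y) \<circ> unwo_vec"
  have "(\<lambda>y. det (matrix (?g' y))) \<in> borel_measurable (lebesgue_on ?S)"
    by (rule borel_measurable_det_Jacobian[OF lebesgue_wo_vec(1)[OF S], where f = "wo_vec \<circ> f \<circ> unwo_vec"])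
      (auto simp: intro!: has_derivative_wo[unfolded o_def] der simp: o_def)
  then have "(\<lambda>y. det (matrix (f' (unwo_vec y)))) \<in> borel_measurable (lebesgue_on ?S)"
    by (simp only: det_matrix_wo)
  then have "{y \<in> ?S. det (matrix (f' (unwo_vec y))) \<in> B} \<in> sets lebesgue"
    using B lebesgue_wo_vec(1)[OF S] measurable_sets[of _ "lebesgue_on ?S" borel B]
    by (simp add: vimage_def Int_def conj_commute sets_restrict_space_iff) (smt (verit) Collect_cong)
  then have "unwo_vec ` {y \<in> ?S. det (matrix (f' (unwo_vec y))) \<in> B} \<in> sets lebesgue"
    using bij_betw_same_card[OF bij_of_wo[where 'a = 'n]]
    by (intro differentiable_image_in_sets_lebesgue linear_imp_differentiable_on linear_wo_vec) simp_all
  also have "unwo_vec ` {y \<in> ?S. det (matrix (f' (unwo_vec y))) \<in> B} = {x\<in>S. det (matrix (f' x)) \<in> B}"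
    by (auto simp: image_image intro!: rev_image_eqI)
  finally show ?thesis .
qed

text \<open>Change of variables for the conjugated map, with the Jacobian bounded below by
  \<open>b\<close>. Boundedness of the image gives it finite measure, which
  \<open>has_measure_differentiable_image\<close> asks for before it yields the integral.\<close>

lemma emeasure_injective_image_ge:
  fixes f :: "real^'n::finite \<Rightarrow> real^'n"
  assumes S: "S \<in> sets lebesgue" and der: "\<And>x. x \<in> S \<Longrightarrow> (f has_derivative f' x) (at x within S)"
    and inj: "inj_on f S" and bd: "bounded (f ` S)"
    and b: "\<And>x. x \<in> S \<Longrightarrow> b \<le> \<bar>det (matrix (f' x))\<bar>" "0 \<le> b"
  shows "ennreal b * emeasure lebesgue S \<le> emeasure lebesgue (f ` S)"
proof -
  let ?S = "wo_vec ` S" and ?g = "wo_vec \<circ> f \<circ> unwo_vec"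
  let ?d = "\<lambda>y. \<bar>det (matrix (f' (unwo_vec y)))\<bar>"
  have S': "?S \<in> sets lebesgue" by (rule lebesgue_wo_vec(1)[OF S])
  have img: "?g ` ?S = wo_vec ` f ` S"
    by (simp add: image_image)
  have fS: "f ` S \<in> sets lebesgue"
    using der by (intro differentiable_image_in_sets_lebesgue[OF S]) (auto simp: differentiable_on_def differentiable_def)
  have lm: "?g ` ?S \<in> lmeasurable"
  proof -
    have "f ` S \<in> lmeasurable"
      using bd fS by (rule bounded_set_imp_lmeasurable)
    then show ?thesis
      unfolding img using lebesgue_wo_vec[OF fS] unfolding fmeasurable_def by (metis (mono_tags, lifting) mem_Collect_eq)
  qed
  have der': "(?g has_derivative (wo_vec \<circ> f' (unwo_vec y) \<circ> unwo_vec)) (at y within ?S)" if "y \<in> ?S" for y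
    using that by (auto simp: intro!: has_derivative_wo[unfolded o_def] der simp: o_def)
  have inj': "inj_on ?g ?S"
    using inj by (auto simp: inj_on_def) (metis unwo_wo_vec(1))
  have "(?d has_integral measure lebesgue (?g ` ?S)) ?S"
    using has_measure_differentiable_image[OF S', of ?g "\<lambda>y. wo_vec \<circ> f' (unwo_vec y) \<circ> unwo_vec", OF der' inj', of "measure lebesgue (?g ` ?S)"] lm
    unfolding det_matrix_wo by blast
  then have nn: "(\<integral>\<^sup>+y. ennreal (?d y) * indicator ?S y \<partial>lebesgue) = ennreal (measure lebesgue (?g ` ?S))"
    by (subst nn_integral_completion) (rule nn_integral_has_integral_lebesgue', auto)
  have "ennreal b * emeasure lebesgue S = (\<integral>\<^sup>+y. ennreal b * indicator ?S y \<partial>lebesgue)"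
    using S' lebesgue_wo_vec(2)[OF S] by (simp add: nn_integral_cmult_indicator)
  also have "\<dots> \<le> (\<integral>\<^sup>+y. ennreal (?d y) * indicator ?S y \<partial>lebesgue)"
    by (intro nn_integral_mono) (auto simp: indicator_def intro!: ennreal_leI b)
  also have "\<dots> = emeasure lebesgue (?g ` ?S)"
    using nn lm by (simp add: emeasure_eq_measure2)
  also have "\<dots> = emeasure lebesgue (f ` S)"
    unfolding img by (rule lebesgue_wo_vec(2)[OF fS])
  finally show ?thesis .
qed

section \<open>Lipschitz images on the line\<close>

text \<open>Both sides integrate \<open>w\<close> against image measures of weighted Lebesgue
  measures, and \<open>le\<close> compares these on Borel sets. Every passage from measures of
  images to integrals goes through here: on the line for Lipschitz functions, in space for
  \<open>f\<close> on its pieces.\<close>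

lemma nn_integral_restrict_le_of_vimage_le:
  fixes T T' :: "'a::euclidean_space \<Rightarrow> 'a" and w :: "'a \<Rightarrow> ennreal"
  assumes T: "T \<in> borel_measurable lebesgue" "A \<in> sets lebesgue"
    and T': "T' \<in> borel_measurable lebesgue" "A' \<in> sets lebesgue" and w: "w \<in> borel_measurable borel"
    and le: "\<And>B. B \<in> sets borel \<Longrightarrow> c * emeasure lebesgue (A \<inter> T -` B) \<le> c' * emeasure lebesgue (A' \<inter> T' -` B)"
  shows "(\<integral>\<^sup>+x. c * indicator A x * w (T x) \<partial>lebesgue) \<le> (\<integral>\<^sup>+x. c' * indicator A' x * w (T' x) \<partial>lebesgue)"
proof -
  have dens: "emeasure (density lebesgue (\<lambda>x. c * indicator A x)) (T -` B) = c * emeasure lebesgue (A \<inter> T -` B)"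
    if "T \<in> borel_measurable lebesgue" "A \<in> sets lebesgue" "B \<in> sets borel" for T :: "'a \<Rightarrow> 'a" and A B c
  proof -
    have "T -` B \<in> sets lebesgue" using measurable_sets[OF that(1,3)] by simp
    moreover from this have "A \<inter> T -` B \<in> sets lebesgue" using that(2) by auto
    ultimately show ?thesis
      using that(2) by (simp add: emeasure_density mult.assoc nn_integral_cmult nn_integral_indicator flip: indicator_inter_arith)
  qed
  have "(\<integral>\<^sup>+x. w (T x) \<partial>density lebesgue (\<lambda>x. c * indicator A x)) \<le> (\<integral>\<^sup>+x. w (T' x) \<partial>density lebesgue (\<lambda>x. c' * indicator A' x))"
  proof -
    let ?M = "density lebesgue (\<lambda>x. c * indicator A x)" and ?M' = "density lebesgue (\<lambda>x. c' * indicator A' x)"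
    have "distr ?M borel T \<le> distr ?M' borel T'"
    \<comment> \<open>For measures with equal space and sigma-algebra the order compares
      \<open>emeasure\<close> on all sets; on non-measurable ones both values are 0.\<close>
    proof (intro less_eq_measure.intros(3) le_funI)
      fix B
      show "emeasure (distr ?M borel T) B \<le> emeasure (distr ?M' borel T') B"
        using T T' le[of B] by (cases "B \<in> sets borel") (simp_all add: emeasure_distr emeasure_notin_sets dens)
    qed auto
    then have "nn_integral (distr ?M borel T) w \<le> nn_integral (distr ?M' borel T') w"
      by (intro nn_integral_mono_measure) auto
    then show ?thesis using T T' w by (simp add: nn_integral_distr)
  qed
  then show ?thesis
    using T T' w measurable_compose[OF T(1) w] measurable_compose[OF T'(1) w] by (simp add: nn_integral_density)
qed

lemma le_suminf_ennreal:
  fixes f :: "nat \<Rightarrow> ennreal"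
  shows "f i \<le> (\<Sum>i. f i)"
  using sum_le_suminf[of f "{i}"] by simp

lemma lipschitz_image_lebesgue:
  fixes g :: "'a::euclidean_space \<Rightarrow> 'a"
  assumes S: "S \<in> sets lebesgue" and g: "C-lipschitz_on S g"
  shows "g ` S \<in> sets lebesgue"
proof (rule sets_lebesgue_continuous_image[OF S])
  show "continuous_on S g" using g by (rule lipschitz_on_continuous_on)
  fix T assume T: "negligible T" "T \<subseteq> S"
  show "negligible (g ` T)"
  proof (rule negligible_locally_Lipschitz_image[OF _ T(1)])
    fix x assume "x \<in> T"
    then show "\<exists>U B. open U \<and> x \<in> U \<and> (\<forall>y\<in>T \<inter> U. norm (g y - g x) \<le> B * norm (y - x))"
      using g T(2) by (intro exI[of _ UNIV] exI[of _ C]) (auto simp: lipschitz_on_def dist_norm subset_iff)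
  qed simp
qed simp

text \<open>The set lies in the interval of length \<open>d\<close> that starts at its infimum. Only
  this interval has to be measurable, so \<open>X\<close> is arbitrary.\<close>

lemma emeasure_real_le_of_dist_le:
  fixes X :: "real set"
  assumes X: "\<And>x y. x \<in> X \<Longrightarrow> y \<in> X \<Longrightarrow> dist x y \<le> d"
  shows "emeasure lebesgue X \<le> ennreal d"
proof (cases "X = {}")
  case False
  then obtain p where p: "p \<in> X" by auto
  have le: "x - d \<le> y" if "x \<in> X" "y \<in> X" for x y
    using X[OF that] by (simp add: dist_real_def abs_le_iff)
  then have bdd: "bdd_below X" using p by (intro bdd_belowI[of _ "p - d"])
  have "X \<subseteq> {Inf X .. Inf X + d}"
  proof
    fix x assume x: "x \<in> X"
    have "x - d \<le> Inf X" using p le[OF x] by (intro cInf_greatest) auto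
    then show "x \<in> {Inf X .. Inf X + d}" using cInf_lower[OF x bdd] by simp
  qed
  then have "emeasure lebesgue X \<le> emeasure lebesgue {Inf X .. Inf X + d}"
    by (rule emeasure_mono) simp
  then show ?thesis using X[OF p p] by simp
qed simp

text \<open>Dyadic subdivision of a cube yields cubes, and for a cube the n-th power of the diameter
  is sqrt(n)^n times the volume. So volume controls the sums of powers of diameters that occur in
  Hausdorff contents.\<close>

lemma outer_cover_by_cubes:
  fixes S :: "'a::euclidean_space set"
  assumes S: "S \<in> sets lebesgue" "bounded S" and e: "0 < e"
  obtains C :: "nat \<Rightarrow> 'a set" where "S \<subseteq> (\<Union>i. C i)" "\<And>i. compact (C i)"
    "\<And>i. ennreal (diameter (C i) ^ DIM('a)) \<le> ennreal (sqrt DIM('a) ^ DIM('a)) * emeasure lebesgue (C i)"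
    "(\<Sum>i. emeasure lebesgue (C i)) \<le> emeasure lebesgue S + ennreal e"
proof -
  obtain m where m: "0 < m" "\<And>x. x \<in> S \<Longrightarrow> norm x \<le> m"
    using S(2) bounded_pos by metis
  let ?a = "- m *\<^sub>R One :: 'a" and ?b = "m *\<^sub>R One :: 'a"
  have lm: "S \<in> lmeasurable" using S by (intro bounded_set_imp_lmeasurable)
  have sub: "S \<subseteq> cbox ?a ?b"
  proof
    fix x assume "x \<in> S"
    then have "\<bar>x \<bullet> i\<bar> \<le> m" if "i \<in> Basis" for i
      using m(2)[of x] Basis_le_norm[OF that, of x] by simp
    then show "x \<in> cbox ?a ?b" by (fastforce simp: mem_box abs_le_iff)
  qed
  show thesis
  proof (rule measurable_outer_intervals_bounded[OF lm sub e])
    fix \<D> assume \<D>: "countable \<D>"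
      "\<And>K. K \<in> \<D> \<Longrightarrow> K \<subseteq> cbox ?a ?b \<and> K \<noteq> {} \<and> (\<exists>c d. K = cbox c d)"
      "pairwise (\<lambda>A B. interior A \<inter> interior B = {}) \<D>"
      "\<And>u v. cbox u v \<in> \<D> \<Longrightarrow> \<exists>n. \<forall>i \<in> Basis. v \<bullet> i - u \<bullet> i = (?b \<bullet> i - ?a \<bullet> i)/2^n"
      "S \<subseteq> \<Union>\<D>" "\<Union>\<D> \<in> lmeasurable" "measure lebesgue (\<Union>\<D>) \<le> measure lebesgue S + e"
    define C where "C i = (if i \<in> to_nat_on \<D> ` \<D> then from_nat_into \<D> i else {})" for i
    have C_cases: "C i = {} \<or> C i \<in> \<D> \<and> to_nat_on \<D> (C i) = i" for i
      unfolding C_def using \<D>(1) by auto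
    have cover: "\<Union>\<D> = (\<Union>i. C i)"
    proof
      show "(\<Union>i. C i) \<subseteq> \<Union>\<D>" using C_cases by blast
      have "C (to_nat_on \<D> K) = K" if "K \<in> \<D>" for K
        using that \<D>(1) by (simp add: C_def)
      then show "\<Union>\<D> \<subseteq> (\<Union>i. C i)" by blast
    qed
    have compact: "compact (C i)" for i
      using C_cases[of i] \<D>(2) by fastforce
    have disj: "disjoint_family (\<lambda>i. interior (C i))"
      unfolding disjoint_family_on_def
    proof (intro ballI impI)
      fix i j :: nat assume "i \<noteq> j"
      then show "interior (C i) \<inter> interior (C j) = {}"
        using C_cases[of i] C_cases[of j] \<D>(3) unfolding pairwise_def by (metis Int_empty_left Int_empty_right interior_empty)
    qed
    have diam: "ennreal (diameter (C i) ^ DIM('a)) \<le> ennreal (sqrt DIM('a) ^ DIM('a)) * emeasure lebesgue (C i)" for i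
    proof (cases "C i = {}")
      case False
      then have CD: "C i \<in> \<D>" using C_cases[of i] by simp
      then obtain u v where uv: "C i = cbox u v" using \<D>(2) by blast
      obtain n where n: "\<And>j. j \<in> Basis \<Longrightarrow> v \<bullet> j - u \<bullet> j = (?b \<bullet> j - ?a \<bullet> j)/2^n"
        using \<D>(4) CD unfolding uv by blast
      define s where "s = 2 * m / 2^n"
      have s: "0 < s" "\<And>j. j \<in> Basis \<Longrightarrow> v \<bullet> j - u \<bullet> j = s"
        using n m by (auto simp: s_def)
      have le: "u \<bullet> j \<le> v \<bullet> j" if "j \<in> Basis" for j using s(2)[OF that] s(1) by simp
      have "diameter (C i) = dist u v"
        unfolding uv by (rule diameter_cbox) (use le in auto)
      also have "\<dots> = sqrt (\<Sum>j\<in>(Basis::'a set). s\<^sup>2)"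
      proof -
        have "dist (u \<bullet> j) (v \<bullet> j) = s" if "j \<in> Basis" for j
          using s(1) s(2)[OF that] by (simp add: dist_real_def)
        then show ?thesis
          unfolding euclidean_dist_l2[of u v] L2_set_def by simp
      qed
      also have "\<dots> = sqrt (real DIM('a)) * s"
        using s(1) by (simp add: real_sqrt_mult)
      finally have d: "diameter (C i) ^ DIM('a) = sqrt (real DIM('a)) ^ DIM('a) * s ^ DIM('a)"
        by (simp add: power_mult_distrib)
      have "emeasure lebesgue (C i) = ennreal (\<Prod>j\<in>(Basis::'a set). (v - u) \<bullet> j)"
        unfolding uv using le by (simp add: emeasure_lborel_cbox)
      also have "(\<Prod>j\<in>(Basis::'a set). (v - u) \<bullet> j) = s ^ DIM('a)"
        using s(2) by (simp add: inner_diff_left)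
      finally show ?thesis
        unfolding d using s(1) by (simp add: ennreal_mult)
    qed (simp add: zero_power)
    \<comment> \<open>Boxes have null boundary, so the non-overlapping closed cubes can be replaced
      by their disjoint interiors when measures are added.\<close>
    have int: "emeasure lebesgue (C i) = emeasure lebesgue (interior (C i))" for i
    proof (cases "C i = {}")
      case False
      then have "C i \<in> \<D>" using C_cases[of i] by simp
      then obtain u v where "C i = cbox u v" using \<D>(2) by blast
      then show ?thesis by (simp add: emeasure_lborel_cbox_eq emeasure_lborel_box_eq)
    qed simp
    have "(\<Sum>i. emeasure lebesgue (C i)) = emeasure lebesgue (\<Union>i. interior (C i))"
      unfolding int using disj by (simp add: suminf_emeasure image_subset_iff)
    also have "\<dots> \<le> emeasure lebesgue (\<Union>\<D>)"
      unfolding cover using \<D>(6)[unfolded cover] interior_subset by (intro emeasure_mono UN_mono) auto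
    also have "\<dots> \<le> emeasure lebesgue S + ennreal e"
      using \<D>(6,7) lm e by (simp add: emeasure_eq_measure2 flip: ennreal_plus)
    finally have sum: "(\<Sum>i. emeasure lebesgue (C i)) \<le> emeasure lebesgue S + ennreal e" .
    have "S \<subseteq> (\<Union>i. C i)" using \<D>(5) cover by simp
    then show thesis using compact diam sum by (rule that)
  qed
qed

text \<open>On the line the constant \<open>C\<close> is kept exactly: a set of diameter d has
  measure at most d, and the cube constant \<open>sqrt DIM(real)\<close> is 1. Exactness matters
  because \<open>C\<close> enters the test function.\<close>

lemma emeasure_lipschitz_image_real:
  fixes g :: "real \<Rightarrow> real"
  assumes S: "S \<in> sets lebesgue" "S \<subseteq> {a..b}" and g: "C-lipschitz_on S g"
  shows "emeasure lebesgue (g ` S) \<le> ennreal C * emeasure lebesgue S"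
proof -
  have C: "0 \<le> C" using g by (rule lipschitz_on_nonneg)
  have bS: "bounded S" using S(2) by (rule bounded_subset[OF bounded_closed_interval])
  have main: "emeasure lebesgue (g ` S) \<le> ennreal C * emeasure lebesgue S + ennreal (C * e)" if e: "0 < e" for e
  proof (rule outer_cover_by_cubes[OF S(1) bS e])
    fix K :: "nat \<Rightarrow> real set"
    assume K: "S \<subseteq> (\<Union>i. K i)" "\<And>i. compact (K i)"
      "\<And>i. ennreal (diameter (K i) ^ DIM(real)) \<le> ennreal (sqrt DIM(real) ^ DIM(real)) * emeasure lebesgue (K i)"
      "(\<Sum>i. emeasure lebesgue (K i)) \<le> emeasure lebesgue S + ennreal e"
    have im: "emeasure lebesgue (g ` (S \<inter> K i)) \<le> ennreal C * emeasure lebesgue (K i)" for i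
    proof -
      have "dist (g x) (g y) \<le> C * diameter (K i)" if "x \<in> S \<inter> K i" "y \<in> S \<inter> K i" for x y
      proof -
        have "dist (g x) (g y) \<le> C * dist x y" using that by (intro lipschitz_onD[OF g]) auto
        also have "\<dots> \<le> C * diameter (K i)"
          using that C K(2) by (intro mult_left_mono diameter_bounded_bound compact_imp_bounded) auto
        finally show ?thesis .
      qed
      then have "emeasure lebesgue (g ` (S \<inter> K i)) \<le> ennreal (C * diameter (K i))"
        by (intro emeasure_real_le_of_dist_le) blast
      also have "\<dots> = ennreal C * ennreal (diameter (K i))"
        using C K(2) by (intro ennreal_mult diameter_ge_0 compact_imp_bounded)
      also have "\<dots> \<le> ennreal C * emeasure lebesgue (K i)"
        using K(3)[of i] by (intro mult_left_mono) auto
      finally show ?thesis .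
    qed
    have eq: "g ` S = (\<Union>i. g ` (S \<inter> K i))" using K(1) by blast
    have "g ` (S \<inter> K i) \<in> sets lebesgue" for i
      using S(1) K(2)[of i] lipschitz_on_subset[OF g]
      by (intro lipschitz_image_lebesgue[where C = C]) (auto intro: lmeasurable_compact fmeasurableD)
    then have "emeasure lebesgue (g ` S) \<le> (\<Sum>i. emeasure lebesgue (g ` (S \<inter> K i)))"
      unfolding eq by (intro emeasure_subadditive_countably) auto
    also have "\<dots> \<le> (\<Sum>i. ennreal C * emeasure lebesgue (K i))"
      by (intro suminf_le im) auto
    also have "\<dots> \<le> ennreal C * (emeasure lebesgue S + ennreal e)"
      unfolding ennreal_suminf_cmult using K(4) by (rule mult_left_mono) simp
    finally show "emeasure lebesgue (g ` S) \<le> ennreal C * emeasure lebesgue S + ennreal (C * e)"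
      using C e by (simp add: distrib_left ennreal_mult)
  qed
  show ?thesis
  proof (rule ennreal_le_epsilon)
    fix e :: real assume e: "0 < e"
    \<comment> \<open>Dividing by \<open>C + 1\<close> rather than \<open>C\<close> covers
      \<open>C = 0\<close>.\<close>
    have "emeasure lebesgue (g ` S) \<le> ennreal C * emeasure lebesgue S + ennreal (C * (e / (C + 1)))"
      by (rule main) (use e C in auto)
    also have "ennreal (C * (e / (C + 1))) \<le> ennreal e"
      using e C by (intro ennreal_leI) (simp add: field_simps)
    finally show "emeasure lebesgue (g ` S) \<le> ennreal C * emeasure lebesgue S + ennreal e"
      by (simp add: add_left_mono)
  qed
qed

lemma nn_integral_lipschitz_image_real:
  fixes g :: "real \<Rightarrow> real" and \<eta> :: "real \<Rightarrow> ennreal"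
  assumes S: "S \<in> sets lebesgue" "S \<subseteq> {a..b}" and lip: "C-lipschitz_on S g"
    and g: "continuous_on UNIV g" and \<eta>: "\<eta> \<in> borel_measurable borel"
  shows "(\<integral>\<^sup>+r. indicator (g ` S) r * \<eta> r \<partial>lebesgue) \<le> (\<integral>\<^sup>+t. ennreal C * indicator S t * \<eta> (g t) \<partial>lebesgue)"
proof -
  have gm: "g \<in> borel_measurable lebesgue"
    using g by (intro measurable_completion) (simp add: borel_measurable_continuous_onI)
  have gS: "g ` S \<in> sets lebesgue"
    by (rule lipschitz_image_lebesgue[OF S(1) lip])
  have "(\<integral>\<^sup>+r. 1 * indicator (g ` S) r * \<eta> r \<partial>lebesgue) \<le> (\<integral>\<^sup>+t. ennreal C * indicator S t * \<eta> (g t) \<partial>lebesgue)"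
  proof (rule nn_integral_restrict_le_of_vimage_le[where T = "\<lambda>r. r" and T' = g])
    fix B :: "real set" assume B: "B \<in> sets borel"
    have gB: "g -` B \<in> sets lebesgue"
      using measurable_sets[OF gm B] by simp
    have "g ` S \<inter> (\<lambda>r. r) -` B = g ` (S \<inter> g -` B)" by auto
    also have "emeasure lebesgue \<dots> \<le> ennreal C * emeasure lebesgue (S \<inter> g -` B)"
      using S gB lipschitz_on_subset[OF lip] by (intro emeasure_lipschitz_image_real) auto
    finally show "1 * emeasure lebesgue (g ` S \<inter> (\<lambda>r. r) -` B) \<le> ennreal C * emeasure lebesgue (S \<inter> g -` B)" by simp
  qed (use gm gS S \<eta> in \<open>auto intro: measurable_completion\<close>)
  then show ?thesis by simp
qed

text \<open>One half of the area formula. A level attained on several pieces is counted several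
  times on the right, which only enlarges it.\<close>

lemma nn_integral_piecewise_lipschitz_real:
  fixes g :: "real \<Rightarrow> real" and \<eta> :: "real \<Rightarrow> ennreal" and S :: "nat \<Rightarrow> real set"
  assumes S: "\<And>i. S i \<in> sets lebesgue" "\<And>i. S i \<subseteq> {a..b}" and lip: "\<And>i. (C i)-lipschitz_on (S i) g"
    and g: "continuous_on UNIV g" and \<eta>: "\<eta> \<in> borel_measurable borel"
  shows "(\<integral>\<^sup>+r. indicator (g ` (\<Union>i. S i)) r * \<eta> r \<partial>lebesgue)
    \<le> (\<integral>\<^sup>+t. (\<Sum>i. ennreal (C i) * indicator (S i) t) * \<eta> (g t) \<partial>lebesgue)"
proof -
  have gm: "g \<in> borel_measurable lebesgue"
    using g by (intro measurable_completion) (simp add: borel_measurable_continuous_onI)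
  have [measurable]: "\<eta> \<in> borel_measurable lebesgue" "(\<lambda>t. \<eta> (g t)) \<in> borel_measurable lebesgue"
    "\<And>i. S i \<in> sets lebesgue" "\<And>i. g ` S i \<in> sets lebesgue"
    using \<eta> measurable_compose[OF gm] S lipschitz_image_lebesgue[OF S(1) lip] by (auto simp: measurable_completion)
  have "indicator (g ` (\<Union>i. S i)) r * \<eta> r \<le> (\<Sum>i. indicator (g ` S i) r * \<eta> r)" for r
  proof (cases "r \<in> g ` (\<Union>i. S i)")
    case True
    then obtain i where i: "r \<in> g ` S i" by auto
    have "indicator (g ` S i) r * \<eta> r \<le> (\<Sum>i. indicator (g ` S i) r * \<eta> r)"
      by (rule le_suminf_ennreal)
    then show ?thesis using True i by simp
  qed simp
  then have "(\<integral>\<^sup>+r. indicator (g ` (\<Union>i. S i)) r * \<eta> r \<partial>lebesgue) \<le> (\<integral>\<^sup>+r. (\<Sum>i. indicator (g ` S i) r * \<eta> r) \<partial>lebesgue)"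
    by (intro nn_integral_mono)
  also have "\<dots> = (\<Sum>i. \<integral>\<^sup>+r. indicator (g ` S i) r * \<eta> r \<partial>lebesgue)"
    by (rule nn_integral_suminf) measurable
  also have "\<dots> \<le> (\<Sum>i. \<integral>\<^sup>+t. ennreal (C i) * indicator (S i) t * \<eta> (g t) \<partial>lebesgue)"
    by (intro suminf_le nn_integral_lipschitz_image_real[OF S lip g \<eta>]) auto
  also have "\<dots> = (\<integral>\<^sup>+t. (\<Sum>i. ennreal (C i) * indicator (S i) t * \<eta> (g t)) \<partial>lebesgue)"
    by (rule nn_integral_suminf[symmetric]) measurable
  finally show ?thesis by simp
qed

section \<open>Hausdorff null sets\<close>

lemma hausdorff_content_leI:
  assumes "E \<subseteq> (\<Union>i. C i)" "\<And>i. bounded (C i)" "\<And>i. diameter (C i) \<le> \<delta>"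
  shows "hausdorff_content k \<delta> E
    \<le> (\<Sum>i. if C i = {} then 0 else ennreal (unit_ball_vol (real k) * (diameter (C i) / 2) ^ k))"
  unfolding hausdorff_content_def by (rule INF_lower) (use assms in auto)

lemma hausdorff_content_mono:
  assumes "E \<subseteq> F"
  shows "hausdorff_content k \<delta> E \<le> hausdorff_content k \<delta> F"
  unfolding hausdorff_content_def using assms by (intro INF_superset_mono) auto

lemma hausdorff_measure_mono:
  assumes "E \<subseteq> F"
  shows "hausdorff_measure k E \<le> hausdorff_measure k F"
  unfolding hausdorff_measure_def by (intro SUP_mono') (rule hausdorff_content_mono[OF assms])

lemma hausdorff_content_antimono:
  assumes "\<delta> \<le> \<delta>'"
  shows "hausdorff_content k \<delta>' E \<le> hausdorff_content k \<delta> E"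
  unfolding hausdorff_content_def using assms by (intro INF_superset_mono) (auto intro: order_trans)

text \<open>Contents grow as the scale shrinks, so one parameter can bound both the scale and the
  value: for scale \<delta> and accuracy e, take \<open>min \<delta> e\<close>.\<close>

lemma hausdorff_measure_0I:
  assumes "\<And>e. 0 < e \<Longrightarrow> hausdorff_content k e E \<le> ennreal e"
  shows "hausdorff_measure k E = 0"
proof -
  have "hausdorff_content k \<delta> E \<le> 0" if \<delta>: "0 < \<delta>" for \<delta>
  proof (rule ennreal_le_epsilon)
    fix e :: real assume e: "0 < e"
    have "hausdorff_content k \<delta> E \<le> hausdorff_content k (min \<delta> e) E"
      by (rule hausdorff_content_antimono) simp
    also have "\<dots> \<le> ennreal (min \<delta> e)" using \<delta> e by (intro assms) simp
    also have "\<dots> \<le> 0 + ennreal e" by (simp add: ennreal_leI)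
    finally show "hausdorff_content k \<delta> E \<le> 0 + ennreal e" .
  qed
  then show ?thesis
    unfolding hausdorff_measure_def by (auto simp: SUP_eq_const intro!: antisym SUP_least)
qed

text \<open>For a null set the total volume of the cubes can be made so small that each single
  diameter is small as well.\<close>

lemma null_set_cover_small_cubes:
  fixes E :: "'a::euclidean_space set"
  assumes E: "negligible E" "bounded E" and e: "0 < e"
  obtains C :: "nat \<Rightarrow> 'a set" where "E \<subseteq> (\<Union>i. C i)" "\<And>i. compact (C i)" "\<And>i. diameter (C i) \<le> e"
    "(\<Sum>i. ennreal (diameter (C i) ^ DIM('a))) \<le> ennreal e"
proof -
  define c where "c = sqrt (real DIM('a)) ^ DIM('a)"
  have c: "0 < c" unfolding c_def by simp
  \<comment> \<open>The bound \<open>e ^ DIM('a)\<close> on the sum forces every diameter below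
    \<open>e\<close>, the bound \<open>e\<close> is the one on the sum itself, and \<open>c\<close>
    undoes the passage from volume to diameter.\<close>
  define e' where "e' = min e (e ^ DIM('a)) / c"
  have e': "0 < e'" unfolding e'_def using e c by simp
  have E0: "E \<in> sets lebesgue" "emeasure lebesgue E = 0"
    using E(1) by (auto simp: negligible_iff_null_sets)
  show thesis
  proof (rule outer_cover_by_cubes[OF E0(1) E(2) e', folded c_def])
    fix C :: "nat \<Rightarrow> 'a set"
    assume C: "E \<subseteq> (\<Union>i. C i)" "\<And>i. compact (C i)"
      "\<And>i. ennreal (diameter (C i) ^ DIM('a)) \<le> ennreal c * emeasure lebesgue (C i)"
      "(\<Sum>i. emeasure lebesgue (C i)) \<le> emeasure lebesgue E + ennreal e'"
    have "(\<Sum>i. ennreal (diameter (C i) ^ DIM('a))) \<le> (\<Sum>i. ennreal c * emeasure lebesgue (C i))"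
      by (intro suminf_le C) auto
    also have "\<dots> \<le> ennreal c * ennreal e'"
      unfolding ennreal_suminf_cmult using C(4) E0 by (intro mult_left_mono) auto
    also have "\<dots> = ennreal (min e (e ^ DIM('a)))"
      using c e' by (simp add: e'_def ennreal_mult[symmetric])
    finally have sum: "(\<Sum>i. ennreal (diameter (C i) ^ DIM('a))) \<le> ennreal (min e (e ^ DIM('a)))" .
    show thesis
    proof (rule that)
      show "E \<subseteq> (\<Union>i. C i)" "compact (C i)" for i by (rule C)+
      show "diameter (C i) \<le> e" for i
      proof -
        have "ennreal (diameter (C i) ^ DIM('a)) \<le> ennreal (min e (e ^ DIM('a)))"
          using sum_le_suminf[of "\<lambda>i. ennreal (diameter (C i) ^ DIM('a))" "{i}"] sum
          by (simp del: ennreal_le_iff)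
        then have "diameter (C i) ^ DIM('a) \<le> e ^ DIM('a)"
          using e by (simp add: ennreal_le_iff)
        then show ?thesis
          using power_strict_mono[of e "diameter (C i)" "DIM('a)"] e by (meson DIM_positive less_imp_le not_less)
      qed
      show "(\<Sum>i. ennreal (diameter (C i) ^ DIM('a))) \<le> ennreal e"
        using sum e by (auto intro: order_trans ennreal_leI)
    qed
  qed
qed

text \<open>An Eilenberg-type estimate: a covering set of diameter \<open>d\<close> meets the sphere of radius \<open>r\<close> only for
  \<open>r\<close> in an interval of length at most \<open>d\<close>.\<close>

lemma AE_hausdorff_null_sphere_bounded:
  fixes E :: "'a::euclidean_space set"
  assumes E: "negligible E" "bounded E" and dim: "DIM('a) = Suc k"
  shows "AE r in lborel. hausdorff_measure k (E \<inter> sphere y0 r) = 0"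
proof -
  have "\<exists>C :: nat \<Rightarrow> 'a set. E \<subseteq> (\<Union>i. C i) \<and> (\<forall>i. compact (C i)) \<and> (\<forall>i. diameter (C i) \<le> (1/2)^j) \<and>
    (\<Sum>i. ennreal (diameter (C i) ^ DIM('a))) \<le> ennreal ((1/2)^j)" for j :: nat
  proof (rule null_set_cover_small_cubes[OF E, of "(1/2)^j"])
    fix C :: "nat \<Rightarrow> 'a set"
    assume "E \<subseteq> (\<Union>i. C i)" "\<And>i. compact (C i)" "\<And>i. diameter (C i) \<le> (1/2)^j"
      "(\<Sum>i. ennreal (diameter (C i) ^ DIM('a))) \<le> ennreal ((1/2)^j)"
    then show ?thesis by (intro exI[of _ C] conjI allI)
  qed simp
  from choice[OF allI, OF this] obtain C :: "nat \<Rightarrow> nat \<Rightarrow> 'a set" where "\<forall>j. E \<subseteq> (\<Union>i. C j i) \<and>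
    (\<forall>i. compact (C j i)) \<and> (\<forall>i. diameter (C j i) \<le> (1/2)^j) \<and>
    (\<Sum>i. ennreal (diameter (C j i) ^ DIM('a))) \<le> ennreal ((1/2)^j)" ..
  then have C: "\<And>j. E \<subseteq> (\<Union>i. C j i)" "\<And>j i. compact (C j i)"
    "\<And>j i. diameter (C j i) \<le> (1/2)^j" "\<And>j. (\<Sum>i. ennreal (diameter (C j i) ^ DIM('a))) \<le> ennreal ((1/2)^j)"
    by simp_all
  define R where "R j i = dist y0 ` C j i" for j i
  have R: "compact (R j i)" for j i
    unfolding R_def using C(2) by (intro compact_continuous_image continuous_intros) auto
  have [measurable]: "R j i \<in> sets borel" for j i
    by (intro borel_closed compact_imp_closed R)
  have R_le: "emeasure lborel (R j i) \<le> ennreal (diameter (C j i))" for j i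
  proof -
    have "dist s t \<le> diameter (C j i)" if st: "s \<in> R j i" "t \<in> R j i" for s t
    proof -
      obtain x y where xy: "x \<in> C j i" "s = dist y0 x" "y \<in> C j i" "t = dist y0 y"
        using st unfolding R_def by blast
      have "dist s t \<le> dist x y"
        using dist_triangle[of y0 y x] dist_triangle[of y0 x y] xy by (simp add: dist_real_def dist_commute)
      also have "\<dots> \<le> diameter (C j i)"
        using xy C(2) by (intro diameter_bounded_bound compact_imp_bounded) auto
      finally show ?thesis .
    qed
    then show ?thesis using emeasure_real_le_of_dist_le[of "R j i"] by simp
  qed
  \<comment> \<open>Up to a constant, \<open>\<phi> j r\<close> bounds the content of the slice at
    radius \<open>r\<close> and scale \<open>(1/2)^j\<close>. Its integral gains one power of the
    diameter from the length of \<open>R j i\<close>.\<close>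
  define \<phi> where "\<phi> j r = (\<Sum>i. ennreal (diameter (C j i) ^ k) * indicator (R j i) r)" for j r
  have [measurable]: "\<phi> j \<in> borel_measurable borel" for j
    unfolding \<phi>_def by measurable
  have int_\<phi>: "(\<integral>\<^sup>+r. \<phi> j r \<partial>lborel) \<le> ennreal ((1/2)^j)" for j
  proof -
    have "(\<integral>\<^sup>+r. \<phi> j r \<partial>lborel) = (\<Sum>i. \<integral>\<^sup>+r. ennreal (diameter (C j i) ^ k) * indicator (R j i) r \<partial>lborel)"
      unfolding \<phi>_def by (rule nn_integral_suminf) measurable
    also have "\<dots> = (\<Sum>i. ennreal (diameter (C j i) ^ k) * emeasure lborel (R j i))"
      by (simp add: nn_integral_cmult_indicator)
    also have "\<dots> \<le> (\<Sum>i. ennreal (diameter (C j i) ^ DIM('a)))"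
    proof (intro suminf_le)
      fix i
      have "ennreal (diameter (C j i) ^ k) * emeasure lborel (R j i) \<le> ennreal (diameter (C j i) ^ k) * ennreal (diameter (C j i))"
        by (intro mult_left_mono R_le) simp
      also have "\<dots> = ennreal (diameter (C j i) ^ DIM('a))"
        using C(2) by (simp add: dim ennreal_mult[symmetric] compact_imp_bounded diameter_ge_0 mult.commute)
      finally show "ennreal (diameter (C j i) ^ k) * emeasure lborel (R j i) \<le> ennreal (diameter (C j i) ^ DIM('a))" .
    qed auto
    finally show ?thesis using C(4) by (rule order_trans)
  qed
  \<comment> \<open>Borel-Cantelli type argument: integrals summable in \<open>j\<close> make the
    sum over \<open>j\<close> finite for almost every \<open>r\<close>, hence its terms tend to 0
    there.\<close>
  have "(\<integral>\<^sup>+r. (\<Sum>j. \<phi> j r) \<partial>lborel) = (\<Sum>j. \<integral>\<^sup>+r. \<phi> j r \<partial>lborel)"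
    by (rule nn_integral_suminf) measurable
  also have "\<dots> \<le> (\<Sum>j. ennreal ((1/2)^j))"
    by (intro suminf_le int_\<phi>) auto
  also have "\<dots> < top"
    using summable_geometric[of "1/2::real"] by (simp add: suminf_ennreal2 less_top[symmetric])
  finally have "(\<integral>\<^sup>+r. (\<Sum>j. \<phi> j r) \<partial>lborel) \<noteq> \<infinity>" by simp
  then have "AE r in lborel. (\<Sum>j. \<phi> j r) \<noteq> \<infinity>"
    by (intro nn_integral_PInf_AE) measurable
  then show ?thesis
  proof eventually_elim
    fix r assume fin: "(\<Sum>j. \<phi> j r) \<noteq> \<infinity>"
    let ?c = "unit_ball_vol (real k)"
    have lim: "(\<lambda>j. \<phi> j r) \<longlonglongrightarrow> 0"
    proof -
      have fin': "\<phi> j r \<noteq> top" for j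
        using fin sum_le_suminf[of "\<lambda>j. \<phi> j r" "{j}"] by (auto simp: top_unique)
      then have eq: "ennreal (enn2real (\<phi> j r)) = \<phi> j r" for j
        by (simp add: less_top)
      then have "summable (\<lambda>j. enn2real (\<phi> j r))"
        using fin by (intro summable_suminf_not_top) auto
      then have "(\<lambda>j. ennreal (enn2real (\<phi> j r))) \<longlonglongrightarrow> ennreal 0"
        by (intro tendsto_ennrealI summable_LIMSEQ_zero)
      then show ?thesis by (simp add: eq)
    qed
    have cont: "hausdorff_content k ((1/2)^j) (E \<inter> sphere y0 r) \<le> ennreal ?c * \<phi> j r" for j
    proof -
      let ?C = "\<lambda>i. C j i \<inter> sphere y0 r"
      have bd: "bounded (C j i)" for i using C(2) compact_imp_bounded by auto
      have "hausdorff_content k ((1/2)^j) (E \<inter> sphere y0 r)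
        \<le> (\<Sum>i. if ?C i = {} then 0 else ennreal (?c * (diameter (?C i) / 2) ^ k))"
      proof (rule hausdorff_content_leI)
        show "bounded (?C i)" for i using bd by auto
        show "diameter (?C i) \<le> (1/2)^j" for i
          using diameter_subset[of "?C i" "C j i"] bd C(3)[of j i] by fastforce
      qed (use C(1) in blast)
      also have "\<dots> \<le> (\<Sum>i. ennreal ?c * (ennreal (diameter (C j i) ^ k) * indicator (R j i) r))"
      proof (intro suminf_le)
        fix i
        show "(if ?C i = {} then 0 else ennreal (?c * (diameter (?C i) / 2) ^ k))
          \<le> ennreal ?c * (ennreal (diameter (C j i) ^ k) * indicator (R j i) r)"
        proof (cases "?C i = {}")
          case False
          then have "r \<in> R j i" by (auto simp: R_def)
          have "diameter (?C i) / 2 \<le> diameter (C j i)"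
            using diameter_subset[of "?C i" "C j i"] bd[of i] diameter_ge_0[of "?C i"] by (auto simp: bounded_Int)
          then have "(diameter (?C i) / 2) ^ k \<le> diameter (C j i) ^ k"
            using bd[of i] by (intro power_mono) (auto simp: bounded_Int intro!: diameter_ge_0)
          then have "?c * (diameter (?C i) / 2) ^ k \<le> ?c * diameter (C j i) ^ k"
            by (intro mult_left_mono) auto
          moreover have "0 \<le> diameter (C j i)" using bd[of i] by (rule diameter_ge_0)
          ultimately have "ennreal (?c * (diameter (?C i) / 2) ^ k) \<le> ennreal ?c * ennreal (diameter (C j i) ^ k)"
            by (subst ennreal_mult[symmetric]) (auto intro!: ennreal_leI)
          then show ?thesis using False \<open>r \<in> R j i\<close> by simp
        qed simp
      qed auto
      also have "\<dots> = ennreal ?c * \<phi> j r"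
        unfolding \<phi>_def by (rule ennreal_suminf_cmult)
      finally show ?thesis .
    qed
    show "hausdorff_measure k (E \<inter> sphere y0 r) = 0"
    proof (rule hausdorff_measure_0I)
      fix e :: real assume e: "0 < e"
      have "(\<lambda>j. ennreal ?c * \<phi> j r) \<longlonglongrightarrow> ennreal ?c * 0"
        using lim by (intro tendsto_mult_ennreal tendsto_const) auto
      then have "\<forall>\<^sub>F j in sequentially. ennreal ?c * \<phi> j r < ennreal e"
        using e by (intro order_tendstoD(2)) auto
      moreover have "\<forall>\<^sub>F j in sequentially. (1/2)^j < e"
        using e by (intro order_tendstoD(2)[OF LIMSEQ_power_zero]) auto
      ultimately have "\<forall>\<^sub>F j in sequentially. ennreal ?c * \<phi> j r < ennreal e \<and> (1/2)^j < e"
        by (rule eventually_conj)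
      then obtain j where j: "ennreal ?c * \<phi> j r < ennreal e" "(1/2)^j < e"
        by (auto dest: eventually_happens)
      have "hausdorff_content k e (E \<inter> sphere y0 r) \<le> hausdorff_content k ((1/2)^j) (E \<inter> sphere y0 r)"
        using j by (intro hausdorff_content_antimono) simp
      also note cont
      also have "ennreal ?c * \<phi> j r \<le> ennreal e" using j by simp
      finally show "hausdorff_content k e (E \<inter> sphere y0 r) \<le> ennreal e" .
    qed
  qed
qed

lemma AE_hausdorff_null_sphere:
  fixes E :: "'a::euclidean_space set"
  assumes E: "negligible E" and dim: "DIM('a) = Suc k"
  shows "AE r in lborel. hausdorff_measure k (E \<inter> sphere y0 r) = 0"
proof -
  have "AE r in lborel. \<forall>m::nat. hausdorff_measure k ((E \<inter> cball y0 (real m)) \<inter> sphere y0 r) = 0"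
    using E dim by (subst AE_all_countable)
      (auto intro!: AE_hausdorff_null_sphere_bounded negligible_Int bounded_Int)
  then show ?thesis
  proof eventually_elim
    fix r assume *: "\<forall>m::nat. hausdorff_measure k ((E \<inter> cball y0 (real m)) \<inter> sphere y0 r) = 0"
    obtain m :: nat where "r \<le> real m" using real_arch_simple by blast
    then have "(E \<inter> cball y0 (real m)) \<inter> sphere y0 r = E \<inter> sphere y0 r" by auto
    then show "hausdorff_measure k (E \<inter> sphere y0 r) = 0" using * by metis
  qed
qed

section \<open>Lipschitz gauges and images of Hausdorff null sets\<close>

text \<open>\<open>d x\<close> is the supremum of the radii up to 1 for which the ball lies in
  \<open>D\<close> and \<open>u\<close> oscillates by at most \<open>e\<close> on it. A ball about
  \<open>y\<close> of radius smaller by \<open>dist x y\<close> is contained in the one about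
  \<open>x\<close>, hence the Lipschitz constant 1. The cap 1 keeps the supremum finite.\<close>

lemma lipschitz_oscillation_radius:
  fixes u :: "'a::euclidean_space \<Rightarrow> real"
  assumes D: "open D" and u: "continuous_on D u" and e: "0 < e"
  obtains d :: "'a \<Rightarrow> real" where "1-lipschitz_on UNIV d" "\<And>x. x \<in> D \<Longrightarrow> 0 < d x" "\<And>x. x \<notin> D \<Longrightarrow> d x = 0"
    "\<And>x y. dist x y < d x \<Longrightarrow> y \<in> D \<and> \<bar>u y - u x\<bar> \<le> e"
proof -
  \<comment> \<open>Oscillation is measured between pairs of points, not against the centre, so that
    it passes to balls with another centre. The radius 0, with empty ball, always qualifies and
    gives the value 0 off \<open>D\<close>.\<close>
  define S where "S x = {s\<in>{0..1}. ball x s \<subseteq> D \<and> (\<forall>y\<in>ball x s. \<forall>z\<in>ball x s. \<bar>u y - u z\<bar> \<le> e)}" for x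
  define d where "d x = Sup (S x)" for x
  have S0: "0 \<in> S x" for x by (simp add: S_def)
  have bdd: "bdd_above (S x)" for x by (rule bdd_aboveI[of _ 1]) (simp add: S_def)
  have le_d: "s \<le> d x" if "s \<in> S x" for s x
    unfolding d_def using that bdd by (rule cSup_upper)
  have d_nonneg: "0 \<le> d x" for x using le_d[OF S0] .
  have lip: "d x - dist x y \<le> d y" for x y
  proof -
    have "d x \<le> d y + dist x y"
      unfolding d_def[of x]
    proof (rule cSup_least)
      show "S x \<noteq> {}" using S0 by auto
      fix s assume s: "s \<in> S x"
      show "s \<le> d y + dist x y"
      proof (cases "s \<le> dist x y")
        case True
        then show ?thesis using d_nonneg[of y] by simp
      next
        case False
        have "ball y (s - dist x y) \<subseteq> ball x s"
          by (rule ball_subset_ball_iff[THEN iffD2]) (simp add: dist_commute)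
        then have "s - dist x y \<in> S y"
          using s False zero_le_dist[of x y] unfolding S_def
          by (auto simp del: mem_ball zero_le_dist)
        then show ?thesis using le_d[of "s - dist x y" y] by simp
      qed
    qed
    then show ?thesis by simp
  qed
  have pos: "0 < d x" if x: "x \<in> D" for x
  proof -
    obtain r where r: "0 < r" "ball x r \<subseteq> D" using D x open_contains_ball by blast
    obtain r' where r': "0 < r'" "\<And>y. y \<in> D \<Longrightarrow> dist y x < r' \<Longrightarrow> dist (u y) (u x) < e / 2"
      using u x e unfolding continuous_on_iff by (metis half_gt_zero)
    define s where "s = min 1 (min r r')"
    have sub: "ball x s \<subseteq> D" using r by (auto simp: s_def)
    have "\<bar>u y - u z\<bar> \<le> e" if "y \<in> ball x s" "z \<in> ball x s" for y z
    proof -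
      have "dist (u y) (u x) < e / 2" "dist (u z) (u x) < e / 2"
        using that sub by (intro r'(2); auto simp: s_def dist_commute[of _ x])+
      then have "\<bar>u y - u x\<bar> + \<bar>u z - u x\<bar> \<le> e" by (simp add: dist_real_def)
      then show ?thesis by arith
    qed
    then have "s \<in> S x" using sub r r' by (simp add: S_def s_def)
    then have "s \<le> d x" by (rule le_d)
    then show ?thesis using r r' by (simp add: s_def)
  qed
  show thesis
  proof
    show "1-lipschitz_on UNIV d"
    proof (rule lipschitz_onI)
      fix x y
      show "dist (d x) (d y) \<le> 1 * dist x y"
        using lip[of x y] lip[of y x] by (simp add: dist_real_def dist_commute abs_le_iff)
    qed simp
    show "0 < d x" if "x \<in> D" for x using that by (rule pos)
    show "d x = 0" if "x \<notin> D" for x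
    proof -
      have "S x \<subseteq> {0}"
      proof
        fix s assume s: "s \<in> S x"
        show "s \<in> {0}"
        proof (rule ccontr)
          assume "s \<notin> {0}"
          then have "x \<in> ball x s" using s by (simp add: S_def)
          then show False using s that unfolding S_def by blast
        qed
      qed
      then have "S x = {0}" using S0 by blast
      then show ?thesis by (simp add: d_def)
    qed
    show "y \<in> D \<and> \<bar>u y - u x\<bar> \<le> e" if "dist x y < d x" for x y
    proof -
      obtain s where s: "s \<in> S x" "dist x y < s"
      proof atomize_elim
        have "S x \<noteq> {}" using S0[of x] by auto
        then have "\<exists>s\<in>S x. dist x y < s"
          using less_cSup_iff[of "S x" "dist x y"] \<open>dist x y < d x\<close> bdd[of x] by (simp add: d_def)
        then show "\<exists>s. s \<in> S x \<and> dist x y < s" by blast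
      qed
      then have "0 < s" using zero_le_dist[of x y] by linarith
      then have "y \<in> ball x s" "x \<in> ball x s" using s by auto
      then show ?thesis using s(1) unfolding S_def by blast
    qed
  qed
qed

text \<open>If sets of diameter d_i cover \<open>Z\<close>, then about L / d_i pieces of size d_i
  cover the part of the product over each of them. The images have total volume of the order of (L /
  d_i) d_i^(k+1) = L d_i^k, summed over i, which is small because \<open>Z\<close> is null.\<close>

lemma negligible_lipschitz_image_times_interval:
  fixes F :: "'a::metric_space \<times> real \<Rightarrow> 'b::euclidean_space"
  assumes F: "M-lipschitz_on (Z \<times> {0..L}) F" and Z: "hausdorff_measure k Z = 0"
    and dim: "DIM('b) = Suc k" and k: "0 < k" and L: "0 \<le> L"
  shows "negligible (F ` (Z \<times> {0..L}))"
proof -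
  define M' where "M' = M + 1"
  have M': "0 < M'" "M \<le> M'" using lipschitz_on_nonneg[OF F] by (auto simp: M'_def)
  define v where "v = unit_ball_vol (real k)"
  have v: "0 < v" by (simp add: v_def)
  \<comment> \<open>\<open>V * d ^ Suc k\<close> is the volume of a ball of radius
    \<open>2 * M' * d\<close>; \<open>K\<close> then collects all constants of the final
    estimate.\<close>
  define V where "V = unit_ball_vol (real (Suc k)) * (2 * M') ^ Suc k"
  have V: "0 < V" using M' by (simp add: V_def)
  define K where "K = (L + 2) * V * (2 ^ k / v + 1)"
  have K: "0 < K" unfolding K_def using L V v by (intro mult_pos_pos add_pos_pos add_nonneg_pos) auto
  have cover: "\<exists>T\<in>sets lebesgue. F ` (Z \<times> {0..L}) \<subseteq> T \<and> emeasure lebesgue T \<le> ennreal (K * e)" if e: "0 < e" for e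
  proof -
    \<comment> \<open>The scale 1 is enough: it gives \<open>d i \<le> 1\<close> below, which bounds
      \<open>N i * d i\<close> by \<open>L + 2\<close>.\<close>
    have "hausdorff_content k 1 Z \<le> hausdorff_measure k Z"
      unfolding hausdorff_measure_def by (rule SUP_upper) simp
    then have "hausdorff_content k 1 Z < ennreal e" using Z e by simp
    then obtain C :: "nat \<Rightarrow> 'a set" where C: "Z \<subseteq> (\<Union>i. C i)" "\<And>i. bounded (C i)" "\<And>i. diameter (C i) \<le> 1"
      "(\<Sum>i. if C i = {} then 0 else ennreal (v * (diameter (C i) / 2) ^ k)) < ennreal e"
      unfolding hausdorff_content_def INF_less_iff v_def by auto
    define dm where "dm i = diameter (C i)" for i
    have dm: "0 \<le> dm i" "dm i \<le> 1" for i unfolding dm_def using C by (auto intro: diameter_ge_0)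
    \<comment> \<open>Covering sets may have diameter 0. The positive floor \<open>w i\<close> makes
      \<open>L / d i\<close> meaningful and costs at most \<open>e\<close> in the sum of k-th
      powers, as \<open>0 < k\<close>.\<close>
    define w where "w i = min 1 (e * (1/2) ^ Suc i)" for i :: nat
    have w: "0 < w i" "w i \<le> 1" for i using e by (auto simp: w_def)
    define d where "d i = max (dm i) (w i)" for i
    have d: "0 < d i" "d i \<le> 1" "dm i \<le> d i" for i using dm[of i] w[of i] by (auto simp: d_def)
    have sum_dm: "(\<Sum>i. ennreal (dm i ^ k)) \<le> ennreal (2 ^ k / v * e)"
    proof -
      have "ennreal (dm i ^ k) = ennreal (2 ^ k / v) * (if C i = {} then 0 else ennreal (v * (diameter (C i) / 2) ^ k))" for i
      proof (cases "C i = {}")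
        case True
        then show ?thesis using k by (simp add: dm_def diameter_def)
      next
        case False
        then show ?thesis
          using v dm[of i] by (simp add: ennreal_mult[symmetric] dm_def power_divide)
      qed
      then have "(\<Sum>i. ennreal (dm i ^ k)) = ennreal (2 ^ k / v) * (\<Sum>i. if C i = {} then 0 else ennreal (v * (diameter (C i) / 2) ^ k))"
        by (simp only: ennreal_suminf_cmult)
      also have "\<dots> \<le> ennreal (2 ^ k / v) * ennreal e"
        using C(4) by (intro mult_left_mono) auto
      also have "\<dots> = ennreal (2 ^ k / v * e)"
        using v e by (intro ennreal_mult[symmetric]) auto
      finally show ?thesis .
    qed
    have sum_w: "(\<Sum>i. ennreal (w i ^ k)) \<le> ennreal e"
    proof -
      have "(\<Sum>i. ennreal (w i ^ k)) \<le> (\<Sum>i. ennreal (e * (1/2) ^ Suc i))"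
      proof (intro suminf_le ennreal_leI)
        fix i
        have "w i ^ k \<le> w i ^ 1" using w[of i] k by (intro power_decreasing) auto
        then show "w i ^ k \<le> e * (1/2) ^ Suc i" by (simp add: w_def)
      qed auto
      also have "\<dots> = ennreal (\<Sum>i. e * (1/2) ^ Suc i)"
        using e by (intro suminf_ennreal2) (auto intro!: summable_mult power_half_series[THEN sums_summable])
      also have "(\<Sum>i. e * (1/2) ^ Suc i) = e"
        using sums_mult[OF power_half_series, of e] by (simp add: sums_iff)
      finally show ?thesis .
    qed
    have sum_d: "(\<Sum>i. ennreal (d i ^ k)) \<le> ennreal ((2 ^ k / v + 1) * e)"
    proof -
      have "(\<Sum>i. ennreal (d i ^ k)) \<le> (\<Sum>i. ennreal (dm i ^ k) + ennreal (w i ^ k))"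
      proof (intro suminf_le)
        show "ennreal (d i ^ k) \<le> ennreal (dm i ^ k) + ennreal (w i ^ k)" for i
          by (cases "dm i \<le> w i") (simp_all add: d_def max_def)
      qed auto
      also have "\<dots> = (\<Sum>i. ennreal (dm i ^ k)) + (\<Sum>i. ennreal (w i ^ k))"
        by (rule suminf_add[symmetric]) auto
      also have "\<dots> \<le> ennreal (2 ^ k / v * e) + ennreal e"
        by (intro add_mono sum_dm sum_w)
      also have "\<dots> = ennreal ((2 ^ k / v + 1) * e)"
        using v e by (simp add: ennreal_plus[symmetric] distrib_right del: ennreal_plus)
      finally show ?thesis .
    qed
    define N where "N i = nat \<lceil>L / d i\<rceil> + 1" for i
    have N: "real (N i) * d i \<le> L + 2" for i
    proof -
      have "real (N i) \<le> L / d i + 2" using L d[of i] by (simp add: N_def) linarith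
      then have "real (N i) * d i \<le> (L / d i + 2) * d i" using d[of i] by (intro mult_right_mono) auto
      also have "\<dots> = L + 2 * d i" using d[of i] by (simp add: field_simps)
      also have "\<dots> \<le> L + 2" using d[of i] by simp
      finally show ?thesis .
    qed
    define P where "P i j = (Z \<inter> C i) \<times> ({0..L} \<inter> {real j * d i .. real (Suc j) * d i})" for i j
    \<comment> \<open>For empty \<open>P i j\<close> the point is arbitrary; the ball around it is
      merely counted along.\<close>
    define p where "p i j = (SOME q. q \<in> P i j)" for i j
    define B where "B i j = cball (F (p i j)) (2 * M' * d i)" for i j
    have FP: "F ` P i j \<subseteq> B i j" for i j
    proof
      fix y assume "y \<in> F ` P i j"
      then obtain q where q: "q \<in> P i j" "y = F q" by auto
      have p: "p i j \<in> P i j" unfolding p_def using q(1) by (rule someI)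
      have "dist (F (p i j)) (F q) \<le> M * dist (p i j) q"
        using p q by (intro lipschitz_onD[OF F]) (auto simp: P_def)
      also have "dist (p i j) q \<le> dist (fst (p i j)) (fst q) + dist (snd (p i j)) (snd q)"
        unfolding dist_prod_def by (rule sqrt_sum_squares_le_sum) auto
      also have "\<dots> \<le> d i + d i"
      proof (rule add_mono)
        have "dist (fst (p i j)) (fst q) \<le> dm i"
          unfolding dm_def using p q C(2) by (intro diameter_bounded_bound) (auto simp: P_def)
        then show "dist (fst (p i j)) (fst q) \<le> d i" using d(3)[of i] by simp
        show "dist (snd (p i j)) (snd q) \<le> d i"
          using p q by (auto simp: P_def dist_real_def algebra_simps)
      qed
      finally have "dist (F (p i j)) (F q) \<le> M * (d i + d i)"
        using lipschitz_on_nonneg[OF F] by (simp add: mult_left_mono)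
      also have "\<dots> \<le> 2 * M' * d i" using M' d[of i] by (simp add: mult_right_mono)
      finally show "y \<in> B i j" by (simp add: B_def q)
    qed
    let ?T = "\<Union>i. \<Union>j<N i. B i j"
    have Bs: "B i j \<in> sets lebesgue" for i j by (simp add: B_def)
    have "F ` (Z \<times> {0..L}) \<subseteq> ?T"
    proof
      fix y assume "y \<in> F ` (Z \<times> {0..L})"
      then obtain z t where zt: "z \<in> Z" "t \<in> {0..L}" "y = F (z, t)" by auto
      obtain i where i: "z \<in> C i" using C(1) zt by auto
      define j where "j = nat \<lfloor>t / d i\<rfloor>"
      have t0: "0 \<le> t / d i" using zt d[of i] by simp
      have j: "real j \<le> t / d i" "t / d i \<le> real (Suc j)" unfolding j_def using t0 by linarith+
      then have j': "real j * d i \<le> t" "t \<le> real (Suc j) * d i" using d[of i] by (simp_all add: field_simps)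
      have "t / d i \<le> L / d i" using zt d[of i] by (simp add: divide_right_mono)
      then have "real j \<le> L / d i" using j by simp
      then have "j < N i" unfolding N_def by linarith
      moreover have "(z, t) \<in> P i j" using zt i j' by (simp add: P_def)
      then have "y \<in> B i j" using FP[of i j] zt(3) by blast
      ultimately show "y \<in> ?T" by blast
    qed
    moreover have "emeasure lebesgue ?T \<le> ennreal (K * e)"
    proof -
      have "emeasure lebesgue ?T \<le> (\<Sum>i. emeasure lebesgue (\<Union>j<N i. B i j))"
        using Bs by (intro emeasure_subadditive_countably) auto
      also have "\<dots> \<le> (\<Sum>i. ennreal ((L + 2) * V) * ennreal (d i ^ k))"
      proof (intro suminf_le)
        fix i
        have "emeasure lebesgue (\<Union>j<N i. B i j) \<le> (\<Sum>j<N i. emeasure lebesgue (B i j))"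
          using Bs by (intro emeasure_subadditive_finite) auto
        also have "\<dots> = (\<Sum>j<N i. ennreal (V * d i ^ Suc k))"
          using M' d[of i] dim by (simp add: B_def V_def emeasure_cball power_mult_distrib mult_ac)
        also have "\<dots> = ennreal (real (N i) * (V * d i ^ Suc k))"
          using V d[of i] by (simp add: ennreal_mult ennreal_of_nat_eq_real_of_nat)
        also have "real (N i) * (V * d i ^ Suc k) = (real (N i) * d i) * (V * d i ^ k)"
          by simp
        also have "ennreal \<dots> \<le> ennreal ((L + 2) * (V * d i ^ k))"
          using N V d[of i] by (intro ennreal_leI mult_right_mono) auto
        also have "\<dots> = ennreal ((L + 2) * V) * ennreal (d i ^ k)"
          using L V d[of i] by (simp add: ennreal_mult[symmetric] mult.assoc)
        finally show "emeasure lebesgue (\<Union>j<N i. B i j) \<le> ennreal ((L + 2) * V) * ennreal (d i ^ k)" .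
      qed auto
      also have "\<dots> = ennreal ((L + 2) * V) * (\<Sum>i. ennreal (d i ^ k))"
        by (rule ennreal_suminf_cmult)
      also have "\<dots> \<le> ennreal ((L + 2) * V) * ennreal ((2 ^ k / v + 1) * e)"
        by (intro mult_left_mono sum_d) simp
      also have "\<dots> = ennreal (K * e)"
        using L V v e by (simp add: K_def ennreal_mult[symmetric] mult.assoc)
      finally show ?thesis .
    qed
    ultimately show ?thesis using Bs by (intro bexI[of _ ?T]) auto
  qed
  show ?thesis
    unfolding negligible_outer_le
  proof (intro allI impI)
    fix e :: real assume e: "0 < e"
    obtain T where T: "T \<in> sets lebesgue" "F ` (Z \<times> {0..L}) \<subseteq> T" "emeasure lebesgue T \<le> ennreal (K * (e / K))"
      using cover[of "e / K"] e K by auto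
    then have "T \<in> lmeasurable" unfolding fmeasurable_def by (auto intro: le_less_trans)
    moreover have "measure lebesgue T \<le> e"
      using T(3) e K by (simp add: measure_def enn2real_leI)
    ultimately show "\<exists>T. F ` (Z \<times> {0..L}) \<subseteq> T \<and> T \<in> lmeasurable \<and> measure lebesgue T \<le> e"
      using T(2) by blast
  qed
qed

section \<open>Arc length and the normal representation\<close>

abbreviation chord_sum :: "(real \<Rightarrow> 'a::metric_space) \<Rightarrow> nat \<Rightarrow> (nat \<Rightarrow> real) \<Rightarrow> ennreal" where
  "chord_sum c m t \<equiv> (\<Sum>i<m. ennreal (dist (c (t i)) (c (t (Suc i)))))"

lemma arc_length_leI:
  assumes "\<And>m t. mono_on {..m::nat} t \<Longrightarrow> t ` {..m} \<subseteq> {a..b} \<Longrightarrow>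
    chord_sum c m t \<le> l"
  shows "arc_length c a b \<le> l"
  unfolding arc_length_def using assms by (intro SUP_least) auto

lemma arc_length_upper:
  assumes "mono_on {..m::nat} t" "t ` {..m} \<subseteq> {a..b}"
  shows "chord_sum c m t \<le> arc_length c a b"
  unfolding arc_length_def using assms by (intro SUP_upper2[of "(m, t)"]) auto

lemma less_arc_lengthE:
  assumes "l < arc_length c a b"
  obtains m t where "mono_on {..m::nat} t" "t ` {..m} \<subseteq> {a..b}"
    "l < chord_sum c m t"
  using assms unfolding arc_length_def less_SUP_iff by auto

lemma dist_le_arc_length:
  assumes "x \<le> y"
  shows "ennreal (dist (c x) (c y)) \<le> arc_length c x y"
proof -
  have "mono_on {..1::nat} (\<lambda>i. if i = 0 then x else y)" "(\<lambda>i::nat. if i = 0 then x else y) ` {..1} \<subseteq> {x..y}"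
    using assms by (auto simp: mono_on_def)
  then show ?thesis
    using arc_length_upper[of 1 "\<lambda>i. if i = 0 then x else y" x y c] by simp
qed

lemma arc_length_refl [simp]: "arc_length c x x = 0"
proof -
  have "arc_length c x x \<le> 0"
    by (rule arc_length_leI) (auto simp: image_subset_iff intro!: sum.neutral)
  then show ?thesis by simp
qed

lemma ennreal_add_SUP_le:
  fixes c :: ennreal
  assumes "I \<noteq> {}" "\<And>i. i \<in> I \<Longrightarrow> c + f i \<le> B"
  shows "c + (SUP i\<in>I. f i) \<le> B"
  unfolding ennreal_SUP_add_right[OF assms(1)] using assms(2) by (rule SUP_least)

lemma arc_length_add_le:
  assumes "a \<le> x" "x \<le> b"
  shows "arc_length c a x + arc_length c x b \<le> arc_length c a b"
proof -
  have "chord_sum c m t + arc_length c x b \<le> arc_length c a b"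
    if t: "mono_on {..m} t" "t ` {..m} \<subseteq> {a..x}" for m t
  proof -
    let ?A = "chord_sum c m t"
    have "?A + chord_sum c k r \<le> arc_length c a b"
      if r: "mono_on {..k} r" "r ` {..k} \<subseteq> {x..b}" for k r
    proof -
      \<comment> \<open>Concatenation of the two partitions. The step from index \<open>m\<close> to
        \<open>Suc m\<close> is the jump from \<open>t m\<close> to \<open>r 0\<close>, a
        nonnegative extra chord.\<close>
      define q where "q i = (if i \<le> m then t i else r (i - Suc m))" for i
      let ?f = "\<lambda>i. ennreal (dist (c (q i)) (c (q (Suc i))))"
      have "?A = (\<Sum>i<m. ?f i)" by (intro sum.cong) (auto simp: q_def)
      moreover have "chord_sum c k r = (\<Sum>i<k. ?f (Suc m + i))"
        by (intro sum.cong) (auto simp: q_def)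
      moreover have "(\<Sum>i<m. ?f i) + (\<Sum>i<k. ?f (Suc m + i)) \<le> (\<Sum>i<Suc m + k. ?f i)"
      proof -
        have "(\<Sum>i<Suc m + k. ?f i) = (\<Sum>i<Suc m. ?f i) + (\<Sum>i<k. ?f (Suc m + i))"
          by (induction k) (auto simp: add.assoc)
        then show ?thesis by (simp add: add_right_mono)
      qed
      moreover have "(\<Sum>i<Suc m + k. ?f i) \<le> arc_length c a b"
      proof (rule arc_length_upper)
        show "mono_on {..Suc m + k} q"
        proof (rule mono_onI)
          fix i j assume ij: "i \<in> {..Suc m + k}" "j \<in> {..Suc m + k}" "i \<le> j"
          consider "j \<le> m" | "i \<le> m" "m < j" | "m < i" using ij by linarith
          then show "q i \<le> q j"
          proof cases
            case 1 then show ?thesis using ij t(1) by (auto simp: q_def mono_on_def)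
          next
            case 2
            then have "t i \<in> t ` {..m}" "r (j - Suc m) \<in> r ` {..k}" using ij by auto
            then have "t i \<in> {a..x}" "r (j - Suc m) \<in> {x..b}" using t(2) r(2) by blast+
            then show ?thesis using 2 by (auto simp: q_def)
          next
            case 3
            then have "r (i - Suc m) \<le> r (j - Suc m)" using ij by (intro mono_onD[OF r(1)]) auto
            then show ?thesis using 3 ij by (auto simp: q_def)
          qed
        qed
        show "q ` {..Suc m + k} \<subseteq> {a..b}"
        proof (rule image_subsetI)
          fix i assume i: "i \<in> {..Suc m + k}"
          show "q i \<in> {a..b}"
          proof (cases "i \<le> m")
            case True
            then have "t i \<in> {a..x}" using t(2) by auto
            then show ?thesis using True assms by (auto simp: q_def)
          next
            case False
            then have "r (i - Suc m) \<in> r ` {..k}" using i by auto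
            then have "r (i - Suc m) \<in> {x..b}" using r(2) by blast
            then show ?thesis using False assms by (auto simp: q_def)
          qed
        qed
      qed
      ultimately show ?thesis by simp
    qed
    note * = this
    show ?thesis
      unfolding arc_length_def[of c x b]
    proof (rule ennreal_add_SUP_le)
      show "{(m, t). mono_on {..m} t \<and> t ` {..m} \<subseteq> {x..b}} \<noteq> {}"
        using assms by (auto intro!: exI[of _ 0] exI[of _ "\<lambda>_. x"] simp: mono_on_def)
    qed (use * in auto)
  qed
  note * = this
  show ?thesis
    unfolding arc_length_def[of c a x] add.commute[of _ "arc_length c x b"]
  proof (rule ennreal_add_SUP_le)
    show "{(m, t). mono_on {..m} t \<and> t ` {..m} \<subseteq> {a..x}} \<noteq> {}"
      using assms by (auto intro!: exI[of _ 0] exI[of _ "\<lambda>_. x"] simp: mono_on_def)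
  qed (use * in \<open>auto simp: add.commute\<close>)
qed

text \<open>For the upper bound a partition is cut at \<open>x\<close> by taking minima and maxima
  with \<open>x\<close>. Only a chord that straddles \<open>x\<close> is affected, and the triangle
  inequality takes care of it.\<close>

lemma arc_length_add:
  assumes x: "a \<le> x" "x \<le> b"
  shows "arc_length c a b = arc_length c a x + arc_length c x b"
proof (rule antisym)
  show "arc_length c a b \<le> arc_length c a x + arc_length c x b"
  proof (rule arc_length_leI)
    fix m :: nat and t :: "nat \<Rightarrow> real"
    assume t: "mono_on {..m} t" "t ` {..m} \<subseteq> {a..b}"
    have "chord_sum c m t
      \<le> (\<Sum>i<m. ennreal (dist (c (min (t i) x)) (c (min (t (Suc i)) x)))
          + ennreal (dist (c (max (t i) x)) (c (max (t (Suc i)) x))))"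
    proof (rule sum_mono)
      fix i assume "i \<in> {..<m}"
      then have le: "t i \<le> t (Suc i)" using t(1) by (auto simp: mono_on_def)
      have "dist (c (t i)) (c (t (Suc i)))
        \<le> dist (c (min (t i) x)) (c (min (t (Suc i)) x)) + dist (c (max (t i) x)) (c (max (t (Suc i)) x))"
        using le dist_triangle[of "c (t i)" "c (t (Suc i))" "c x"] by (auto simp: min_def max_def)
      then show "ennreal (dist (c (t i)) (c (t (Suc i))))
        \<le> ennreal (dist (c (min (t i) x)) (c (min (t (Suc i)) x)))
          + ennreal (dist (c (max (t i) x)) (c (max (t (Suc i)) x)))"
        by (simp add: ennreal_leI flip: ennreal_plus)
    qed
    also have "\<dots> = chord_sum c m (\<lambda>i. min (t i) x)
      + chord_sum c m (\<lambda>i. max (t i) x)"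
      by (rule sum.distrib)
    also have "\<dots> \<le> arc_length c a x + arc_length c x b"
    proof (rule add_mono)
      have "mono_on {..m} (\<lambda>i. min (t i) x)" "mono_on {..m} (\<lambda>i. max (t i) x)"
        using t(1) unfolding mono_on_def by (blast intro: min.mono max.mono order_refl)+
      moreover have "(\<lambda>i. min (t i) x) ` {..m} \<subseteq> {a..x}" "(\<lambda>i. max (t i) x) ` {..m} \<subseteq> {x..b}"
        using t(2) x by auto
      ultimately show "chord_sum c m (\<lambda>i. min (t i) x) \<le> arc_length c a x"
        "chord_sum c m (\<lambda>i. max (t i) x) \<le> arc_length c x b"
        using arc_length_upper[of m "\<lambda>i. min (t i) x"] arc_length_upper[of m "\<lambda>i. max (t i) x"] by blast+
    qed
    finally show "chord_sum c m t \<le> arc_length c a x + arc_length c x b" .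
  qed
qed (rule arc_length_add_le[OF x])

lemma arc_length_mono:
  assumes "a \<le> x" "x \<le> y"
  shows "arc_length c a x \<le> arc_length c a y"
  using arc_length_add[OF assms, of c] by simp

text \<open>Arc length is a supremum of functions depending continuously on the end point; together with
  additivity this gives its continuity.\<close>

lemma arc_length_lower_semicontinuous:
  assumes c: "continuous_on {a..b} c" and x: "x \<in> {a..b}"
  shows "l < arc_length c a x \<Longrightarrow> eventually (\<lambda>y. l < arc_length c a y) (at x within {a..b})"
    and "l < arc_length c x b \<Longrightarrow> eventually (\<lambda>y. l < arc_length c y b) (at x within {a..b})"
proof -
  \<comment> \<open>Both claims at once: \<open>p\<close>, \<open>q\<close> are the end points, one
    of which moves, and \<open>h\<close> (\<open>min\<close> or \<open>max\<close>) pushes the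
    points of a good partition into the moved interval.\<close>
  have aux: "eventually (\<lambda>y. l < arc_length c (p y) (q y)) (at x within {a..b})"
    if l: "l < arc_length c (p x) (q x)" and h: "h = min \<or> h = max"
      and pq: "\<And>y. y \<in> {a..b} \<Longrightarrow> {p y..q y} \<subseteq> {a..b}" "\<And>s. s \<in> {p x..q x} \<Longrightarrow> h s x = s"
        "\<And>s y. s \<in> {p x..q x} \<Longrightarrow> y \<in> {a..b} \<Longrightarrow> h s y \<in> {p y..q y}"
    for p q :: "real \<Rightarrow> real" and h :: "real \<Rightarrow> real \<Rightarrow> real"
  proof -
    obtain m t where t: "mono_on {..m::nat} t" "t ` {..m} \<subseteq> {p x..q x}" "l < chord_sum c m t"
      using l by (rule less_arc_lengthE)
    have t': "t i \<in> {p x..q x}" if "i \<le> m" for i using that t(2) by blast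
    have cont: "((\<lambda>y. c (h s y)) \<longlongrightarrow> c s) (at x within {a..b})" if s: "s \<in> {p x..q x}" for s
    proof -
      have "continuous_on {a..b} (h s)" using h by (auto intro!: continuous_intros)
      moreover have "h s ` {a..b} \<subseteq> {a..b}" using pq(1,3) s by blast
      ultimately have "continuous_on {a..b} (\<lambda>y. c (h s y))"
        using continuous_on_compose2[OF c] by blast
      then have "((\<lambda>y. c (h s y)) \<longlongrightarrow> c (h s x)) (at x within {a..b})"
        using x unfolding continuous_on_def by blast
      then show ?thesis by (simp only: pq(2)[OF s])
    qed
    have "((\<lambda>y. chord_sum c m (\<lambda>i. h (t i) y)) \<longlongrightarrow> chord_sum c m t) (at x within {a..b})"
      by (intro tendsto_sum tendsto_ennrealI tendsto_dist cont t') auto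
    then have ev: "eventually (\<lambda>y. l < chord_sum c m (\<lambda>i. h (t i) y)) (at x within {a..b})"
      using t(3) by (rule order_tendstoD(1))
    have "eventually (\<lambda>y. y \<in> {a..b}) (at x within {a..b})"
      by (simp add: eventually_at_topological exI[of _ UNIV])
    with ev show ?thesis
    proof eventually_elim
      fix y assume y: "l < chord_sum c m (\<lambda>i. h (t i) y)" "y \<in> {a..b}"
      have "mono_on {..m} (\<lambda>i. h (t i) y)"
        using t(1) h unfolding mono_on_def by (blast intro: min.mono max.mono order_refl)
      moreover have "(\<lambda>i. h (t i) y) ` {..m} \<subseteq> {p y..q y}" using pq(3) t' y(2) by blast
      ultimately show "l < arc_length c (p y) (q y)"
        using y(1) arc_length_upper[of m "\<lambda>i. h (t i) y" "p y" "q y" c] by simp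
    qed
  qed
  show "l < arc_length c a x \<Longrightarrow> eventually (\<lambda>y. l < arc_length c a y) (at x within {a..b})"
    by (rule aux[of "\<lambda>_. a" "\<lambda>y. y" min]) auto
  show "l < arc_length c x b \<Longrightarrow> eventually (\<lambda>y. l < arc_length c y b) (at x within {a..b})"
    by (rule aux[of "\<lambda>y. y" "\<lambda>_. b" max]) auto
qed

text \<open>Intermediate value theorem for the length function, at the supremum \<open>w\<close> of
  the times with length at most \<open>u\<close>. Length beyond \<open>u\<close> at \<open>w\<close>
  would persist slightly to the left of \<open>w\<close>; length below \<open>u\<close> would
  persist slightly to the right.\<close>

lemma arc_length_attains:
  assumes ab: "a \<le> b" and c: "continuous_on {a..b} c" and fin: "arc_length c a b < top"
    and u: "ennreal u \<le> arc_length c a b" "0 \<le> u"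
  shows "\<exists>t\<in>{a..b}. arc_length c a t = ennreal u"
proof -
  let ?s = "arc_length c a"
  define T where "T = {t\<in>{a..b}. ?s t \<le> ennreal u}"
  define w where "w = Sup T"
  have aT: "a \<in> T" using ab by (simp add: T_def)
  have bdd: "bdd_above T" by (rule bdd_aboveI[of _ b]) (simp add: T_def)
  have w: "a \<le> w" "w \<le> b"
    unfolding w_def using aT by (auto intro!: cSup_upper[OF aT bdd] cSup_least simp: T_def[symmetric])
      (simp add: T_def)
  have "?s w \<le> ennreal u"
  proof (rule ccontr)
    assume "\<not> ?s w \<le> ennreal u"
    then have gt: "ennreal u < ?s w" by simp
    then have aw: "a < w" using w by (cases "a = w") auto
    have "eventually (\<lambda>y. ennreal u < ?s y) (at w within {a..b})"
      by (rule arc_length_lower_semicontinuous(1)[OF c _ gt]) (use w in simp)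
    then obtain d where d: "0 < d" "\<And>y. y \<in> {a..b} \<Longrightarrow> y \<noteq> w \<Longrightarrow> dist y w < d \<Longrightarrow> ennreal u < ?s y"
      unfolding eventually_at by blast
    define y where "y = max a (w - d / 2)"
    have y: "y \<in> {a..b}" "y < w" "dist y w < d"
      using aw w d(1) by (auto simp: y_def dist_real_def)
    then have "ennreal u < ?s y" using d(2) by auto
    moreover obtain z where z: "z \<in> T" "y < z"
      using y(2) less_cSup_iff[of T y] aT bdd unfolding w_def by auto
    then have "?s y \<le> ?s z" using y by (intro arc_length_mono) auto
    ultimately show False using z by (auto simp: T_def)
  qed
  moreover have "ennreal u \<le> ?s w"
  proof (rule ccontr)
    assume "\<not> ennreal u \<le> ?s w"
    then have lt: "?s w < ennreal u" by simp
    then have wb: "w < b" using w u by (cases "w = b") auto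
    define l where "l = arc_length c a b - ennreal u"
    have split: "?s y + arc_length c y b = arc_length c a b" if "y \<in> {a..b}" for y
      using that arc_length_add[of a y b c] by simp
    \<comment> \<open>Additivity turns lower semicontinuity of the remaining length into upper
      semicontinuity of \<open>?s\<close>. Finite total length makes the subtraction in
      \<open>l\<close> faithful.\<close>
    have key: "l < arc_length c y b \<longleftrightarrow> ?s y < ennreal u" if "y \<in> {a..b}" for y
    proof -
      have "?s y < top" "arc_length c y b < top"
        using split[OF that] fin by (auto simp: less_top[symmetric] simp flip: split[OF that])
      then obtain p q where pq: "?s y = ennreal p" "arc_length c y b = ennreal q" "0 \<le> p" "0 \<le> q"
        by (cases "?s y"; cases "arc_length c y b") auto
      then have "arc_length c a b = ennreal (p + q)"
        using split[OF that] by simp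
      then have "l = ennreal (p + q - u)" "u \<le> p + q"
        using u pq by (simp_all add: l_def ennreal_minus del: ennreal_plus)
      then show ?thesis
        using u pq by (simp add: ennreal_less_iff)
    qed
    have "eventually (\<lambda>y. l < arc_length c y b) (at w within {a..b})"
      by (rule arc_length_lower_semicontinuous(2)[OF c]) (use w key lt in auto)
    then obtain d where d: "0 < d" "\<And>y. y \<in> {a..b} \<Longrightarrow> y \<noteq> w \<Longrightarrow> dist y w < d \<Longrightarrow> l < arc_length c y b"
      unfolding eventually_at by blast
    define y where "y = min b (w + d / 2)"
    have y: "y \<in> {a..b}" "w < y" "dist y w < d"
      using wb w d(1) by (auto simp: y_def dist_real_def)
    then have "y \<in> T" using d(2) key by (auto simp: T_def less_imp_le)
    then have "y \<le> w" unfolding w_def using bdd by (rule cSup_upper)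
    then show False using y by simp
  qed
  ultimately show ?thesis using w by (intro bexI[of _ w]) auto
qed

text \<open>A chord is at most the arc, and by additivity the arc is the difference of the length
  parameters. In particular two times with equal length parameter have the same image, which yields
  the end values whatever \<open>inv_into\<close> chooses.\<close>

lemma normal_rep_lipschitz:
  assumes p: "is_path (a, b, c)" and rect: "rectifiable (a, b, c)"
  defines "L \<equiv> enn2real (arc_length c a b)"
  shows "1-lipschitz_on {0..L} (normal_rep (a, b, c))" "normal_rep (a, b, c) 0 = c a"
    "normal_rep (a, b, c) L = c b" "normal_rep (a, b, c) ` {0..L} \<subseteq> c ` {a..b}"
proof -
  let ?s = "arc_length c a"
  have ab: "a \<le> b" and c: "continuous_on {a..b} c" and fin: "arc_length c a b < top"
    using p rect by (auto simp: is_path_def rectifiable_def)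
  have L: "arc_length c a b = ennreal L" using fin by (simp add: L_def)
  have L0: "0 \<le> L" by (simp add: L_def)
  define T where "T u = inv_into {a..b} ?s (ennreal u)" for u
  have nr: "normal_rep (a, b, c) u = c (T u)" for u
    by (simp add: normal_rep_def T_def)
  have T: "T u \<in> {a..b}" "?s (T u) = ennreal u" if "u \<in> {0..L}" for u
  proof -
    have "ennreal u \<in> ?s ` {a..b}"
      using arc_length_attains[OF ab c fin, of u] that by (force simp: L ennreal_leI)
    then show "T u \<in> {a..b}" "?s (T u) = ennreal u"
      unfolding T_def by (rule inv_into_into, rule f_inv_into_f)
  qed
  have dist_le: "dist (c x) (c y) \<le> v - u"
    if "a \<le> x" "x \<le> y" "?s x = ennreal u" "?s y = ennreal v" "0 \<le> u" "0 \<le> v" for x y u v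
  proof -
    have "ennreal u + ennreal (dist (c x) (c y)) \<le> ennreal u + arc_length c x y"
      using that by (intro add_left_mono dist_le_arc_length)
    also have "\<dots> = ennreal v" using arc_length_add[of a x y c] that by simp
    finally show ?thesis using that by (simp flip: ennreal_plus)
  qed
  have main: "dist (c (T u)) (c (T v)) \<le> v - u" if "u \<in> {0..L}" "v \<in> {0..L}" "u \<le> v" for u v
  proof (cases "T u \<le> T v")
    case True
    then show ?thesis using T that by (intro dist_le) auto
  next
    case False
    then have "?s (T v) \<le> ?s (T u)" using T(1)[OF that(2)] by (intro arc_length_mono) auto
    then have "v \<le> u" using T(2) that by simp
    then have "u = v" using that by simp
    then show ?thesis by simp
  qed
  show "1-lipschitz_on {0..L} (normal_rep (a, b, c))"
  proof (rule lipschitz_onI)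
    fix u v assume uv: "u \<in> {0..L}" "v \<in> {0..L}"
    show "dist (normal_rep (a, b, c) u) (normal_rep (a, b, c) v) \<le> 1 * dist u v"
      unfolding nr using main[OF uv] main[OF uv(2,1)] by (cases "u \<le> v") (auto simp: dist_real_def dist_commute)
  qed simp
  have "dist (c a) (c (T 0)) \<le> 0 - 0"
    using T[of 0] L0 by (intro dist_le) auto
  then show "normal_rep (a, b, c) 0 = c a" by (simp add: nr)
  have "dist (c (T L)) (c b) \<le> L - L"
    using T[of L] L0 L ab by (intro dist_le) auto
  then show "normal_rep (a, b, c) L = c b" by (simp add: nr)
  show "normal_rep (a, b, c) ` {0..L} \<subseteq> c ` {a..b}"
    unfolding nr using T(1) by blast
qed

section \<open>Powers in the extended half-line and Jensen's inequality\<close>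

lemma enn_powr_mono: "0 < a \<Longrightarrow> x \<le> y \<Longrightarrow> enn_powr x a \<le> enn_powr y a"
  unfolding enn_powr_def
  by (auto simp: top_unique less_top intro!: ennreal_leI powr_mono2 enn2real_mono)

lemma enn_powr_mult:
  assumes a: "0 < a" and c: "0 \<le> c"
  shows "enn_powr (ennreal c * x) a = ennreal (c powr a) * enn_powr x a"
proof (cases x)
  case (real r)
  then show ?thesis using a c
    by (simp add: enn_powr_def powr_mult flip: ennreal_mult)
next
  case top
  then show ?thesis using a c
    by (cases "c = 0") (auto simp: enn_powr_def ennreal_mult_top)
qed

lemma enn_powr_measurable [measurable (raw)]:
  assumes "f \<in> borel_measurable M"
  shows "(\<lambda>x. enn_powr (f x) a) \<in> borel_measurable M"
  unfolding enn_powr_def using assms by measurable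

lemma enn_powr_0 [simp]: "enn_powr 0 a = 0"
  by (simp add: enn_powr_def)

text \<open>Jensen's inequality, integrated from Young's inequality
  \<open>a m\<^bsup>a-1\<^esup> x \<le> x\<^bsup>a\<^esup> + (a - 1) m\<^bsup>a\<^esup>\<close> with \<open>m\<close> the mean.\<close>

lemma young_tangent:
  fixes x m a :: real
  assumes a: "1 \<le> a" and x: "0 \<le> x" and m: "0 < m"
  shows "a * m powr (a - 1) * x \<le> x powr a + (a - 1) * m powr a"
proof -
  \<comment> \<open>By homogeneity m = 1 may be assumed; what remains is Bernoulli's inequality,
    that is, Young's inequality with second factor 1.\<close>
  define z where "z = x / m"
  have "a * z \<le> z powr a + (a - 1)"
  proof (cases "z = 0")
    case False
    then have z: "0 < z" using x m by (simp add: z_def)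
    have "(z powr a) powr (1 / a) * 1 powr (1 - 1 / a) \<le> 1 / a * z powr a + (1 - 1 / a) * 1"
      using a z by (intro Youngs_inequality_0) auto
    then have "z \<le> 1 / a * z powr a + (1 - 1 / a)"
      using a z by (simp add: powr_powr)
    then have "a * z \<le> a * (1 / a * z powr a + (1 - 1 / a))"
      using a by (intro mult_left_mono) auto
    also have "\<dots> = z powr a + (a - 1)"
      using a by (simp add: algebra_simps)
    finally show ?thesis .
  qed (use a in simp)
  then have "1 + a * (x / m - 1) \<le> (x / m) powr a"
    by (simp add: z_def algebra_simps)
  then have "m powr a * (1 + a * (x / m - 1)) \<le> m powr a * (x / m) powr a"
    by (intro mult_left_mono) auto
  moreover have "m powr a * (x / m) powr a = x powr a"
    using x m by (simp add: powr_divide)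
  moreover have "m powr a * (1 + a * (x / m - 1)) = a * m powr (a - 1) * x - (a - 1) * m powr a"
    using m by (simp add: powr_diff field_simps)
  ultimately show ?thesis by simp
qed

text \<open>The tangent is taken at the mean, which must be positive and finite. For infinite mean,
  y \<le> 1 + y^a makes the right-hand side infinite, since the total mass is 1.\<close>

lemma enn_powr_nn_integral_le:
  assumes M: "emeasure M (space M) = 1" and f: "f \<in> borel_measurable M" and a: "1 \<le> a"
  shows "enn_powr (\<integral>\<^sup>+x. f x \<partial>M) a \<le> (\<integral>\<^sup>+x. enn_powr (f x) a \<partial>M)"
proof -
  have le1: "y \<le> 1 + enn_powr y a" for y
  proof (cases y)
    case (real r)
    have "r \<le> 1 + r powr a"
    proof (cases "r \<le> 1")
      case False
      then have "r powr 1 \<le> r powr a" using a by (intro powr_mono) auto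
      then show ?thesis using False by simp
    qed (simp add: add_increasing2)
    then show ?thesis using real by (simp add: enn_powr_def ennreal_leI flip: ennreal_1 ennreal_plus)
  qed (simp add: enn_powr_def)
  show ?thesis
  proof (cases "\<integral>\<^sup>+x. f x \<partial>M")
    case (real m)
    show ?thesis
    proof (cases "m = 0")
      case False
      then have m: "0 < m" using real by simp
      have pt: "ennreal (a * m powr (a - 1)) * y \<le> enn_powr y a + ennreal ((a - 1) * m powr a)" for y
        using young_tangent[OF a _ m] a
        by (cases y) (auto simp: enn_powr_def ennreal_leI simp flip: ennreal_mult ennreal_plus)
      have "ennreal (a * m powr a) = ennreal (a * m powr (a - 1)) * (\<integral>\<^sup>+x. f x \<partial>M)"
        unfolding real using m a by (simp add: powr_diff flip: ennreal_mult)
      also have "\<dots> = (\<integral>\<^sup>+x. ennreal (a * m powr (a - 1)) * f x \<partial>M)"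
        using f by (rule nn_integral_cmult[symmetric])
      also have "\<dots> \<le> (\<integral>\<^sup>+x. enn_powr (f x) a + ennreal ((a - 1) * m powr a) \<partial>M)"
        by (intro nn_integral_mono pt)
      also have "\<dots> = (\<integral>\<^sup>+x. enn_powr (f x) a \<partial>M) + ennreal ((a - 1) * m powr a)"
        using f by (subst nn_integral_add) (auto simp: M enn_powr_measurable)
      also have "ennreal (a * m powr a) = ennreal ((a - 1) * m powr a) + ennreal (m powr a)"
      proof -
        have nn: "0 \<le> (a - 1) * m powr a" using a by simp
        show ?thesis by (subst ennreal_plus[OF nn, symmetric]) (auto simp: algebra_simps)
      qed
      finally have "ennreal (m powr a) \<le> (\<integral>\<^sup>+x. enn_powr (f x) a \<partial>M)"
        unfolding add.commute[of "\<integral>\<^sup>+x. enn_powr (f x) a \<partial>M"] by (simp add: ennreal_add_left_cancel_le)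
      then show ?thesis unfolding real using real m by (simp add: enn_powr_def)
    qed (simp add: real)
  next
    case top
    have "(\<integral>\<^sup>+x. f x \<partial>M) \<le> (\<integral>\<^sup>+x. 1 + enn_powr (f x) a \<partial>M)"
      by (intro nn_integral_mono le1)
    also have "\<dots> = 1 + (\<integral>\<^sup>+x. enn_powr (f x) a \<partial>M)"
      using f by (subst nn_integral_add) (auto simp: M enn_powr_measurable)
    finally have "(\<integral>\<^sup>+x. enn_powr (f x) a \<partial>M) = top"
      by (simp add: top top_unique)
    then show ?thesis by simp
  qed
qed

section \<open>Averages over balls of variable radius\<close>

text \<open>The variable \<open>h\<close> ranges over a fixed ball, independent of \<open>x\<close>:
  one \<open>h\<close> then perturbs a whole curve, and averages along curves can be exchanged with
  the integral over \<open>h\<close>.\<close>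

definition ball_average :: "('a::euclidean_space \<Rightarrow> real) \<Rightarrow> ('a \<Rightarrow> ennreal) \<Rightarrow> 'a \<Rightarrow> ennreal" where
  "ball_average \<delta> \<rho> x = (\<integral>\<^sup>+h. \<rho> (x + \<delta> x *\<^sub>R h) \<partial>uniform_measure lborel (ball 0 1))"

lemma emeasure_unit_ball:
  "emeasure lborel (ball (0::'a::euclidean_space) 1) = ennreal (unit_ball_vol (real DIM('a)))"
  using emeasure_ball[of 1 "0::'a"] by simp

lemma emeasure_uniform_unit_ball:
  "emeasure (uniform_measure lborel (ball 0 1)) (space (uniform_measure lborel (ball (0::'a::euclidean_space) 1))) = 1"
proof -
  have "0 < unit_ball_vol (real DIM('a))" by simp
  then have "ennreal (unit_ball_vol (real DIM('a))) \<noteq> 0"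
    by (metis ennreal_eq_0_iff not_less)
  then show ?thesis by (simp add: emeasure_unit_ball ennreal_divide_self)
qed

lemma ball_average_eq:
  fixes x :: "'a::euclidean_space"
  assumes \<rho>: "\<rho> \<in> borel_measurable borel"
  shows "ball_average \<delta> \<rho> x =
    ennreal (1 / unit_ball_vol (real DIM('a))) * (\<integral>\<^sup>+h. \<rho> (x + \<delta> x *\<^sub>R h) * indicator (ball 0 1) h \<partial>lborel)"
proof -
  have "(\<lambda>h. \<rho> (x + \<delta> x *\<^sub>R h)) \<in> borel_measurable lborel"
    using \<rho> by measurable
  then have "ball_average \<delta> \<rho> x =
    (\<integral>\<^sup>+h. \<rho> (x + \<delta> x *\<^sub>R h) * indicator (ball 0 1) h \<partial>lborel) / ennreal (unit_ball_vol (real DIM('a)))"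
    unfolding ball_average_def
    by (subst nn_integral_uniform_measure) (auto simp: emeasure_unit_ball)
  then show ?thesis
    by (simp add: divide_ennreal_def inverse_ennreal inverse_eq_divide mult.commute)
qed

lemma enn_powr_ball_average_le:
  fixes \<rho> :: "'a::euclidean_space \<Rightarrow> ennreal"
  assumes \<rho>: "\<rho> \<in> borel_measurable borel" and a: "1 \<le> a"
  shows "enn_powr (ball_average \<delta> \<rho> x) a \<le> ball_average \<delta> (\<lambda>z. enn_powr (\<rho> z) a) x"
  unfolding ball_average_def
proof (rule enn_powr_nn_integral_le)
  have "(\<lambda>h. \<rho> (x + \<delta> x *\<^sub>R h)) \<in> borel_measurable borel"
    using \<rho> by measurable
  then show "(\<lambda>h. \<rho> (x + \<delta> x *\<^sub>R h)) \<in> borel_measurable (uniform_measure lborel (ball 0 1))"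
    by simp
qed (rule emeasure_uniform_unit_ball a)+

lemma nn_integral_lborel_affine:
  fixes f :: "'a::euclidean_space \<Rightarrow> ennreal"
  assumes f: "f \<in> borel_measurable borel" and c: "0 < c"
  shows "(\<integral>\<^sup>+z. f z \<partial>lborel) = ennreal (c ^ DIM('a)) * (\<integral>\<^sup>+h. f (x + c *\<^sub>R h) \<partial>lborel)"
proof -
  have "(\<integral>\<^sup>+z. f z \<partial>lborel) = (\<integral>\<^sup>+z. f z \<partial>density (distr lborel borel (\<lambda>h. x + c *\<^sub>R h)) (\<lambda>_. ennreal (\<bar>c\<bar> ^ DIM('a))))"
    using lborel_affine[of c x] c by simp
  also have "\<dots> = (\<integral>\<^sup>+h. ennreal (\<bar>c\<bar> ^ DIM('a)) * f (x + c *\<^sub>R h) \<partial>lborel)"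
    using f by (simp add: nn_integral_density nn_integral_distr)
  also have "\<dots> = ennreal (c ^ DIM('a)) * (\<integral>\<^sup>+h. f (x + c *\<^sub>R h) \<partial>lborel)"
    using f c by (subst nn_integral_cmult) auto
  finally show ?thesis .
qed

text \<open>The substitution z = x + \<delta>(x) h gives the form to which Fubini in (x, z)
  applies.\<close>

lemma ball_average_eq_kernel:
  fixes x :: "'a::euclidean_space"
  assumes \<rho>: "\<rho> \<in> borel_measurable borel" and \<delta>: "0 < \<delta> x"
  shows "ball_average \<delta> \<rho> x =
    (\<integral>\<^sup>+z. ennreal (1 / (unit_ball_vol (real DIM('a)) * \<delta> x ^ DIM('a))) * indicator {y. dist x y < \<delta> x} z * \<rho> z \<partial>lborel)"
proof -
  let ?v = "unit_ball_vol (real DIM('a))"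
  have [measurable]: "{y. dist x y < \<delta> x} \<in> sets borel" by measurable
  have "(\<integral>\<^sup>+z. ennreal (1 / (?v * \<delta> x ^ DIM('a))) * indicator {y. dist x y < \<delta> x} z * \<rho> z \<partial>lborel)
    = ennreal (1 / (?v * \<delta> x ^ DIM('a))) * (\<integral>\<^sup>+z. indicator {y. dist x y < \<delta> x} z * \<rho> z \<partial>lborel)"
    using \<rho> by (simp add: mult.assoc nn_integral_cmult)
  also have "(\<integral>\<^sup>+z. indicator {y. dist x y < \<delta> x} z * \<rho> z \<partial>lborel)
    = ennreal (\<delta> x ^ DIM('a)) * (\<integral>\<^sup>+h. indicator {y. dist x y < \<delta> x} (x + \<delta> x *\<^sub>R h) * \<rho> (x + \<delta> x *\<^sub>R h) \<partial>lborel)"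
    using \<rho> \<delta> by (intro nn_integral_lborel_affine) auto
  also have "(\<integral>\<^sup>+h. indicator {y. dist x y < \<delta> x} (x + \<delta> x *\<^sub>R h) * \<rho> (x + \<delta> x *\<^sub>R h) \<partial>lborel)
    = (\<integral>\<^sup>+h. \<rho> (x + \<delta> x *\<^sub>R h) * indicator (ball 0 1) h \<partial>lborel)"
    using \<delta> by (intro nn_integral_cong) (auto simp: indicator_def dist_norm)
  finally show ?thesis
    unfolding ball_average_eq[OF \<rho>] using \<delta>
    by (simp add: mult.assoc[symmetric] flip: ennreal_mult)
qed

text \<open>By Fubini it suffices to bound the integral of the kernel over x for fixed z. If z lies
  in the ball about x, then (1 - e) \<delta>(x) \<le> \<delta>(z) \<le> (1 + e) \<delta>(x). So x is
  within \<delta>(z) / (1 - e) of z, the kernel is at most (1 + e)^n divided by the volume of the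
  ball of radius \<delta>(z), and the quotient of volumes is the constant.\<close>

lemma nn_integral_ball_average_le:
  fixes \<rho> :: "'a::euclidean_space \<Rightarrow> ennreal"
  assumes \<rho>: "\<rho> \<in> borel_measurable borel" and \<delta>: "e-lipschitz_on UNIV \<delta>" "\<And>x. 0 \<le> \<delta> x" and e: "e < 1"
  shows "(\<integral>\<^sup>+x. indicator {x. 0 < \<delta> x} x * ball_average \<delta> \<rho> x \<partial>lborel)
    \<le> ennreal (((1 + e) / (1 - e)) ^ DIM('a)) * (\<integral>\<^sup>+z. \<rho> z \<partial>lborel)"
proof -
  let ?n = "DIM('a)" and ?v = "unit_ball_vol (real DIM('a))"
  have e0: "0 \<le> e" using \<delta>(1) by (rule lipschitz_on_nonneg)
  have [measurable]: "\<delta> \<in> borel_measurable borel"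
    using lipschitz_on_continuous_on[OF \<delta>(1)] by (rule borel_measurable_continuous_onI)
  define k where "k x z = ennreal (1 / (?v * \<delta> x ^ ?n)) * indicator {y. dist x y < \<delta> x} z" for x z
  have kmeas: "(\<lambda>(x, z). k x z * \<rho> z) \<in> borel_measurable (lborel \<Otimes>\<^sub>M lborel)"
  proof -
    have "(\<lambda>p. k (fst p) (snd p) * \<rho> (snd p)) \<in> borel_measurable (borel \<Otimes>\<^sub>M borel)"
      unfolding k_def indicator_def using \<rho> by measurable
    then show ?thesis by (simp add: case_prod_beta' cong: measurable_cong_sets)
  qed
  have k_le: "(\<integral>\<^sup>+x. k x z \<partial>lborel) \<le> ennreal (((1 + e) / (1 - e)) ^ ?n)" for z
  proof (cases "\<delta> z = 0")
    case True
    \<comment> \<open>A zero \<open>z\<close> of \<delta> is never reached: \<delta>(x) \<le> e |x -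
      z| \<le> |x - z|.\<close>
    have "k x z = 0" for x
    proof -
      have "\<delta> x \<le> e * dist x z" using lipschitz_onD[OF \<delta>(1), of x z] True by (simp add: dist_real_def)
      also have "\<dots> \<le> dist x z" using e by (simp add: mult_left_le_one_le e0)
      finally show ?thesis by (simp add: k_def indicator_def)
    qed
    then show ?thesis by simp
  next
    case False
    then have z: "0 < \<delta> z" using \<delta>(2)[of z] by simp
    have "k x z \<le> ennreal ((1 + e) ^ ?n / (?v * \<delta> z ^ ?n)) * indicator (ball z (\<delta> z / (1 - e))) x" for x
    proof (cases "dist x z < \<delta> x")
      case True
      have "dist (\<delta> x) (\<delta> z) \<le> e * dist x z" using lipschitz_onD[OF \<delta>(1)] by simp
      also have "e * dist x z \<le> e * \<delta> x" using True e0 by (intro mult_left_mono) auto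
      finally have cmp: "\<delta> z \<le> (1 + e) * \<delta> x" "(1 - e) * \<delta> x \<le> \<delta> z"
        by (auto simp: dist_real_def algebra_simps abs_le_iff)
      have x: "0 < \<delta> x" using True zero_le_dist[of x z] by linarith
      have "\<delta> x \<le> \<delta> z / (1 - e)" using cmp(2) e by (simp add: field_simps)
      then have "x \<in> ball z (\<delta> z / (1 - e))" using True by (simp add: dist_commute)
      moreover have "1 / (?v * \<delta> x ^ ?n) \<le> (1 + e) ^ ?n / (?v * \<delta> z ^ ?n)"
      proof -
        have "\<delta> z ^ ?n \<le> ((1 + e) * \<delta> x) ^ ?n" using cmp(1) z by (intro power_mono) auto
        then have "?v * \<delta> z ^ ?n \<le> (1 + e) ^ ?n * (?v * \<delta> x ^ ?n)"
          by (simp add: power_mult_distrib mult_left_mono mult.left_commute)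
        moreover have "0 < ?v" by simp
        ultimately show ?thesis using x z e0 by (simp add: divide_simps)
      qed
      ultimately show ?thesis using True by (simp add: k_def ennreal_leI)
    qed (simp add: k_def)
    then have "(\<integral>\<^sup>+x. k x z \<partial>lborel)
      \<le> (\<integral>\<^sup>+x. ennreal ((1 + e) ^ ?n / (?v * \<delta> z ^ ?n)) * indicator (ball z (\<delta> z / (1 - e))) x \<partial>lborel)"
      by (intro nn_integral_mono)
    also have "\<dots> = ennreal ((1 + e) ^ ?n / (?v * \<delta> z ^ ?n)) * emeasure lborel (ball z (\<delta> z / (1 - e)))"
      by (intro nn_integral_cmult_indicator) simp
    also have "\<dots> = ennreal (((1 + e) / (1 - e)) ^ ?n)"
    proof -
      have "0 < ?v" by simp
      then show ?thesis
        using z e e0 by (simp add: emeasure_ball power_divide less_imp_neq[symmetric] flip: ennreal_mult)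
    qed
    finally show ?thesis .
  qed
  have "(\<integral>\<^sup>+x. indicator {x. 0 < \<delta> x} x * ball_average \<delta> \<rho> x \<partial>lborel) \<le> (\<integral>\<^sup>+x. (\<integral>\<^sup>+z. k x z * \<rho> z \<partial>lborel) \<partial>lborel)"
    using \<rho> by (intro nn_integral_mono) (auto simp: indicator_def ball_average_eq_kernel k_def)
  also have "\<dots> = (\<integral>\<^sup>+z. (\<integral>\<^sup>+x. k x z * \<rho> z \<partial>lborel) \<partial>lborel)"
    using kmeas by (intro lborel_pair.Fubini') simp
  also have "\<dots> = (\<integral>\<^sup>+z. (\<integral>\<^sup>+x. k x z \<partial>lborel) * \<rho> z \<partial>lborel)"
  proof (intro nn_integral_cong nn_integral_multc)
    fix z
    have "(\<lambda>x. k x z) \<in> borel_measurable borel"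
      unfolding k_def indicator_def by measurable
    then show "(\<lambda>x. k x z) \<in> borel_measurable lborel" by simp
  qed
  also have "\<dots> \<le> (\<integral>\<^sup>+z. ennreal (((1 + e) / (1 - e)) ^ ?n) * \<rho> z \<partial>lborel)"
    by (intro nn_integral_mono mult_right_mono k_le) auto
  also have "\<dots> = ennreal (((1 + e) / (1 - e)) ^ ?n) * (\<integral>\<^sup>+z. \<rho> z \<partial>lborel)"
    using \<rho> by (intro nn_integral_cmult) simp
  finally show ?thesis .
qed

lemma ball_average_measurable:
  fixes \<rho> :: "'a::euclidean_space \<Rightarrow> ennreal"
  assumes \<rho>: "\<rho> \<in> borel_measurable borel" and \<delta>: "\<delta> \<in> borel_measurable borel"
  shows "ball_average \<delta> \<rho> \<in> borel_measurable borel"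
proof -
  have [measurable]: "ball (0::'a) 1 \<in> sets borel" by simp
  have "(\<lambda>p. \<rho> (fst p + \<delta> (fst p) *\<^sub>R snd p) * indicator (ball 0 1) (snd p)) \<in> borel_measurable (borel \<Otimes>\<^sub>M borel)"
    using \<rho> \<delta> by measurable
  then have "(\<lambda>(x, h). \<rho> (x + \<delta> x *\<^sub>R h) * indicator (ball 0 1) h) \<in> borel_measurable (borel \<Otimes>\<^sub>M lborel)"
    by (simp add: case_prod_beta' cong: measurable_cong_sets)
  then have "(\<lambda>x. \<integral>\<^sup>+h. \<rho> (x + \<delta> x *\<^sub>R h) * indicator (ball 0 1) h \<partial>lborel) \<in> borel_measurable borel"
    by (rule lborel.borel_measurable_nn_integral)
  then show ?thesis
    unfolding ball_average_eq[OF \<rho>] by measurable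
qed

section \<open>Crossing the level sets\<close>

lemma sets_disjointed:
  assumes "\<And>i. K i \<in> sets M"
  shows "disjointed K i \<in> sets M"
proof -
  have "range K \<subseteq> sets M" using assms by auto
  from sets.range_disjointed_sets[OF this] show ?thesis by blast
qed

text \<open>The map recovers \<open>h\<close> from
  \<open>z = c t + \<delta> (c t) *\<^sub>R h\<close>. It is Lipschitz because \<delta> is bounded
  below along the compact curve.\<close>

lemma continuous_lipschitz_quotient:
  fixes c :: "real \<Rightarrow> 'a::euclidean_space"
  assumes c: "1-lipschitz_on {0..L} c" and \<delta>: "e-lipschitz_on UNIV \<delta>" and pos: "\<And>t. t \<in> {0..L} \<Longrightarrow> 0 < \<delta> (c t)"
  obtains M where "M-lipschitz_on (cball 0 R \<times> {0..L}) (\<lambda>(z, t). (z - c t) /\<^sub>R \<delta> (c t))"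
proof (cases "{0..L} = {}")
  case True
  then show thesis by (intro that[of 0]) (simp add: lipschitz_on_def)
next
  case False
  have cc: "continuous_on {0..L} c" using c by (rule lipschitz_on_continuous_on)
  have "continuous_on {0..L} (\<lambda>t. \<delta> (c t))"
    using continuous_on_compose2[OF lipschitz_on_continuous_on[OF \<delta>] cc] by simp
  then obtain t0 where t0: "t0 \<in> {0..L}" "\<And>t. t \<in> {0..L} \<Longrightarrow> \<delta> (c t0) \<le> \<delta> (c t)"
    using continuous_attains_inf[of "{0..L}"] False by (metis compact_Icc)
  define m where "m = \<delta> (c t0)"
  have m: "0 < m" "\<And>t. t \<in> {0..L} \<Longrightarrow> m \<le> \<delta> (c t)" using t0 pos by (auto simp: m_def)
  have "bounded (c ` {0..L})" using cc by (intro compact_imp_bounded compact_continuous_image) auto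
  then obtain R' where R': "0 < R'" "\<And>t. t \<in> {0..L} \<Longrightarrow> norm (c t) \<le> R'"
    unfolding bounded_pos by auto
  have e: "0 \<le> e" using \<delta> by (rule lipschitz_on_nonneg)
  \<comment> \<open>The first term comes from varying the numerator, the second from varying
    \<open>1 / \<delta> (c t)\<close>, whose Lipschitz constant is \<open>e / m\<^sup>2\<close>,
    against a numerator of norm at most \<open>\<bar>R\<bar> + R'\<close>.\<close>
  define M where "M = 2 / m + e / m\<^sup>2 * (\<bar>R\<bar> + R')"
  have M: "0 \<le> M" using m e R' by (simp add: M_def)
  show thesis
  proof (rule that, rule lipschitz_onI)
    show "0 \<le> M" by (rule M)
    fix p q :: "'a \<times> real" assume "p \<in> cball 0 R \<times> {0..L}" "q \<in> cball 0 R \<times> {0..L}"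
    then obtain z z' :: 'a and t t' :: real where pq: "p = (z, t)" "q = (z', t')" "norm z' \<le> R" "t \<in> {0..L}" "t' \<in> {0..L}"
      by auto
    define g where "g s = 1 / \<delta> (c s)" for s
    have dz: "norm (z - z') \<le> dist p q" "\<bar>t - t'\<bar> \<le> dist p q"
      using dist_fst_le[of p q] dist_snd_le[of p q] by (auto simp: pq dist_norm)
    have ct: "norm (c t - c t') \<le> dist p q"
      using lipschitz_onD[OF c pq(4,5)] dz(2) by (simp add: dist_norm)
    have g: "\<bar>g t\<bar> \<le> 1 / m"
      using m pq pos[of t] by (auto simp: g_def intro!: divide_left_mono)
    have gg: "\<bar>g t - g t'\<bar> \<le> e / m\<^sup>2 * dist p q"
    proof -
      have "\<bar>g t - g t'\<bar> = \<bar>\<delta> (c t') - \<delta> (c t)\<bar> / (\<delta> (c t) * \<delta> (c t'))"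
        using pos[of t] pos[of t'] pq by (simp add: g_def field_simps abs_mult)
      also have "\<dots> \<le> (e * dist p q) / (m * m)"
      proof (intro frac_le mult_mono)
        have "\<bar>\<delta> (c t') - \<delta> (c t)\<bar> \<le> e * norm (c t - c t')"
          using lipschitz_onD[OF \<delta>, of "c t'" "c t"] by (simp add: dist_norm norm_minus_commute)
        also have "\<dots> \<le> e * dist p q" using e ct by (rule mult_left_mono[rotated])
        finally show "\<bar>\<delta> (c t') - \<delta> (c t)\<bar> \<le> e * dist p q" .
      qed (use m pq pos[of t] e in \<open>auto intro: less_imp_le\<close>)
      finally show ?thesis by (simp add: power2_eq_square)
    qed
    have "dist (case p of (z, t) \<Rightarrow> (z - c t) /\<^sub>R \<delta> (c t)) (case q of (z, t) \<Rightarrow> (z - c t) /\<^sub>R \<delta> (c t))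
      = norm (g t *\<^sub>R ((z - z') - (c t - c t')) + (g t - g t') *\<^sub>R (z' - c t'))"
      by (simp add: pq dist_norm g_def inverse_eq_divide algebra_simps)
    also have "\<dots> \<le> \<bar>g t\<bar> * norm ((z - z') - (c t - c t')) + \<bar>g t - g t'\<bar> * norm (z' - c t')"
      by (rule order_trans[OF norm_triangle_ineq]) simp
    also have "\<dots> \<le> (1 / m) * (dist p q + dist p q) + (e / m\<^sup>2 * dist p q) * (\<bar>R\<bar> + R')"
    proof (intro add_mono mult_mono)
      show "norm ((z - z') - (c t - c t')) \<le> dist p q + dist p q"
        using norm_triangle_ineq4[of "z - z'" "c t - c t'"] dz ct by simp
      show "norm (z' - c t') \<le> \<bar>R\<bar> + R'"
        using norm_triangle_ineq4[of z' "c t'"] R'(2)[OF pq(5)] pq(3) by simp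
    qed (use g gg m e in auto)
    also have "\<dots> = M * dist p q" by (simp add: M_def algebra_simps)
    finally show "dist (case p of (z, t) \<Rightarrow> (z - c t) /\<^sub>R \<delta> (c t)) (case q of (z, t) \<Rightarrow> (z - c t) /\<^sub>R \<delta> (c t)) \<le> M * dist p q" .
  qed
qed

text \<open>Admissibility along one curve. A pair (h, r) is bad if the perturbed curve attains the
  level r, but nowhere inside the pieces. For almost every r the bad h are null, hence for almost
  every h the bad r are null. For such h the intermediate value theorem and the piecewise Lipschitz
  estimate give the bound, which is then averaged over h.\<close>

lemma crossing_bound:
  fixes c :: "real \<Rightarrow> 'a::euclidean_space" and u :: "'a \<Rightarrow> real" and K :: "nat \<Rightarrow> 'a set" and \<eta> :: "real \<Rightarrow> ennreal"
  assumes dim: "DIM('a) = Suc k" "0 < k"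
    and u: "continuous_on D u" "u \<in> borel_measurable borel"
    and \<delta>: "e-lipschitz_on UNIV \<delta>" "\<And>x. x \<in> D \<Longrightarrow> 0 < \<delta> x"
      "\<And>x h. x \<in> D \<Longrightarrow> norm h \<le> 1 \<Longrightarrow> x + \<delta> x *\<^sub>R h \<in> D \<and> \<bar>u (x + \<delta> x *\<^sub>R h) - u x\<bar> \<le> \<epsilon>"
    and c: "1-lipschitz_on UNIV c" "\<And>t. c t \<in> D" and L: "0 \<le> L"
    and ends: "u (c 0) \<le> r1" "r2 \<le> u (c L)"
    and K: "\<And>i. compact (K i)" "\<And>i. K i \<subseteq> D" "\<And>i. (\<sigma> i)-lipschitz_on (K i) u"
    and bad: "AE r in lborel. r1 < r \<and> r < r2 \<longrightarrow> hausdorff_measure k ((D - (\<Union>i. K i)) \<inter> {x. u x = r}) = 0"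
    and \<eta>: "\<eta> \<in> borel_measurable borel"
    and \<rho>_def: "\<rho> = (\<lambda>x. (\<Sum>i. ennreal (\<sigma> i) * indicator (disjointed K i) x) * \<eta> (u x))"
    and \<epsilon>: "0 < \<epsilon>"
  shows "(\<integral>\<^sup>+r. indicator {r1 + \<epsilon> <..< r2 - \<epsilon>} r * \<eta> r \<partial>lborel)
    \<le> ennreal (1 + e) * (\<integral>\<^sup>+t. indicator {0..L} t * ball_average \<delta> \<rho> (c t) \<partial>lborel)"
proof -
  define w where "w h t = c t + \<delta> (c t) *\<^sub>R h" for h t
  define G where "G = (\<Union>i. K i)"
  have e: "0 \<le> e" using \<delta>(1) by (rule lipschitz_on_nonneg)
  have cont_c: "continuous_on UNIV c" using c(1) by (rule lipschitz_on_continuous_on)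
  have cont_\<delta>: "continuous_on UNIV \<delta>" using \<delta>(1) by (rule lipschitz_on_continuous_on)
  have cont_\<delta>c: "continuous_on UNIV (\<lambda>t. \<delta> (c t))" using continuous_on_compose2[OF cont_\<delta> cont_c] by simp
  have wD: "w h t \<in> D" "\<bar>u (w h t) - u (c t)\<bar> \<le> \<epsilon>" if "norm h \<le> 1" for h t
    using \<delta>(3)[OF c(2) that] by (auto simp: w_def)
  have cont_w: "continuous_on UNIV (w h)" for h
    unfolding w_def by (intro continuous_intros cont_c cont_\<delta>c)
  have cont_w2: "continuous_on UNIV (\<lambda>p. w (fst p) (snd p))"
  proof -
    have "continuous_on UNIV (\<lambda>p::'a \<times> real. c (snd p))" "continuous_on UNIV (\<lambda>p::'a \<times> real. \<delta> (c (snd p)))"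
      by (rule continuous_on_compose2[OF cont_c] continuous_on_compose2[OF cont_\<delta>c], auto intro: continuous_intros)+
    then show ?thesis unfolding w_def by (intro continuous_intros)
  qed
  have cont_uw2: "continuous_on (cball 0 1 \<times> UNIV) (\<lambda>p. u (w (fst p) (snd p)))"
    by (rule continuous_on_compose2[OF u(1) continuous_on_subset[OF cont_w2]]) (use wD in auto)
  let ?g = "\<lambda>p. w (fst p) (snd p)"
  let ?Q = "cball (0::'a) 1 \<times> {0..L}"
  \<comment> \<open>\<open>W\<close> will consist of the pairs (h, attained level),
    \<open>WG\<close> of those attained inside a piece. As images of compact sets they are Borel,
    which licenses the exchange of the two almost-everywhere quantifiers.\<close>
  define \<Phi> where "\<Phi> p = (fst p, u (w (fst p) (snd p)))" for p
  have cont_\<Phi>: "continuous_on ?Q \<Phi>"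
    unfolding \<Phi>_def using continuous_on_subset[OF cont_uw2, of ?Q] by (intro continuous_intros) auto
  have compQ: "compact ?Q" by (intro compact_Times) auto
  define W where "W = \<Phi> ` ?Q"
  define WG where "WG = (\<Union>i. \<Phi> ` (?Q \<inter> ?g -` K i))"
  have W: "W \<in> sets borel"
    unfolding W_def using compact_continuous_image[OF cont_\<Phi> compQ] by (simp add: borel_compact)
  have WG: "WG \<in> sets borel"
  proof -
    have "compact (?Q \<inter> ?g -` K i)" for i
      using cont_w2 K(1)[of i] compQ
      by (intro compact_Int_closed closed_vimage) (auto intro: compact_imp_closed)
    then have "compact (\<Phi> ` (?Q \<inter> ?g -` K i))" for i
      by (intro compact_continuous_image continuous_on_subset[OF cont_\<Phi>]) auto
    then show ?thesis unfolding WG_def by (intro sets.countable_UN) (auto intro: borel_compact)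
  qed
  define P where "P h r \<longleftrightarrow> (r1 < r \<and> r < r2 \<and> (h, r) \<in> W \<longrightarrow> (h, r) \<in> WG)" for h r
  have Pm: "{p. P (fst p) (snd p)} \<in> sets borel"
  proof -
    have "{p. P (fst p) (snd p)} = (UNIV - {p. r1 < snd p \<and> snd p < r2}) \<union> (UNIV - W) \<union> WG"
      by (auto simp: P_def)
    moreover have "open {p :: 'a \<times> real. r1 < snd p \<and> snd p < r2}"
      by (intro open_Collect_conj open_Collect_less continuous_intros)
    ultimately show ?thesis using W WG by auto
  qed
  have "bounded (?g ` ?Q)"
    using compQ continuous_on_subset[OF cont_w2] by (intro compact_imp_bounded compact_continuous_image) auto
  then obtain R where "\<And>x. x \<in> ?g ` ?Q \<Longrightarrow> norm x \<le> R"
    unfolding bounded_iff by blast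
  then have R: "norm (w h t) \<le> R" if "norm h \<le> 1" "t \<in> {0..L}" for h t
    using that by force
  have "AE r in lborel. AE h in lborel. P h r"
    using bad
  proof eventually_elim
    fix r assume r: "r1 < r \<and> r < r2 \<longrightarrow> hausdorff_measure k ((D - (\<Union>i. K i)) \<inter> {x. u x = r}) = 0"
    show "AE h in lborel. P h r"
    proof (cases "r1 < r \<and> r < r2")
      case True
      \<comment> \<open>The quotient map is Lipschitz only for bounded \<open>z\<close>;
        \<open>R\<close> bounds all the perturbed curves, so the truncation loses no hit.\<close>
      define Z where "Z = ((D - G) \<inter> {x. u x = r}) \<inter> cball 0 R"
      have Z0: "hausdorff_measure k Z = 0"
      proof -
        have "Z \<subseteq> (D - G) \<inter> {x. u x = r}" by (auto simp: Z_def)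
        then have "hausdorff_measure k Z \<le> hausdorff_measure k ((D - G) \<inter> {x. u x = r})"
          by (rule hausdorff_measure_mono)
        also have "\<dots> = 0" using r True by (simp add: G_def)
        finally show ?thesis by simp
      qed
      let ?F = "\<lambda>(z, t). (z - c t) /\<^sub>R \<delta> (c t)"
      obtain M where "M-lipschitz_on (cball 0 R \<times> {0..L}) ?F"
        using continuous_lipschitz_quotient[OF lipschitz_on_subset[OF c(1)] \<delta>(1), of L R] \<delta>(2) c(2) by auto
      then have "M-lipschitz_on (Z \<times> {0..L}) ?F"
        by (rule lipschitz_on_subset) (auto simp: Z_def)
      then have neg: "negligible (?F ` (Z \<times> {0..L}))"
        using Z0 dim L by (rule negligible_lipschitz_image_times_interval)
      have "{h. \<not> P h r} \<subseteq> ?F ` (Z \<times> {0..L})"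
      proof
        fix h assume "h \<in> {h. \<not> P h r}"
        then have h: "(h, r) \<in> W" "(h, r) \<notin> WG" by (auto simp: P_def)
        then obtain t where t: "norm h \<le> 1" "t \<in> {0..L}" "r = u (w h t)"
          by (auto simp: W_def \<Phi>_def)
        have "w h t \<notin> G"
        proof
          assume "w h t \<in> G"
          then obtain i where "w h t \<in> K i" by (auto simp: G_def)
          then have "(h, t) \<in> ?Q \<inter> ?g -` K i" using t by simp
          moreover have "(h, r) = \<Phi> (h, t)" by (simp add: \<Phi>_def t(3))
          ultimately have "(h, r) \<in> \<Phi> ` (?Q \<inter> ?g -` K i)" by (rule rev_image_eqI)
          then have "(h, r) \<in> WG" unfolding WG_def by (rule UN_I[OF UNIV_I])
          then show False using h(2) by simp
        qed
        then have "w h t \<in> Z" using wD(1)[OF t(1)] R[OF t(1,2)] t(3) by (simp add: Z_def)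
        moreover have "h = (w h t - c t) /\<^sub>R \<delta> (c t)" using \<delta>(2)[OF c(2)[of t]] by (simp add: w_def)
        ultimately show "h \<in> ?F ` (Z \<times> {0..L})"
          using t(2) by (intro image_eqI[of _ _ "(w h t, t)"]) auto
      qed
      then have "negligible {h. \<not> P h r}" using neg negligible_subset by blast
      then have "AE h in lebesgue. P h r"
        by (intro AE_I'[of "{h. \<not> P h r}"]) (auto simp: negligible_iff_null_sets)
      then show ?thesis by (simp add: AE_completion_iff)
    next
      case False
      then have "P h r" for h by (auto simp: P_def)
      then show ?thesis by simp
    qed
  qed
  moreover have "{p \<in> space (lborel \<Otimes>\<^sub>M lborel). P (fst p) (snd p)} \<in> sets (lborel \<Otimes>\<^sub>M lborel)"
    unfolding lborel_prod using Pm by simp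
  ultimately have AE_h: "AE h in lborel. AE r in lborel. P h r"
    using lborel_pair.AE_commute[of P] by blast
  have [measurable]: "K i \<in> sets borel" for i using K(1) by (rule borel_compact)
  have dK[measurable]: "disjointed K i \<in> sets borel" for i by (rule sets_disjointed) simp
  have \<rho>m: "\<rho> \<in> borel_measurable borel"
    unfolding \<rho>_def using u(2) \<eta> by measurable
  let ?I = "\<integral>\<^sup>+r. indicator {r1 + \<epsilon> <..< r2 - \<epsilon>} r * \<eta> r \<partial>lborel"
  let ?J = "\<lambda>h. \<integral>\<^sup>+t. indicator {0..L} t * \<rho> (w h t) \<partial>lborel"
  have I_le: "?I \<le> ennreal (1 + e) * ?J h" if h: "norm h \<le> 1" and ae: "AE r in lborel. P h r" for h
  proof -
    define g where "g t = u (w h t)" for t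
    have cont_g: "continuous_on UNIV g"
      unfolding g_def using wD(1)[OF h] by (intro continuous_on_compose2[OF u(1) cont_w]) auto
    define S where "S i = {0..L} \<inter> w h -` disjointed K i" for i
    have US: "(\<Union>i. S i) = {0..L} \<inter> w h -` G"
      unfolding S_def G_def UN_disjointed_eq[of K, symmetric] by blast
    have Sm: "S i \<in> sets lebesgue" for i
    proof -
      have "w h -` disjointed K i \<in> sets borel"
        using measurable_sets_borel[OF borel_measurable_continuous_onI[OF cont_w] dK] .
      then have "S i \<in> sets borel" unfolding S_def by auto
      then show ?thesis by simp
    qed
    \<comment> \<open>The summand 1 is the speed of \<open>c\<close>, and \<open>e\<close> that of
      \<delta> along \<open>c\<close>, with |h| \<le> 1.\<close>
    have lip_w: "dist (w h s) (w h t) \<le> (1 + e) * dist s t" for s t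
    proof -
      have 1: "dist (c s) (c t) \<le> dist s t" using lipschitz_onD[OF c(1), of s t] by simp
      have "\<bar>\<delta> (c s) - \<delta> (c t)\<bar> \<le> e * dist (c s) (c t)"
        using lipschitz_onD[OF \<delta>(1), of "c s" "c t"] by (simp add: dist_real_def)
      also have "\<dots> \<le> e * dist s t" using e 1 by (rule mult_left_mono[rotated])
      finally have 2: "\<bar>\<delta> (c s) - \<delta> (c t)\<bar> * norm h \<le> (e * dist s t) * 1"
        using h e by (intro mult_mono) auto
      have "w h s - w h t = (c s - c t) + (\<delta> (c s) - \<delta> (c t)) *\<^sub>R h"
        by (simp add: w_def algebra_simps)
      then have "dist (w h s) (w h t) \<le> norm (c s - c t) + \<bar>\<delta> (c s) - \<delta> (c t)\<bar> * norm h"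
        using norm_triangle_ineq[of "c s - c t" "(\<delta> (c s) - \<delta> (c t)) *\<^sub>R h"] by (simp add: dist_norm)
      also have "\<dots> \<le> dist s t + e * dist s t" using 1 2 by (simp add: dist_norm)
      finally show ?thesis by (simp add: algebra_simps)
    qed
    have lip: "((1 + e) * \<sigma> i)-lipschitz_on (S i) g" for i
    proof (rule lipschitz_onI)
      have \<sigma>0: "0 \<le> \<sigma> i" using K(3) by (rule lipschitz_on_nonneg)
      then show "0 \<le> (1 + e) * \<sigma> i" using e by simp
      fix s t assume st: "s \<in> S i" "t \<in> S i"
      have "w h s \<in> K i" "w h t \<in> K i" using st disjointed_subset[of K i] by (auto simp: S_def)
      then have "dist (g s) (g t) \<le> \<sigma> i * dist (w h s) (w h t)"
        unfolding g_def by (rule lipschitz_onD[OF K(3)])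
      also have "\<dots> \<le> \<sigma> i * ((1 + e) * dist s t)" using \<sigma>0 lip_w by (rule mult_left_mono[rotated])
      finally show "dist (g s) (g t) \<le> (1 + e) * \<sigma> i * dist s t" by (simp add: mult_ac)
    qed
    have "?I = (\<integral>\<^sup>+r. indicator {r1 + \<epsilon> <..< r2 - \<epsilon>} r * \<eta> r \<partial>lebesgue)"
      by (rule nn_integral_completion[symmetric])
    also have "\<dots> \<le> (\<integral>\<^sup>+r. indicator (g ` (\<Union>i. S i)) r * \<eta> r \<partial>lebesgue)"
    proof (rule nn_integral_mono_AE)
      have "AE r in lebesgue. P h r" using ae by (simp add: AE_completion_iff)
      then show "AE r in lebesgue. indicator {r1 + \<epsilon> <..< r2 - \<epsilon>} r * \<eta> r \<le> indicator (g ` (\<Union>i. S i)) r * \<eta> r"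
      proof eventually_elim
        fix r assume P: "P h r"
        show "indicator {r1 + \<epsilon> <..< r2 - \<epsilon>} r * \<eta> r \<le> indicator (g ` (\<Union>i. S i)) r * \<eta> r"
        proof (cases "r \<in> {r1 + \<epsilon> <..< r2 - \<epsilon>}")
          case True
          \<comment> \<open>The perturbation moves the end values of \<open>u\<close> by at most
            \<epsilon>; hence the range of levels shortened by \<epsilon> at both ends.\<close>
          have "g 0 \<le> r" "r \<le> g L"
            using wD(2)[OF h, of 0] wD(2)[OF h, of L] ends True by (auto simp: g_def abs_le_iff)
          then obtain t where t: "t \<in> {0..L}" "g t = r"
            using IVT'[of g 0 r L] L continuous_on_subset[OF cont_g] by auto
          have "(h, r) \<in> W"
            unfolding W_def by (rule image_eqI[of _ _ "(h, t)"]) (use t h in \<open>auto simp: \<Phi>_def g_def\<close>)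
          then have "(h, r) \<in> WG" using P True \<epsilon> by (auto simp: P_def)
          then obtain i s where s: "w h s \<in> K i" "s \<in> {0..L}" "r = g s"
            by (auto simp: WG_def \<Phi>_def g_def)
          then have "s \<in> {0..L} \<inter> w h -` G" by (auto simp: G_def)
          then have "r \<in> g ` (\<Union>i. S i)" unfolding US s(3) by (rule imageI)
          then show ?thesis using True by simp
        qed simp
      qed
    qed
    also have "\<dots> \<le> (\<integral>\<^sup>+t. (\<Sum>i. ennreal ((1 + e) * \<sigma> i) * indicator (S i) t) * \<eta> (g t) \<partial>lebesgue)"
      by (rule nn_integral_piecewise_lipschitz_real[OF Sm _ lip cont_g \<eta>, where a = 0 and b = L]) (auto simp: S_def)
    also have "\<dots> = (\<integral>\<^sup>+t. ennreal (1 + e) * (indicator {0..L} t * \<rho> (w h t)) \<partial>lebesgue)"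
    proof (rule nn_integral_cong)
      fix t
      have "ennreal ((1 + e) * \<sigma> i) * indicator (S i) t
        = (ennreal (1 + e) * indicator {0..L} t) * (ennreal (\<sigma> i) * indicator (disjointed K i) (w h t))" for i
        using e lipschitz_on_nonneg[OF K(3)[of i]] by (simp add: S_def indicator_def ennreal_mult)
      then have "(\<Sum>i. ennreal ((1 + e) * \<sigma> i) * indicator (S i) t)
        = (ennreal (1 + e) * indicator {0..L} t) * (\<Sum>i. ennreal (\<sigma> i) * indicator (disjointed K i) (w h t))"
        by (simp only: ennreal_suminf_cmult)
      then show "(\<Sum>i. ennreal ((1 + e) * \<sigma> i) * indicator (S i) t) * \<eta> (g t) = ennreal (1 + e) * (indicator {0..L} t * \<rho> (w h t))"
        by (simp only: \<rho>_def g_def mult.assoc)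
    qed
    also have "\<dots> = (\<integral>\<^sup>+t. ennreal (1 + e) * (indicator {0..L} t * \<rho> (w h t)) \<partial>lborel)"
      by (rule nn_integral_completion)
    also have "\<dots> = ennreal (1 + e) * ?J h"
    proof (rule nn_integral_cmult)
      have "(\<lambda>t. \<rho> (w h t)) \<in> borel_measurable borel"
        using measurable_compose[OF borel_measurable_continuous_onI[OF cont_w] \<rho>m] .
      then show "(\<lambda>t. indicator {0..L} t * \<rho> (w h t)) \<in> borel_measurable lborel" by simp
    qed
    finally show ?thesis .
  qed
  let ?U = "uniform_measure lborel (ball (0::'a) 1)"
  have U1: "emeasure ?U (space ?U) = 1" by (rule emeasure_uniform_unit_ball)
  interpret U: finite_measure ?U by (rule finite_measureI) (simp only: U1, simp)
  interpret UL: pair_sigma_finite ?U "lborel :: real measure" ..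
  have meas: "(\<lambda>(h, t). indicator {0..L} t * \<rho> (w h t)) \<in> borel_measurable (?U \<Otimes>\<^sub>M lborel)"
  proof -
    have "(\<lambda>p. \<rho> (w (fst p) (snd p))) \<in> borel_measurable (borel \<Otimes>\<^sub>M borel)"
      using measurable_compose[OF borel_measurable_continuous_onI[OF cont_w2] \<rho>m] by (simp add: borel_prod)
    then have "(\<lambda>p. indicator {0..L} (snd p) * \<rho> (w (fst p) (snd p))) \<in> borel_measurable (borel \<Otimes>\<^sub>M borel)"
      by measurable
    then show ?thesis
      by (simp add: case_prod_beta' cong: measurable_cong_sets sets_pair_measure_cong)
  qed
  have "?I = (\<integral>\<^sup>+h. ?I \<partial>?U)" by (simp only: nn_integral_const U1 mult_1_right)
  also have "\<dots> \<le> (\<integral>\<^sup>+h. ennreal (1 + e) * ?J h \<partial>?U)"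
  proof (rule nn_integral_mono_AE, rule AE_uniform_measureI)
    show "AE h in lborel. h \<in> ball 0 1 \<longrightarrow> ?I \<le> ennreal (1 + e) * ?J h"
      using AE_h by eventually_elim (use I_le in auto)
  qed simp
  also have "\<dots> = ennreal (1 + e) * (\<integral>\<^sup>+h. ?J h \<partial>?U)"
    using lborel.borel_measurable_nn_integral[OF meas] by (rule nn_integral_cmult)
  also have "(\<integral>\<^sup>+h. ?J h \<partial>?U) = (\<integral>\<^sup>+t. (\<integral>\<^sup>+h. indicator {0..L} t * \<rho> (w h t) \<partial>?U) \<partial>lborel)"
    using meas by (rule UL.Fubini'[symmetric])
  also have "\<dots> = (\<integral>\<^sup>+t. indicator {0..L} t * ball_average \<delta> \<rho> (c t) \<partial>lborel)"
  proof (rule nn_integral_cong)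
    fix t
    show "(\<integral>\<^sup>+h. indicator {0..L} t * \<rho> (w h t) \<partial>?U) = indicator {0..L} t * ball_average \<delta> \<rho> (c t)"
      by (cases "t \<in> {0..L}") (simp_all add: ball_average_def w_def)
  qed
  finally show ?thesis .
qed

section \<open>Decomposition into nearly linear pieces\<close>

text \<open>For each \<open>y\<close> the condition says that \<open>x\<close> lies in a union of
  two relatively closed sets, thanks to the strict \<open><\<close> in the premise. This makes the
  sets \<open>A k m\<close> and \<open>I m\<close> of the decomposition Borel.\<close>

lemma closedin_Ball_dist:
  fixes D :: "'a::metric_space set"
  assumes \<Phi>: "\<And>y. y \<in> D \<Longrightarrow> continuous_on D (\<lambda>x. \<Phi> x y :: real)"
  shows "closedin (top_of_set D) {x\<in>D. \<forall>y\<in>D. dist y x < r \<longrightarrow> \<Phi> x y \<le> 0}"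
proof (cases "D = {}")
  case False
  have "closedin (top_of_set D) (\<Inter>y\<in>D. (D \<inter> (\<lambda>x. dist y x) -` {r..}) \<union> (D \<inter> (\<lambda>x. \<Phi> x y) -` {..0}))"
    using False
    by (intro closedin_INT closedin_Un continuous_closedin_preimage \<Phi> continuous_intros) auto
  also have "(\<Inter>y\<in>D. (D \<inter> (\<lambda>x. dist y x) -` {r..}) \<union> (D \<inter> (\<lambda>x. \<Phi> x y) -` {..0}))
      = {x\<in>D. \<forall>y\<in>D. dist y x < r \<longrightarrow> \<Phi> x y \<le> 0}"
    using False by (auto simp flip: not_less)
  finally show ?thesis .
qed auto

lemma closedin_open_imp_sets_borel:
  assumes "open D" "closedin (top_of_set D) S"
  shows "S \<in> sets borel"
  using assms unfolding closedin_closed by auto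

text \<open>Together with \<open>locally_lipschitz_imp_onorm_le\<close> this places a countable
  union of Borel sets, defined by difference quotients, between the conditions onorm < s and onorm
  \<le> s. Points can thus be sorted by the norm of the derivative.\<close>

lemma onorm_less_imp_locally_lipschitz:
  fixes f :: "'a::real_normed_vector \<Rightarrow> 'b::real_normed_vector"
  assumes f: "(f has_derivative f') (at x)" and less: "onorm f' < s"
  shows "\<exists>m::nat. \<forall>y. dist y x < 1 / (real m + 1) \<longrightarrow> dist (f y) (f x) \<le> s * dist y x"
proof -
  have "0 < s - onorm f'" using less by simp
  then obtain d where d: "0 < d"
    "\<And>y. norm (y - x) < d \<Longrightarrow> norm (f y - f x - f' (y - x)) \<le> (s - onorm f') * norm (y - x)"
    using f unfolding has_derivative_at_alt by blast
  obtain m :: nat where m: "1 / (real m + 1) < d"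
    using reals_Archimedean[OF d(1)] by (auto simp: inverse_eq_divide add.commute)
  have "dist (f y) (f x) \<le> s * dist y x" if "dist y x < 1 / (real m + 1)" for y
  proof -
    have "norm (f y - f x) \<le> norm (f y - f x - f' (y - x)) + norm (f' (y - x))"
      using norm_triangle_ineq[of "f y - f x - f' (y - x)" "f' (y - x)"] by simp
    also have "\<dots> \<le> (s - onorm f') * norm (y - x) + onorm f' * norm (y - x)"
      using that m d(2)[of y] onorm[OF has_derivative_bounded_linear[OF f], of "y - x"]
      by (intro add_mono) (auto simp: dist_norm)
    finally show ?thesis by (simp add: dist_norm algebra_simps)
  qed
  then show ?thesis by blast
qed

lemma locally_lipschitz_imp_onorm_le:
  fixes f :: "'a::real_normed_vector \<Rightarrow> 'b::real_normed_vector"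
  assumes f: "(f has_derivative f') (at x)" and r: "0 < r" and s: "0 \<le> s"
    and lip: "\<And>y. dist y x < r \<Longrightarrow> dist (f y) (f x) \<le> s * dist y x"
  shows "onorm f' \<le> s"
proof (rule onorm_bound[OF s])
  fix h
  interpret f': bounded_linear f' using f by (rule has_derivative_bounded_linear)
  show "norm (f' h) \<le> s * norm h"
  proof (cases "h = 0")
    case False
    show ?thesis
    proof (rule field_le_epsilon)
      fix e :: real assume e: "0 < e"
      then have e': "0 < e / norm h" using False by simp
      then obtain d where d: "0 < d"
        "\<And>y. norm (y - x) < d \<Longrightarrow> norm (f y - f x - f' (y - x)) \<le> (e / norm h) * norm (y - x)"
        using f unfolding has_derivative_at_alt by blast
      define t where "t = min d r / (2 * norm h)"
      have t: "0 < t" "t * norm h < d" "t * norm h < r"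
        using d(1) r False by (auto simp: t_def min_def field_simps)
      define y where "y = x + t *\<^sub>R h"
      have y: "norm (y - x) = t * norm h" using t by (simp add: y_def)
      have "t * norm (f' h) = norm (f' (y - x))" using t by (simp add: y_def f'.scaleR)
      also have "\<dots> \<le> norm (f y - f x) + norm (f y - f x - f' (y - x))"
        using norm_triangle_ineq4[of "f y - f x" "f y - f x - f' (y - x)"] by simp
      also have "\<dots> \<le> s * (t * norm h) + (e / norm h) * (t * norm h)"
        using lip[of y] d(2)[of y] t by (intro add_mono) (simp_all add: dist_norm y)
      also have "\<dots> = t * (s * norm h + e)" using False by (simp add: algebra_simps)
      finally show "norm (f' h) \<le> s * norm h + e" using t by simp
    qed
  qed (simp add: f'.zero)
qed

text \<open>A single \<open>m\<close> governs scale and expansion constant. Expansion makes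
  \<open>f\<close> injective on sets of diameter below the scale.\<close>

lemma injective_derivative_imp_locally_expanding:
  fixes f :: "'a::euclidean_space \<Rightarrow> 'b::euclidean_space"
  assumes f: "(f has_derivative f') (at x)" and inj: "inj f'"
  shows "\<exists>m::nat. \<forall>y. dist y x < 1 / (real m + 1) \<longrightarrow> dist y x \<le> (real m + 1) * dist (f y) (f x)"
proof -
  have lin: "linear f'" using f by (rule has_derivative_linear)
  obtain B where B: "0 < B" "\<And>h. B * norm h \<le> norm (f' h)"
    using linear_inj_bounded_below_pos[OF lin inj] by blast
  then have "0 < B / 2" by simp
  then obtain d where d: "0 < d"
    "\<And>y. norm (y - x) < d \<Longrightarrow> norm (f y - f x - f' (y - x)) \<le> B / 2 * norm (y - x)"
    using f unfolding has_derivative_at_alt by blast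
  obtain m :: nat where m: "1 / (real m + 1) < min d (B / 2)"
    using reals_Archimedean[of "min d (B / 2)"] d(1) B(1) by (auto simp: inverse_eq_divide add.commute)
  have "dist y x \<le> (real m + 1) * dist (f y) (f x)" if "dist y x < 1 / (real m + 1)" for y
  proof -
    have "B * norm (y - x) \<le> norm (f' (y - x))" by (rule B(2))
    also have "\<dots> \<le> norm (f y - f x) + norm (f y - f x - f' (y - x))"
      using norm_triangle_ineq4[of "f y - f x" "f y - f x - f' (y - x)"] by simp
    also have "\<dots> \<le> norm (f y - f x) + B / 2 * norm (y - x)"
      using d(2)[of y] that m by (simp add: dist_norm)
    finally have "B / 2 * norm (y - x) \<le> norm (f y - f x)" by simp
    moreover have "1 / (real m + 1) * norm (y - x) \<le> B / 2 * norm (y - x)"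
      using m by (intro mult_right_mono) auto
    ultimately have "1 / (real m + 1) * norm (y - x) \<le> norm (f y - f x)" by linarith
    then show ?thesis by (simp add: dist_norm field_simps)
  qed
  then show ?thesis by blast
qed

lemma AE_imp_negligible:
  assumes "AE x in lebesgue. P x"
  shows "negligible {x. \<not> P x}"
proof -
  obtain N where "N \<in> null_sets lebesgue" "{x \<in> space lebesgue. \<not> P x} \<subseteq> N"
    using assms by (auto elim: AE_E2 simp: eventually_ae_filter)
  then show ?thesis
    by (auto simp: negligible_iff_null_sets intro: null_sets_completion_subset)
qed

lemma ex_powr_between:
  fixes q a :: real
  assumes "1 < q" "0 < a"
  shows "\<exists>k::int. q powr k \<le> a \<and> a < q powr (real_of_int k + 1)"
proof -
  have a: "a = q powr (log q a)" using assms by simp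
  have "q powr \<lfloor>log q a\<rfloor> \<le> q powr (log q a)" "q powr (log q a) < q powr (\<lfloor>log q a\<rfloor> + 1)"
    using assms by (auto intro!: powr_mono powr_less_mono simp del: powr_log_cancel)
  then show ?thesis using a by (metis of_int_1 of_int_add)
qed

text \<open>The constants \<open>\<sigma>\<close> and \<open>b\<close> replace \<open>\<parallel>f'\<parallel>\<close> and \<open>\<bar>J\<bar>\<close>; the factor \<open>C\<close> measures the loss. With constants in
  their place, the change of variables is only needed for the measures of images.\<close>

definition nearly_linear_on ::
  "real \<Rightarrow> real \<Rightarrow> (real^'n \<Rightarrow> real^'n) \<Rightarrow> (real^'n) set \<Rightarrow> real \<Rightarrow> real \<Rightarrow> bool" where
  "nearly_linear_on \<alpha> C f S \<sigma> b \<longleftrightarrow> \<sigma>-lipschitz_on S f \<and> 0 < b \<and>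
     (\<forall>E\<in>sets lebesgue. E \<subseteq> S \<longrightarrow>
        f ` E \<in> sets lebesgue \<and> ennreal b * emeasure lebesgue E \<le> emeasure lebesgue (f ` E)) \<and>
     (\<forall>x\<in>S. ennreal (\<sigma> powr \<alpha> / b) \<le> ennreal C * outer_dilatation \<alpha> f x)"

lemma nearly_linear_onD:
  assumes "nearly_linear_on \<alpha> C f S \<sigma> b"
  shows "\<sigma>-lipschitz_on S f" "0 < b"
    "E \<in> sets lebesgue \<Longrightarrow> E \<subseteq> S \<Longrightarrow> f ` E \<in> sets lebesgue"
    "E \<in> sets lebesgue \<Longrightarrow> E \<subseteq> S \<Longrightarrow> ennreal b * emeasure lebesgue E \<le> emeasure lebesgue (f ` E)"
    "x \<in> S \<Longrightarrow> ennreal (\<sigma> powr \<alpha> / b) \<le> ennreal C * outer_dilatation \<alpha> f x"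
  using assms unfolding nearly_linear_on_def by blast+

lemma nearly_linear_on_subset:
  assumes lin: "nearly_linear_on \<alpha> C f S \<sigma> b" and "S' \<subseteq> S"
  shows "nearly_linear_on \<alpha> C f S' \<sigma> b"
  unfolding nearly_linear_on_def using \<open>S' \<subseteq> S\<close>
  by (intro conjI ballI impI nearly_linear_onD(2-5)[OF lin] lipschitz_on_subset[OF nearly_linear_onD(1)[OF lin]]) blast+

text \<open>Noncritical points of differentiability are sorted by the powers of \<open>q\<close>
  near the norm and the Jacobian, by the scales of the Lipschitz and expansion estimates, and by a
  small ball. Compact sets exhaust each class up to a null set, whose image is null by the Luzin
  property, as is that of the points of non-differentiability; critical values are null by
  \<open>crit\<close>.\<close>

lemma linearization_pieces:
  fixes f :: "real^'n::finite \<Rightarrow> real^'n"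
  assumes D: "open D" and cont: "continuous_on D f"
    and diff: "AE x in lebesgue. x \<in> D \<longrightarrow> f differentiable (at x)"
    and luzin: "N_Luzin D f"
    and crit: "f ` {x\<in>D. f differentiable (at x) \<and> jacobian_det f x = 0} \<in> null_sets lebesgue"
    and q: "1 < q" and \<alpha>: "0 < \<alpha>"
  obtains K :: "nat \<Rightarrow> (real^'n) set" and \<sigma> b :: "nat \<Rightarrow> real"
  where "\<And>i. compact (K i)" "\<And>i. K i \<subseteq> D"
    "\<And>i. nearly_linear_on \<alpha> (q powr (2 * \<alpha> + 1)) f (K i) (\<sigma> i) (b i)"
    "negligible (f ` (D - (\<Union>i. K i)))"
proof -
  define D1 where "D1 = {x\<in>D. f differentiable (at x)}"
  define T where "T x = frechet_derivative f (at x)" for x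
  have der: "(f has_derivative T x) (at x)" if "x \<in> D1" for x
    using that by (simp add: D1_def T_def frechet_derivative_works)
  have jac: "jacobian_det f x = det (matrix (T x))" for x
    by (simp add: jacobian_det_def jacobian_def T_def)
  have nonD1: "negligible (D - D1)"
    using AE_imp_negligible[OF diff] by (rule negligible_subset) (auto simp: D1_def)
  have D1: "D1 \<in> sets lebesgue"
  proof -
    have "D1 = D - (D - D1)" by (auto simp: D1_def)
    moreover have "D - D1 \<in> sets lebesgue" using nonD1 by (simp add: negligible_imp_sets)
    ultimately show ?thesis using D by (metis borel_open sets.Diff sets_completionI_sets sets_lborel)
  qed
  define A where "A k m = {x\<in>D. \<forall>y\<in>D. dist y x < 1 / (real m + 1) \<longrightarrow> dist (f y) (f x) - q powr k * dist y x \<le> 0}"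
    for k :: int and m :: nat
  define I where "I m = {x\<in>D. \<forall>y\<in>D. dist y x < 1 / (real m + 1) \<longrightarrow> dist y x - (real m + 1) * dist (f y) (f x) \<le> 0}"
    for m :: nat
  have A: "A k m \<in> sets lebesgue" for k m
  proof -
    have "A k m \<in> sets borel"
      unfolding A_def
      by (intro closedin_open_imp_sets_borel[OF D] closedin_Ball_dist continuous_intros cont)
    then show ?thesis by simp
  qed
  have I: "I m \<in> sets lebesgue" for m
  proof -
    have "I m \<in> sets borel"
      unfolding I_def
      by (intro closedin_open_imp_sets_borel[OF D] closedin_Ball_dist continuous_intros cont)
    then show ?thesis by simp
  qed
  have A_if: "\<exists>m. x \<in> A k m" if x: "x \<in> D1" "onorm (T x) < q powr k" for x k
    using onorm_less_imp_locally_lipschitz[OF der[OF x(1)] x(2)] x(1) by (auto simp: A_def D1_def)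
  have A_onorm: "onorm (T x) \<le> q powr k" if x: "x \<in> D1" "x \<in> A k m" for x k m
  proof -
    obtain r where r: "0 < r" "ball x r \<subseteq> D" using D x(1) unfolding D1_def open_contains_ball by blast
    show ?thesis
      by (rule locally_lipschitz_imp_onorm_le[OF der[OF x(1)], of "min r (1 / (real m + 1))"])
        (use r x in \<open>auto simp: A_def dist_commute subset_iff\<close>)
  qed
  obtain Z :: "(real^'n) set" where Z: "countable Z" "\<And>X. open X \<Longrightarrow> X \<noteq> {} \<Longrightarrow> \<exists>z\<in>Z. z \<in> X"
    using countable_dense_setE by blast
  \<comment> \<open>Removing the sets with exponent \<open>k - 2\<close> bounds the norm below by
    \<open>q powr (k - 2)\<close>. The gap is 2 because membership in \<open>A\<close> gives only a
    non-strict bound: a point with norm exactly \<open>q powr (k - 1)\<close> may lie in some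
    \<open>A (k - 1) i\<close>. The ball radius is half the smaller scale, so two points of a class
    see each other at both scales.\<close>
  define P where "P = (\<lambda>(k::int, m::nat, m'::nat, l::int, j::nat).
    D1 \<inter> (A k m - (\<Union>i. A (k - 2) i)) \<inter> I m' \<inter> {x\<in>D1. det (matrix (T x)) \<in> {y. q powr l \<le> \<bar>y\<bar> \<and> \<bar>y\<bar> < q powr (real_of_int l + 1)}}
      \<inter> ball (from_nat_into Z j) (1 / (2 * (real (max m m') + 1))))"
  have P: "P p \<in> sets lebesgue" for p
  proof -
    have "{y. q powr l \<le> \<bar>y\<bar> \<and> \<bar>y\<bar> < q powr (real_of_int l + 1)} \<in> sets borel" for l :: int
      by measurable
    then have "{x\<in>D1. det (matrix (T x)) \<in> {y. q powr l \<le> \<bar>y\<bar> \<and> \<bar>y\<bar> < q powr (real_of_int l + 1)}} \<in> sets lebesgue" for l :: int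
      using der by (intro det_derivative_measurable[OF D1, where f = f]) (auto intro: has_derivative_at_withinI)
    note det = this
    obtain k m m' l j where p: "p = (k, m, m', l, j)" by (rule prod_cases5)
    have "ball (from_nat_into Z j) (1 / (2 * (real (max m m') + 1))) \<in> sets lebesgue" by simp
    moreover have "(\<Union>i. A (k - 2) i) \<in> sets lebesgue" using A by (intro sets.countable_UN) auto
    ultimately show ?thesis
      unfolding P_def p prod.case by (intro sets.Int sets.Diff D1 A I det)
  qed
  have P_cover: "\<exists>p. x \<in> P p" if x: "x \<in> D1" "jacobian_det f x \<noteq> 0" for x
  proof -
    have det: "det (matrix (T x)) \<noteq> 0" using x jac by simp
    have bl: "bounded_linear (T x)" using der[OF x(1)] by (rule has_derivative_bounded_linear)
    then have lin: "linear (T x)" by (rule bounded_linear.linear)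
    have inj: "inj (T x)" using det_nz_iff_inj[OF lin] det by simp
    have "T x \<noteq> (\<lambda>h. 0)" using inj injD[of "T x" "axis undefined 1" 0] by (auto simp: axis_eq_0_iff)
    then have pos: "0 < onorm (T x)" using onorm_pos_lt[OF bl] by (auto simp: fun_eq_iff)
    obtain k :: int where k: "q powr k \<le> onorm (T x)" "onorm (T x) < q powr (real_of_int k + 1)"
      using ex_powr_between[OF q pos] by auto
    obtain m where m: "x \<in> A (k + 1) m" using A_if[OF x(1), of "k + 1"] k by auto
    have not: "x \<notin> A (k + 1 - 2) i" for i
    proof
      assume "x \<in> A (k + 1 - 2) i"
      then have "q powr k \<le> q powr (k + 1 - 2)" using A_onorm[OF x(1)] k(1) by fastforce
      then show False using q by simp
    qed
    obtain m' where m': "x \<in> I m'"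
      using injective_derivative_imp_locally_expanding[OF der[OF x(1)] inj] x(1) by (auto simp: I_def D1_def)
    obtain l :: int where l: "q powr l \<le> \<bar>det (matrix (T x))\<bar>" "\<bar>det (matrix (T x))\<bar> < q powr (real_of_int l + 1)"
      using ex_powr_between[OF q, of "\<bar>det (matrix (T x))\<bar>"] det by auto
    obtain z where z: "z \<in> Z" "z \<in> ball x (1 / (2 * (real (max m m') + 1)))"
      using Z(2)[of "ball x (1 / (2 * (real (max m m') + 1)))"] by auto
    then obtain j where "from_nat_into Z j = z" using from_nat_into_surj[OF Z(1)] by blast
    then have "x \<in> P (k + 1, m, m', l, j)"
      using m not m' l z x(1) unfolding P_def by (simp add: dist_commute)
    then show ?thesis by blast
  qed
  have "\<exists>C N. negligible N \<and> (\<forall>n::nat. compact (C n)) \<and> P p = (\<Union>n. C n) \<union> N" for p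
    using lebesgue_regular_inner[OF P[of p]] by metis
  from choice[OF allI, OF this] obtain C where "\<forall>p. \<exists>N. negligible N \<and> (\<forall>n::nat. compact (C p n)) \<and> P p = (\<Union>n. C p n) \<union> N" ..
  from choice[OF this] obtain N where "\<forall>p. negligible (N p) \<and> (\<forall>n::nat. compact (C p n)) \<and> P p = (\<Union>n. C p n) \<union> N p" ..
  then have CN: "\<And>p. negligible (N p)" "\<And>p n. compact (C p n)" "\<And>p. P p = (\<Union>n. C p n) \<union> N p"
    by blast+
  define idx :: "nat \<Rightarrow> (int \<times> nat \<times> nat \<times> int \<times> nat) \<times> nat" where "idx = from_nat"
  define K where "K i = C (fst (idx i)) (snd (idx i))" for i
  have UK: "(\<Union>i. K i) = (\<Union>p. \<Union>n. C p n)"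
  proof
    have "C p n = K (to_nat (p, n))" for p n by (simp add: K_def idx_def)
    then show "(\<Union>p. \<Union>n. C p n) \<subseteq> (\<Union>i. K i)" by blast
  qed (auto simp: K_def)
  define \<sigma> where "\<sigma> i = q powr (fst (fst (idx i)))" for i
  define b where "b i = q powr (fst (snd (snd (snd (fst (idx i))))))" for i
  have KP: "K i \<subseteq> P (fst (idx i))" for i using CN(3) by (auto simp: K_def)
  have P_D1: "P p \<subseteq> D1" for p by (cases p) (auto simp: P_def)
  have D1D: "D1 \<subseteq> D" by (auto simp: D1_def)
  have K_D: "K i \<subseteq> D" for i using KP P_D1 D1D by blast
  have near: "\<exists>m m'. dist x y < 1 / (real m + 1) \<and> dist x y < 1 / (real m' + 1) \<and> x \<in> A (fst (fst (idx i))) m \<and> y \<in> A (fst (fst (idx i))) m \<and> y \<in> I m'"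
    if "x \<in> K i" "y \<in> K i" for x y i
  proof -
    obtain k m m' l j where p: "fst (idx i) = (k, m, m', l, j)" by (metis prod.collapse)
    have xy: "x \<in> P (k, m, m', l, j)" "y \<in> P (k, m, m', l, j)" using that KP[of i] p by auto
    let ?z = "from_nat_into Z j" and ?r = "1 / (2 * (real (max m m') + 1))"
    have "dist ?z x < ?r" "dist ?z y < ?r" using xy by (auto simp: P_def)
    then have "dist x y < ?r + ?r"
      using dist_triangle3[of x y ?z] by linarith
    also have "?r + ?r = 1 / (real (max m m') + 1)" by (simp add: field_simps)
    finally have "dist x y < 1 / (real (max m m') + 1)" .
    moreover have "1 / (real (max m m') + 1) \<le> 1 / (real m + 1)" "1 / (real (max m m') + 1) \<le> 1 / (real m' + 1)"
      by (auto intro!: divide_left_mono)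
    ultimately have "dist x y < 1 / (real m + 1)" "dist x y < 1 / (real m' + 1)" by linarith+
    then show ?thesis using xy p by (auto simp: P_def)
  qed
  have K_lip: "(\<sigma> i)-lipschitz_on (K i) f" for i
  proof (rule lipschitz_onI)
    fix x y assume xy: "x \<in> K i" "y \<in> K i"
    obtain m where "dist x y < 1 / (real m + 1)" "y \<in> A (fst (fst (idx i))) m" using near[OF xy] by blast
    moreover have "x \<in> D" using xy K_D by blast
    ultimately show "dist (f x) (f y) \<le> \<sigma> i * dist x y" by (auto simp: A_def \<sigma>_def)
  qed (simp add: \<sigma>_def)
  have K_inj: "inj_on f (K i)" for i
  proof (rule inj_onI)
    fix x y assume xy: "x \<in> K i" "y \<in> K i" "f x = f y"
    obtain m where "dist x y < 1 / (real m + 1)" "y \<in> I m" using near[OF xy(1,2)] by blast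
    moreover have "x \<in> D" using xy K_D by blast
    ultimately have "dist x y \<le> (real m + 1) * dist (f x) (f y)" by (auto simp: I_def)
    then show "x = y" using xy(3) by simp
  qed
  have K_b: "b i \<le> \<bar>det (matrix (T x))\<bar>" "\<bar>det (matrix (T x))\<bar> < q * b i"
    "x \<in> D1" "\<sigma> i \<le> q powr 2 * onorm (T x)" if "x \<in> K i" for x i
  proof -
    obtain k m m' l j where p: "fst (idx i) = (k, m, m', l, j)" by (metis prod.collapse)
    have x: "x \<in> P (k, m, m', l, j)" using that KP[of i] p by auto
    show D1: "x \<in> D1" using x P_D1 by blast
    show "b i \<le> \<bar>det (matrix (T x))\<bar>" "\<bar>det (matrix (T x))\<bar> < q * b i"
      using x q p by (auto simp: P_def b_def powr_add mult.commute)
    have "\<not> onorm (T x) < q powr (k - 2)"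
      using A_if[OF D1, of "k - 2"] x by (auto simp: P_def)
    then have "q powr 2 * q powr (k - 2) \<le> q powr 2 * onorm (T x)"
      using q by (intro mult_left_mono) auto
    also have "q powr 2 * q powr (k - 2) = q powr k" by (subst powr_add[symmetric]) simp
    finally show "\<sigma> i \<le> q powr 2 * onorm (T x)"
      using p by (simp add: \<sigma>_def)
  qed
  have K_E: "f ` E \<in> sets lebesgue" "ennreal (b i) * emeasure lebesgue E \<le> emeasure lebesgue (f ` E)"
    if E: "E \<in> sets lebesgue" "E \<subseteq> K i" for E i
  proof -
    have der': "(f has_derivative T x) (at x within E)" if "x \<in> E" for x
      using der K_b(3) that E(2) by (blast intro: has_derivative_at_withinI)
    then show "f ` E \<in> sets lebesgue"
      by (intro differentiable_image_in_sets_lebesgue[OF E(1)]) (auto simp: differentiable_on_def differentiable_def)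
    show "ennreal (b i) * emeasure lebesgue E \<le> emeasure lebesgue (f ` E)"
    proof (rule emeasure_injective_image_ge[OF E(1) der'])
      show "inj_on f E" using K_inj E(2) by (rule inj_on_subset)
      have "compact (f ` K i)"
        using CN(2) by (intro compact_continuous_image continuous_on_subset[OF cont K_D]) (simp add: K_def)
      then have "bounded (f ` K i)" by (rule compact_imp_bounded)
      then show "bounded (f ` E)" by (rule bounded_subset) (use E(2) in blast)
      show "b i \<le> \<bar>det (matrix (T x))\<bar>" if "x \<in> E" for x
        using that E(2) by (intro K_b) blast
      show "0 \<le> b i" unfolding b_def by (rule powr_ge_zero)
    qed
  qed
  \<comment> \<open>The norm is known up to \<open>q powr 2\<close>, raised to the power \<alpha>,
    and the Jacobian up to \<open>q\<close>: hence the exponent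
    \<open>2 * \<alpha> + 1\<close>.\<close>
  have K_O: "ennreal (\<sigma> i powr \<alpha> / b i) \<le> ennreal (q powr (2 * \<alpha> + 1)) * outer_dilatation \<alpha> f x" if x: "x \<in> K i" for i x
  proof -
    let ?J = "\<bar>det (matrix (T x))\<bar>"
    have b: "0 < b i" using q by (simp add: b_def)
    then have J: "0 < ?J" "?J < q * b i" using K_b[OF x] by auto
    have on: "0 \<le> onorm (T x)" using K_b(3)[OF x] der has_derivative_bounded_linear onorm_pos_le by blast
    have \<sigma>: "0 < \<sigma> i" using q by (simp add: \<sigma>_def)
    have "\<sigma> i powr \<alpha> / b i \<le> (q powr 2 * onorm (T x)) powr \<alpha> / (?J / q)"
      using K_b(4)[OF x] \<sigma> b J q \<alpha> on by (intro frac_le powr_mono2) (auto simp: field_simps)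
    also have "\<dots> = q powr (2 * \<alpha> + 1) * (onorm (T x) powr \<alpha> / ?J)"
    proof -
      have "(q powr 2 * onorm (T x)) powr \<alpha> = q powr (2 * \<alpha>) * onorm (T x) powr \<alpha>"
        by (subst powr_mult) (auto simp only: powr_powr on powr_ge_zero)
      then show ?thesis using q by (simp only:) (simp add: powr_add)
    qed
    finally have "ennreal (\<sigma> i powr \<alpha> / b i) \<le> ennreal (q powr (2 * \<alpha> + 1)) * ennreal (onorm (T x) powr \<alpha> / ?J)"
      using J by (simp add: ennreal_leI flip: ennreal_mult)
    also have "ennreal (onorm (T x) powr \<alpha> / ?J) = outer_dilatation \<alpha> f x"
      using K_b(3)[OF x] J by (simp add: outer_dilatation_def jac D1_def T_def[symmetric])
    finally show ?thesis .
  qed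
  have null_image: "negligible (f ` E)" if "negligible E" "E \<subseteq> D" for E
    using luzin that unfolding N_Luzin_def negligible_iff_null_sets by blast
  let ?U = "f ` (D - D1) \<union> f ` {x\<in>D. f differentiable (at x) \<and> jacobian_det f x = 0} \<union> f ` (\<Union>p. N p)"
  have "negligible ?U"
  proof (intro negligible_Un)
    show "negligible (f ` (D - D1))" by (rule null_image[OF nonD1]) auto
    show "negligible (f ` {x\<in>D. f differentiable (at x) \<and> jacobian_det f x = 0})"
      using crit by (simp add: negligible_iff_null_sets)
    have "negligible (\<Union>p. N p)" using CN(1) by (intro negligible_countable_Union) auto
    moreover have "(\<Union>p. N p) \<subseteq> D" using CN(3) P_D1 D1D by blast
    ultimately show "negligible (f ` (\<Union>p. N p))" by (rule null_image)
  qed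
  moreover have "f ` (D - (\<Union>i. K i)) \<subseteq> ?U"
  proof
    fix y assume "y \<in> f ` (D - (\<Union>i. K i))"
    then obtain x where x: "x \<in> D" "x \<notin> (\<Union>i. K i)" "y = f x" by blast
    show "y \<in> ?U"
    proof (cases "x \<in> D1 \<and> jacobian_det f x \<noteq> 0")
      case True
      then obtain p where "x \<in> P p" using P_cover by blast
      then have "x \<in> N p" using x(2) CN(3) unfolding UK by blast
      then show ?thesis using x(3) by blast
    next
      case False
      then show ?thesis using x by (auto simp: D1_def)
    qed
  qed
  ultimately have null: "negligible (f ` (D - (\<Union>i. K i)))" by (rule negligible_subset)
  have "nearly_linear_on \<alpha> (q powr (2 * \<alpha> + 1)) f (K i) (\<sigma> i) (b i)" for i
  proof -
    have "0 < b i" using q by (simp add: b_def)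
    then show ?thesis
      unfolding nearly_linear_on_def by (intro conjI ballI impI K_lip K_E K_O)
  qed
  then show thesis
    using CN(2) K_D null by (intro that[of K \<sigma> b]) (auto simp: K_def)
qed

section \<open>The dilatation inequality\<close>

lemma sum_le_infsum_ennreal:
  fixes g :: "'a \<Rightarrow> ennreal"
  assumes "finite F" "F \<subseteq> A"
  shows "sum g F \<le> infsum g A"
proof -
  have "sum g F = infsum g F" using assms(1) by simp
  also have "\<dots> \<le> infsum g A"
    using assms(2) by (intro infsum_mono_neutral nonneg_summable_on_complete) auto
  finally show ?thesis .
qed

text \<open>By disjointness, different indices with y in the image of \<open>P i\<close> have
  different preimages of y, so each partial sum is dominated by a finite part of the sum over the
  fibre.\<close>

lemma suminf_le_inverse_dilatation:
  fixes f :: "real^'n::finite \<Rightarrow> real^'n"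
  assumes disj: "disjoint_family P" and PD: "\<And>i. P i \<subseteq> D"
    and le: "\<And>i x. x \<in> P i \<Longrightarrow> a i \<le> C * outer_dilatation \<alpha> f x"
  shows "(\<Sum>i. a i * indicator (f ` P i) y) \<le> C * inverse_dilatation \<alpha> D f y"
proof (rule suminf_le_const)
  show "summable (\<lambda>i. a i * indicator (f ` P i) y)" by simp
  fix n
  define I where "I = {i. i < n \<and> y \<in> f ` P i}"
  have "\<forall>i\<in>I. \<exists>x. x \<in> P i \<and> f x = y" by (auto simp: I_def)
  then obtain x where x: "\<And>i. i \<in> I \<Longrightarrow> x i \<in> P i \<and> f (x i) = y" by metis
  have inj: "inj_on x I"
  proof (rule inj_onI)
    fix i j assume ij: "i \<in> I" "j \<in> I" "x i = x j"
    then have "x i \<in> P i \<inter> P j" using x[OF ij(1)] x[OF ij(2)] by simp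
    then show "i = j" using disj by (auto simp: disjoint_family_on_def)
  qed
  have fin: "finite I" by (simp add: I_def)
  have "(\<Sum>i<n. a i * indicator (f ` P i) y) = (\<Sum>i\<in>I. a i * indicator (f ` P i) y)"
    by (rule sum.mono_neutral_right) (auto simp: I_def)
  also have "\<dots> \<le> (\<Sum>i\<in>I. C * outer_dilatation \<alpha> f (x i))"
  proof (rule sum_mono)
    fix i assume i: "i \<in> I"
    then have "indicator (f ` P i) y = (1::ennreal)" by (simp add: I_def)
    then show "a i * indicator (f ` P i) y \<le> C * outer_dilatation \<alpha> f (x i)" using le[of "x i" i] x[OF i] by simp
  qed
  also have "\<dots> = C * (\<Sum>z\<in>x ` I. outer_dilatation \<alpha> f z)"
    by (simp add: sum_distrib_left sum.reindex[OF inj])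
  also have "\<dots> \<le> C * inverse_dilatation \<alpha> D f y"
    unfolding inverse_dilatation_def
    using fin x PD by (intro mult_left_mono sum_le_infsum_ennreal) (auto simp: subset_iff)
  finally show "(\<Sum>i<n. a i * indicator (f ` P i) y) \<le> C * inverse_dilatation \<alpha> D f y" .
qed

lemma borel_measurable_extend_0:
  fixes f :: "'a::euclidean_space \<Rightarrow> 'b::euclidean_space"
  assumes "open D" "continuous_on D f"
  shows "(\<lambda>x. if x \<in> D then f x else 0) \<in> borel_measurable borel"
  using assms by (intro borel_measurable_continuous_on_if) (auto intro: continuous_intros)

text \<open>Extending \<open>f\<close> by 0 off \<open>D\<close> gives a globally measurable map, to
  which the comparison by preimages applies; inside \<open>P\<close> it agrees with
  \<open>f\<close>.\<close>

lemma nn_integral_expanding_image_ge: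
  fixes f :: "'a::euclidean_space \<Rightarrow> 'a" and w :: "'a \<Rightarrow> ennreal"
  assumes D: "open D" "continuous_on D f" and P: "P \<in> sets lebesgue" "P \<subseteq> D" and w: "w \<in> borel_measurable borel"
    and img: "\<And>E. E \<in> sets lebesgue \<Longrightarrow> E \<subseteq> P \<Longrightarrow> f ` E \<in> sets lebesgue"
    and le: "\<And>E. E \<in> sets lebesgue \<Longrightarrow> E \<subseteq> P \<Longrightarrow> ennreal b * emeasure lebesgue E \<le> emeasure lebesgue (f ` E)"
  shows "(\<integral>\<^sup>+x. ennreal b * indicator P x * w (f x) \<partial>lebesgue) \<le> (\<integral>\<^sup>+y. indicator (f ` P) y * w y \<partial>lebesgue)"
proof -
  define T where "T x = (if x \<in> D then f x else 0)" for x
  have Tm: "T \<in> borel_measurable lebesgue"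
    unfolding T_def using borel_measurable_extend_0[OF D] by (intro measurable_completion) simp
  have fP: "f ` P \<in> sets lebesgue" using P(1) by (rule img) simp
  have "(\<integral>\<^sup>+x. ennreal b * indicator P x * w (T x) \<partial>lebesgue) \<le> (\<integral>\<^sup>+y. 1 * indicator (f ` P) y * w y \<partial>lebesgue)"
  proof (rule nn_integral_restrict_le_of_vimage_le[where T = T and T' = "\<lambda>y. y"])
    fix B :: "'a set" assume "B \<in> sets borel"
    then have "T -` B \<in> sets lebesgue" using measurable_sets[OF Tm] by simp
    then have "ennreal b * emeasure lebesgue (P \<inter> T -` B) \<le> emeasure lebesgue (f ` (P \<inter> T -` B))"
      using P by (intro le) auto
    also have "f ` (P \<inter> T -` B) = f ` P \<inter> (\<lambda>y. y) -` B"
      using P(2) by (force simp: T_def)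
    finally show "ennreal b * emeasure lebesgue (P \<inter> T -` B) \<le> 1 * emeasure lebesgue (f ` P \<inter> (\<lambda>y. y) -` B)" by simp
  qed (use Tm P fP w in \<open>auto intro: measurable_completion\<close>)
  moreover have "(\<integral>\<^sup>+x. ennreal b * indicator P x * w (f x) \<partial>lebesgue) = (\<integral>\<^sup>+x. ennreal b * indicator P x * w (T x) \<partial>lebesgue)"
    using P(2) by (intro nn_integral_cong) (auto simp: indicator_def T_def)
  ultimately show ?thesis by simp
qed

text \<open>On each piece \<sigma>^\<alpha> = (\<sigma>^\<alpha> / b) b. The factor b is spent on
  the passage to the image, the other is at most C times the dilatation, and adding over the pieces
  rebuilds the sum over preimages.\<close>

lemma nn_integral_pieces_le_inverse_dilatation:
  fixes f :: "real^'n::finite \<Rightarrow> real^'n"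
  assumes D: "open D" "continuous_on D f"
    and P: "\<And>i. P i \<in> sets lebesgue" "\<And>i. P i \<subseteq> D" "disjoint_family P"
    and w: "w \<in> borel_measurable borel" and lin: "\<And>i. nearly_linear_on \<alpha> C f (P i) (\<sigma> i) (b i)"
    and Q: "inverse_dilatation \<alpha> D f \<in> borel_measurable (lebesgue_on (f ` D))" "f ` D \<in> sets lebesgue"
  shows "(\<integral>\<^sup>+x. (\<Sum>i. ennreal (\<sigma> i powr \<alpha>) * indicator (P i) x) * w (f x) \<partial>lebesgue)
    \<le> ennreal C * (\<integral>\<^sup>+y. inverse_dilatation \<alpha> D f y * w y * indicator (f ` D) y \<partial>lebesgue)"
proof -
  define T where "T x = (if x \<in> D then f x else 0)" for x
  have Tm: "T \<in> borel_measurable lebesgue"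
    unfolding T_def using borel_measurable_extend_0[OF D] by (intro measurable_completion) simp
  have [measurable]: "(\<lambda>x. w (T x)) \<in> borel_measurable lebesgue" using measurable_compose[OF Tm w] .
  have [measurable]: "w \<in> borel_measurable lebesgue" using w by (simp add: measurable_completion)
  have [measurable]: "P i \<in> sets lebesgue" for i by (rule P(1))
  have fP[measurable]: "f ` P i \<in> sets lebesgue" for i by (rule nearly_linear_onD(3)[OF lin[of i] P(1)[of i]]) simp
  have "(\<integral>\<^sup>+x. (\<Sum>i. ennreal (\<sigma> i powr \<alpha>) * indicator (P i) x) * w (f x) \<partial>lebesgue)
    = (\<integral>\<^sup>+x. (\<Sum>i. ennreal (\<sigma> i powr \<alpha>) * indicator (P i) x * w (T x)) \<partial>lebesgue)"
  proof (rule nn_integral_cong)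
    fix x
    have "ennreal (\<sigma> i powr \<alpha>) * indicator (P i) x * w (T x) = ennreal (\<sigma> i powr \<alpha>) * indicator (P i) x * w (f x)" for i
      using P(2)[of i] by (auto simp: T_def indicator_def)
    then show "(\<Sum>i. ennreal (\<sigma> i powr \<alpha>) * indicator (P i) x) * w (f x) = (\<Sum>i. ennreal (\<sigma> i powr \<alpha>) * indicator (P i) x * w (T x))"
      by simp
  qed
  also have "\<dots> = (\<Sum>i. \<integral>\<^sup>+x. ennreal (\<sigma> i powr \<alpha>) * indicator (P i) x * w (T x) \<partial>lebesgue)"
    by (rule nn_integral_suminf) measurable
  also have "\<dots> \<le> (\<Sum>i. \<integral>\<^sup>+y. ennreal (\<sigma> i powr \<alpha> / b i) * indicator (f ` P i) y * w y \<partial>lebesgue)"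
  proof (intro suminf_le)
    fix i
    have eq: "ennreal (\<sigma> i powr \<alpha>) = ennreal (\<sigma> i powr \<alpha> / b i) * ennreal (b i)"
      using nearly_linear_onD(2)[OF lin, of i] by (simp flip: ennreal_mult)
    have "(\<integral>\<^sup>+x. ennreal (\<sigma> i powr \<alpha>) * indicator (P i) x * w (T x) \<partial>lebesgue)
      = (\<integral>\<^sup>+x. ennreal (\<sigma> i powr \<alpha> / b i) * (ennreal (b i) * indicator (P i) x * w (T x)) \<partial>lebesgue)"
      unfolding eq by (simp only: mult.assoc)
    also have "\<dots> = ennreal (\<sigma> i powr \<alpha> / b i) * (\<integral>\<^sup>+x. ennreal (b i) * indicator (P i) x * w (T x) \<partial>lebesgue)"
      by (rule nn_integral_cmult) measurable
    also have "(\<integral>\<^sup>+x. ennreal (b i) * indicator (P i) x * w (T x) \<partial>lebesgue) = (\<integral>\<^sup>+x. ennreal (b i) * indicator (P i) x * w (f x) \<partial>lebesgue)"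
      using P(2)[of i] by (intro nn_integral_cong) (auto simp: indicator_def T_def)
    also have "ennreal (\<sigma> i powr \<alpha> / b i) * \<dots> \<le> ennreal (\<sigma> i powr \<alpha> / b i) * (\<integral>\<^sup>+y. indicator (f ` P i) y * w y \<partial>lebesgue)"
      by (intro mult_left_mono nn_integral_expanding_image_ge[OF D P(1,2) w] nearly_linear_onD(3,4)[OF lin]) auto
    also have "\<dots> = (\<integral>\<^sup>+y. ennreal (\<sigma> i powr \<alpha> / b i) * (indicator (f ` P i) y * w y) \<partial>lebesgue)"
      by (rule nn_integral_cmult[symmetric]) measurable
    finally show "(\<integral>\<^sup>+x. ennreal (\<sigma> i powr \<alpha>) * indicator (P i) x * w (T x) \<partial>lebesgue)
      \<le> (\<integral>\<^sup>+y. ennreal (\<sigma> i powr \<alpha> / b i) * indicator (f ` P i) y * w y \<partial>lebesgue)"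
      by (simp only: mult.assoc)
  qed auto
  also have "\<dots> = (\<integral>\<^sup>+y. (\<Sum>i. ennreal (\<sigma> i powr \<alpha> / b i) * indicator (f ` P i) y * w y) \<partial>lebesgue)"
    by (rule nn_integral_suminf[symmetric]) measurable
  also have "\<dots> \<le> (\<integral>\<^sup>+y. ennreal C * (inverse_dilatation \<alpha> D f y * w y * indicator (f ` D) y) \<partial>lebesgue)"
  proof (rule nn_integral_mono)
    fix y
    show "(\<Sum>i. ennreal (\<sigma> i powr \<alpha> / b i) * indicator (f ` P i) y * w y) \<le> ennreal C * (inverse_dilatation \<alpha> D f y * w y * indicator (f ` D) y)"
    proof (cases "y \<in> f ` D")
      case True
      have "(\<Sum>i. ennreal (\<sigma> i powr \<alpha> / b i) * indicator (f ` P i) y) * w y \<le> (ennreal C * inverse_dilatation \<alpha> D f y) * w y"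
        by (intro mult_right_mono suminf_le_inverse_dilatation P nearly_linear_onD(5)[OF lin]) auto
      also have "\<dots> = ennreal C * (inverse_dilatation \<alpha> D f y * w y * indicator (f ` D) y)"
        using True by (simp add: mult.assoc)
      finally show ?thesis by simp
    next
      case False
      then have "y \<notin> f ` P i" for i using P(2)[of i] by blast
      then show ?thesis by simp
    qed
  qed
  also have "\<dots> = ennreal C * (\<integral>\<^sup>+y. inverse_dilatation \<alpha> D f y * w y * indicator (f ` D) y \<partial>lebesgue)"
  proof (rule nn_integral_cmult)
    have "(\<lambda>y. inverse_dilatation \<alpha> D f y * indicator (f ` D) y) \<in> borel_measurable lebesgue"
      using Q borel_measurable_restrict_space_iff_ennreal[of "f ` D" lebesgue "inverse_dilatation \<alpha> D f"] by simp
    then have "(\<lambda>y. inverse_dilatation \<alpha> D f y * indicator (f ` D) y * w y) \<in> borel_measurable lebesgue"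
      by measurable
    then show "(\<lambda>y. inverse_dilatation \<alpha> D f y * w y * indicator (f ` D) y) \<in> borel_measurable lebesgue"
      by (simp add: mult_ac)
  qed
  finally show ?thesis .
qed

section \<open>The modulus estimate\<close>

lemma AE_level_set_null:
  fixes f :: "'a::euclidean_space \<Rightarrow> 'a" and r0 :: ereal
  assumes dim: "DIM('a) = Suc k"
    and r0: "r0 = (SUP y\<in>f ` D. ereal (norm (y - y0)))"
    and Ninv: "\<And>\<epsilon>::real. 0 < \<epsilon> \<Longrightarrow> ereal \<epsilon> < r0 \<Longrightarrow>
      (AE r in lebesgue. \<epsilon> < r \<and> ereal r < r0 \<longrightarrow> N_inverse_on k D f (sphere y0 r))"
    and B: "B \<subseteq> D" "negligible (f ` B)"
  shows "AE r in lborel. 0 < r \<longrightarrow> hausdorff_measure k (B \<inter> {x. norm (f x - y0) = r}) = 0"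
proof -
  \<comment> \<open>Countably many lower bounds tending to 0 turn the hypothesis for each \<epsilon>
    into a statement about almost all positive radii.\<close>
  define s where "s j = 1 / (real j + 1)" for j :: nat
  have s: "0 < s j" for j by (simp add: s_def)
  have "AE r in lborel. \<forall>j. s j < r \<and> ereal r < r0 \<longrightarrow> N_inverse_on k D f (sphere y0 r)"
  proof (subst AE_all_countable, intro allI)
    fix j
    show "AE r in lborel. s j < r \<and> ereal r < r0 \<longrightarrow> N_inverse_on k D f (sphere y0 r)"
    proof (cases "ereal (s j) < r0")
      case True
      then show ?thesis using Ninv[OF s True] by (simp add: AE_completion_iff)
    next
      case False
      then have "\<not> (s j < r \<and> ereal r < r0)" for r
        by (meson ereal_less_eq(3) less_imp_le not_le order_le_less_trans)
      then show ?thesis by (intro AE_I2) blast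
    qed
  qed
  \<comment> \<open>The hypothesis covers radii below \<open>r0\<close> only, so the radius
    \<open>r0\<close> itself is discarded. An infinite \<open>r0\<close> is sent to 0, which
    discards one harmless radius.\<close>
  moreover have "AE r in lborel. r \<noteq> real_of_ereal r0"
    by (rule AE_lborel_singleton)
  moreover have "AE r in lborel. hausdorff_measure k (f ` B \<inter> sphere y0 r) = 0"
    using B(2) dim by (rule AE_hausdorff_null_sphere)
  ultimately show ?thesis
  proof eventually_elim
    fix r assume N: "\<forall>j. s j < r \<and> ereal r < r0 \<longrightarrow> N_inverse_on k D f (sphere y0 r)"
      and ne: "r \<noteq> real_of_ereal r0" and H: "hausdorff_measure k (f ` B \<inter> sphere y0 r) = 0"
    show "0 < r \<longrightarrow> hausdorff_measure k (B \<inter> {x. norm (f x - y0) = r}) = 0"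
    proof
      assume r: "0 < r"
      show "hausdorff_measure k (B \<inter> {x. norm (f x - y0) = r}) = 0"
      proof (cases "ereal r < r0")
        case True
        obtain j where "s j < r" using reals_Archimedean[OF r] by (auto simp: s_def inverse_eq_divide add.commute)
        then have "N_inverse_on k D f (sphere y0 r)" using N True by blast
        then have H0: "hausdorff_measure k (D \<inter> f -` (f ` B \<inter> sphere y0 r)) = 0"
        proof -
          have "f ` B \<inter> sphere y0 r \<subseteq> sphere y0 r \<inter> f ` D" using B(1) by auto
          from \<open>N_inverse_on k D f (sphere y0 r)\<close>[unfolded N_inverse_on_def, rule_format, OF this H]
          show ?thesis .
        qed
        have "B \<inter> {x. norm (f x - y0) = r} \<subseteq> D \<inter> f -` (f ` B \<inter> sphere y0 r)"
          using B(1) by (auto simp: dist_norm norm_minus_commute)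
        then have "hausdorff_measure k (B \<inter> {x. norm (f x - y0) = r}) \<le> hausdorff_measure k (D \<inter> f -` (f ` B \<inter> sphere y0 r))"
          by (rule hausdorff_measure_mono)
        then show ?thesis using H0 by simp
      next
        case False
        have "B \<inter> {x. norm (f x - y0) = r} = {}"
        proof (rule ccontr)
          assume "B \<inter> {x. norm (f x - y0) = r} \<noteq> {}"
          then obtain x where x: "x \<in> B" "norm (f x - y0) = r" by auto
          then have "ereal r \<le> r0"
            unfolding r0 using B(1) by (intro SUP_upper2[of "f x"]) auto
          then have "r0 = ereal r" using False by simp
          then show False using ne by simp
        qed
        moreover have "hausdorff_measure k ({} :: 'a set) = 0"
        proof (rule hausdorff_measure_0I)
          fix e :: real assume "0 < e"
          then have "hausdorff_content k e ({} :: 'a set) \<le> (\<Sum>i. if ({} :: 'a set) = {} then 0 else 0)"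
            using hausdorff_content_leI[of "{} :: 'a set" "\<lambda>_. {}" e k] by simp
          then show "hausdorff_content k e ({} :: 'a set) \<le> ennreal e" by simp
        qed
        ultimately show ?thesis by simp
      qed
    qed
  qed
qed

text \<open>The factors of the constant: \<open>((1 + e) / \<tau>) powr \<alpha>\<close> normalises
  the averaged test function along curves, \<open>((1 + e) / (1 - e)) ^ CARD('n)\<close> is the cost
  of averaging over balls, and \<open>C\<close> that of replacing derivatives by constants.\<close>

lemma path_modulus_lifted_paths_le:
  fixes f :: "real^'n::finite \<Rightarrow> real^'n" and \<eta> :: "real \<Rightarrow> ennreal"
    and K :: "nat \<Rightarrow> (real^'n) set" and \<sigma> b :: "nat \<Rightarrow> real"
  assumes dim: "CARD('n) = Suc k" "0 < k"
    and D: "open D" "continuous_on D f" and \<alpha>: "1 \<le> \<alpha>"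
    and K: "\<And>i. compact (K i)" "\<And>i. K i \<subseteq> D" "\<And>i. nearly_linear_on \<alpha> C f (K i) (\<sigma> i) (b i)"
    and bad: "AE r in lborel. 0 < r \<longrightarrow> hausdorff_measure k ((D - (\<Union>i. K i)) \<inter> {x. norm (f x - y0) = r}) = 0"
    and Q: "inverse_dilatation \<alpha> D f \<in> borel_measurable (lebesgue_on (f ` D))" "f ` D \<in> sets lebesgue"
    and r: "0 < r1" and C1: "C1 \<subseteq> closure (ball y0 r1)" and C2: "C2 \<subseteq> - ball y0 r2"
    and \<eta>: "\<eta> \<in> borel_measurable borel"
    and e: "0 < e" "e < 1" and \<tau>: "0 < \<tau>" "ennreal \<tau> \<le> (\<integral>\<^sup>+r. indicator {r1 + e <..< r2 - e} r * \<eta> r \<partial>lborel)"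
  shows "path_modulus \<alpha> (lifted_paths f D y0 r1 r2 C1 C2)
    \<le> ennreal (((1 + e) / \<tau>) powr \<alpha> * ((1 + e) / (1 - e)) ^ CARD('n)) * (ennreal C *
        (\<integral>\<^sup>+y. inverse_dilatation \<alpha> D f y * enn_powr (\<eta> (norm (y - y0))) \<alpha> * indicator (f ` D) y \<partial>lebesgue))"
proof -
  define u where "u x = (if x \<in> D then norm (f x - y0) else 0)" for x
  have cont: "continuous_on D (\<lambda>x. norm (f x - y0))"
    by (intro continuous_intros D(2))
  then have u_cont: "continuous_on D u"
    by (rule continuous_on_eq) (simp add: u_def)
  have u_meas: "u \<in> borel_measurable borel"
    unfolding u_def using D(1) cont by (rule borel_measurable_extend_0)
  obtain d where d: "1-lipschitz_on UNIV d" "\<And>x. x \<in> D \<Longrightarrow> 0 < d x" "\<And>x. x \<notin> D \<Longrightarrow> d x = 0"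
    "\<And>x y. dist x y < d x \<Longrightarrow> y \<in> D \<and> \<bar>u y - u x\<bar> \<le> e"
    using lipschitz_oscillation_radius[OF D(1) u_cont e(1)] by blast
  \<comment> \<open>Scaling by \<open>e < 1\<close> makes the Lipschitz constant \<open>e\<close>
    and keeps the closed ball of radius \<open>\<delta> x\<close> inside the open ball where the
    oscillation is controlled.\<close>
  define \<delta> where "\<delta> x = e * d x" for x
  have \<delta>_lip: "e-lipschitz_on UNIV \<delta>"
  proof (rule lipschitz_onI)
    fix x y
    show "dist (\<delta> x) (\<delta> y) \<le> e * dist x y"
      using lipschitz_onD[OF d(1), of x y] e by (simp add: \<delta>_def dist_real_def abs_mult flip: right_diff_distrib)
  qed (use e in simp)
  have \<delta>_pos: "0 < \<delta> x \<longleftrightarrow> x \<in> D" for x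
    using d(2,3)[of x] e by (cases "x \<in> D") (auto simp: \<delta>_def)
  have \<delta>_nonneg: "0 \<le> \<delta> x" for x
    using \<delta>_pos[of x] d(3)[of x] by (cases "x \<in> D") (auto simp: \<delta>_def)
  have \<delta>_osc: "x + \<delta> x *\<^sub>R h \<in> D \<and> \<bar>u (x + \<delta> x *\<^sub>R h) - u x\<bar> \<le> e" if "x \<in> D" "norm h \<le> 1" for x h
  proof (rule d(4))
    have "dist x (x + \<delta> x *\<^sub>R h) = \<delta> x * norm h" using \<delta>_nonneg[of x] by (simp add: dist_norm)
    also have "\<dots> \<le> \<delta> x" using that(2) \<delta>_nonneg[of x] by (simp add: mult_left_le)
    also have "\<dots> < d x" using e d(2)[OF that(1)] by (simp add: \<delta>_def)
    finally show "dist x (x + \<delta> x *\<^sub>R h) < d x" .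
  qed
  have \<delta>_meas: "\<delta> \<in> borel_measurable borel"
    using lipschitz_on_continuous_on[OF \<delta>_lip] by (rule borel_measurable_continuous_onI)
  let ?P = "disjointed K"
  have Ks[measurable]: "K i \<in> sets borel" for i using K(1) by (rule borel_compact)
  have P_borel[measurable]: "?P i \<in> sets borel" for i by (rule sets_disjointed) simp
  have PK: "?P i \<subseteq> K i" for i by (rule disjointed_subset)
  define \<rho> where "\<rho> = (\<lambda>x. (\<Sum>i. ennreal (\<sigma> i) * indicator (?P i) x) * \<eta> (u x))"
  have \<rho>_meas: "\<rho> \<in> borel_measurable borel"
    unfolding \<rho>_def using \<eta> u_meas by measurable
  \<comment> \<open>The pieces being disjoint, at most one summand is nonzero at \<open>x\<close>,
    so the power may be taken termwise.\<close>
  have \<rho>_powr: "enn_powr (\<rho> x) \<alpha> = (\<Sum>i. ennreal (\<sigma> i powr \<alpha>) * indicator (?P i) x) * enn_powr (\<eta> (norm (f x - y0))) \<alpha>" for x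
  proof (cases "\<exists>i. x \<in> ?P i")
    case True
    then obtain i where i: "x \<in> ?P i" by blast
    have single: "(\<Sum>j. ennreal (a j) * indicator (?P j) x) = ennreal (a i)" for a :: "nat \<Rightarrow> real"
    proof -
      have "ennreal (a j) * indicator (?P j) x = (if j = i then ennreal (a i) else 0)" for j
        using i disjoint_family_disjointed[of K] by (auto simp: disjoint_family_on_def indicator_def)
      then show ?thesis using sums_single[of i "\<lambda>_. ennreal (a i)"] by (simp add: sums_iff)
    qed
    have "x \<in> D" using i PK K(2) by blast
    then show ?thesis
      unfolding \<rho>_def single using enn_powr_mult[of \<alpha> "\<sigma> i"] \<alpha> lipschitz_on_nonneg[OF nearly_linear_onD(1)[OF K(3)[of i]]]
      by (simp add: u_def)
  qed (simp add: \<rho>_def)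
  define q where "q x = ennreal ((1 + e) / \<tau>) * (indicator {x. 0 < \<delta> x} x * ball_average \<delta> \<rho> x)" for x
  have q_meas: "q \<in> borel_measurable borel"
  proof -
    have [measurable]: "ball_average \<delta> \<rho> \<in> borel_measurable borel"
      using \<rho>_meas \<delta>_meas by (rule ball_average_measurable)
    have [measurable]: "{x. 0 < \<delta> x} \<in> sets borel" using \<delta>_meas by measurable
    show ?thesis unfolding q_def by measurable
  qed
  have adm: "admissible (lifted_paths f D y0 r1 r2 C1 C2) q"
    unfolding admissible_def
  proof (intro conjI ballI impI q_meas)
    fix p assume p: "p \<in> lifted_paths f D y0 r1 r2 C1 C2" and rect: "rectifiable p"
    obtain a b' \<gamma> where p_eq: "p = (a, b', \<gamma>)" by (rule prod_cases3)
    have path: "is_path (a, b', \<gamma>)" and im: "\<gamma> ` {a..b'} \<subseteq> D" and ends: "f (\<gamma> a) \<in> C1" "f (\<gamma> b') \<in> C2"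
      using p by (auto simp: p_eq lifted_paths_def joining_paths_def)
    define L where "L = enn2real (arc_length \<gamma> a b')"
    have L: "0 \<le> L" by (simp add: L_def)
    note nr = normal_rep_lipschitz[OF path rect[unfolded p_eq], folded L_def]
    \<comment> \<open>The normal representation is frozen outside \<open>[0, L]\<close>, which keeps
      the Lipschitz constant 1 and defines the curve on the whole line.\<close>
    define c where "c t = normal_rep (a, b', \<gamma>) (max 0 (min L t))" for t
    have clamp: "max 0 (min L t) \<in> {0..L}" for t using L by auto
    have c_lip: "1-lipschitz_on UNIV c"
    proof (rule lipschitz_onI)
      fix s t
      have "dist (c s) (c t) \<le> 1 * dist (max 0 (min L s)) (max 0 (min L t))"
        unfolding c_def by (rule lipschitz_onD[OF nr(1) clamp clamp])
      also have "\<dots> \<le> 1 * dist s t" by (auto simp: dist_real_def max_def min_def)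
      finally show "dist (c s) (c t) \<le> 1 * dist s t" .
    qed simp
    have cD: "c t \<in> D" for t
      using nr(4) clamp[of t] im unfolding c_def by blast
    have ab: "\<gamma> a \<in> D" "\<gamma> b' \<in> D" using im path by (auto simp: is_path_def)
    have c0: "c 0 = \<gamma> a" "c L = \<gamma> b'" using nr(2,3) L by (auto simp: c_def)
    have u_ends: "u (c 0) \<le> r1" "r2 \<le> u (c L)"
    proof -
      have "f (\<gamma> a) \<in> cball y0 r1" using ends(1) C1 r by (auto simp: closure_ball)
      then show "u (c 0) \<le> r1" using ab by (simp add: c0 u_def dist_norm norm_minus_commute)
      have "f (\<gamma> b') \<notin> ball y0 r2" using ends(2) C2 by blast
      then show "r2 \<le> u (c L)" using ab by (simp add: c0 u_def dist_norm norm_minus_commute)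
    qed
    let ?A = "\<integral>\<^sup>+t. indicator {0..L} t * ball_average \<delta> \<rho> (c t) \<partial>lborel"
    have "(\<integral>\<^sup>+r. indicator {r1 + e <..< r2 - e} r * \<eta> r \<partial>lborel)
      \<le> ennreal (1 + e) * ?A"
    proof (rule crossing_bound[OF _ _ u_cont u_meas \<delta>_lip _ \<delta>_osc c_lip cD L u_ends K(1,2) _ _ \<eta> \<rho>_def e(1)])
      show "DIM(real^'n) = Suc k" "0 < k" using dim by auto
      show "0 < \<delta> x" if "x \<in> D" for x using that by (simp add: \<delta>_pos)
      show "(\<sigma> i)-lipschitz_on (K i) u" for i
      proof (rule lipschitz_onI)
        fix x y assume xy: "x \<in> K i" "y \<in> K i"
        then have "x \<in> D" "y \<in> D" using K(2) by auto
        then have "dist (u x) (u y) \<le> dist (f x) (f y)"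
          using norm_triangle_ineq3[of "f x - y0" "f y - y0"] by (simp add: u_def dist_real_def dist_norm)
        also have "\<dots> \<le> \<sigma> i * dist x y" using lipschitz_onD[OF nearly_linear_onD(1)[OF K(3)] xy] .
        finally show "dist (u x) (u y) \<le> \<sigma> i * dist x y" .
      qed (rule lipschitz_on_nonneg[OF nearly_linear_onD(1)[OF K(3)]])
      show "AE r in lborel. r1 < r \<and> r < r2 \<longrightarrow> hausdorff_measure k ((D - (\<Union>i. K i)) \<inter> {x. u x = r}) = 0"
        using bad
      proof eventually_elim
        fix s assume s: "0 < s \<longrightarrow> hausdorff_measure k ((D - (\<Union>i. K i)) \<inter> {x. norm (f x - y0) = s}) = 0"
        have "(D - (\<Union>i. K i)) \<inter> {x. u x = s} = (D - (\<Union>i. K i)) \<inter> {x. norm (f x - y0) = s}"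
          by (auto simp: u_def)
        then show "r1 < s \<and> s < r2 \<longrightarrow> hausdorff_measure k ((D - (\<Union>i. K i)) \<inter> {x. u x = s}) = 0"
          using s r by simp
      qed
    qed
    then have le: "ennreal \<tau> \<le> ennreal (1 + e) * ?A"
      using \<tau>(2) by (rule order_trans[rotated])
    have c_meas: "c \<in> borel_measurable borel"
      using lipschitz_on_continuous_on[OF c_lip] by (rule borel_measurable_continuous_onI)
    have "1 = ennreal (1 / \<tau>) * ennreal \<tau>" using \<tau>(1) by (simp flip: ennreal_mult)
    also have "\<dots> \<le> ennreal (1 / \<tau>) * (ennreal (1 + e) * ?A)"
      using le by (rule mult_left_mono) simp
    also have "\<dots> = ennreal ((1 + e) / \<tau>) * ?A"
    proof -
      have "ennreal ((1 + e) / \<tau>) = ennreal (1 / \<tau>) * ennreal (1 + e)"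
        using \<tau>(1) e by (subst ennreal_mult[symmetric]) auto
      then show ?thesis by (simp only: mult.assoc)
    qed
    also have "\<dots> = (\<integral>\<^sup>+t. ennreal ((1 + e) / \<tau>) * (indicator {0..L} t * ball_average \<delta> \<rho> (c t)) \<partial>lborel)"
    proof (rule nn_integral_cmult[symmetric])
      have "(\<lambda>t. ball_average \<delta> \<rho> (c t)) \<in> borel_measurable borel"
        using measurable_compose[OF c_meas ball_average_measurable[OF \<rho>_meas \<delta>_meas]] .
      then show "(\<lambda>t. indicator {0..L} t * ball_average \<delta> \<rho> (c t)) \<in> borel_measurable lborel" by simp
    qed
    also have "\<dots> = (\<integral>\<^sup>+t. q (normal_rep p t) * indicator {0..L} t \<partial>lborel)"
    proof (rule nn_integral_cong)
      fix t
      show "ennreal ((1 + e) / \<tau>) * (indicator {0..L} t * ball_average \<delta> \<rho> (c t)) = q (normal_rep p t) * indicator {0..L} t"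
      proof (cases "t \<in> {0..L}")
        case True
        then have "c t = normal_rep p t" by (simp add: c_def p_eq)
        then show ?thesis using True cD[of t] \<delta>_pos by (simp add: q_def)
      qed simp
    qed
    also have "\<dots> = line_integral p q" by (simp add: line_integral_def p_eq L_def)
    finally show "1 \<le> line_integral p q" .
  qed
  let ?w = "\<lambda>y. enn_powr (\<eta> (norm (y - y0))) \<alpha>"
  let ?I = "\<integral>\<^sup>+y. inverse_dilatation \<alpha> D f y * ?w y * indicator (f ` D) y \<partial>lebesgue"
  have w_meas: "?w \<in> borel_measurable borel"
    using \<eta> by measurable
  let ?B = "ball_average \<delta> (\<lambda>z. enn_powr (\<rho> z) \<alpha>)" and ?Dx = "indicator {x. 0 < \<delta> x}" and ?c = "ennreal (((1 + e) / \<tau>) powr \<alpha>)"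
  have "path_modulus \<alpha> (lifted_paths f D y0 r1 r2 C1 C2) \<le> (\<integral>\<^sup>+x. enn_powr (q x) \<alpha> \<partial>lborel)"
    unfolding path_modulus_def using adm by (intro INF_lower) simp
  also have "\<dots> \<le> (\<integral>\<^sup>+x. ?c * (?Dx x * ?B x) \<partial>lborel)"
  proof (rule nn_integral_mono)
    fix x
    have "enn_powr (q x) \<alpha> = ?c * enn_powr (?Dx x * ball_average \<delta> \<rho> x) \<alpha>"
      unfolding q_def using \<alpha> e \<tau> by (intro enn_powr_mult) auto
    also have "\<dots> \<le> ?c * (?Dx x * ?B x)"
      using enn_powr_ball_average_le[OF \<rho>_meas \<alpha>, of \<delta> x] by (intro mult_left_mono) (auto simp: indicator_def)
    finally show "enn_powr (q x) \<alpha> \<le> ?c * (?Dx x * ?B x)" .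
  qed
  also have "\<dots> = ?c * (\<integral>\<^sup>+x. ?Dx x * ?B x \<partial>lborel)"
  proof (rule nn_integral_cmult)
    have [measurable]: "?B \<in> borel_measurable borel"
      using enn_powr_measurable[OF \<rho>_meas] \<delta>_meas by (rule ball_average_measurable)
    have [measurable]: "{x. 0 < \<delta> x} \<in> sets borel" using \<delta>_meas by measurable
    show "(\<lambda>x. ?Dx x * ?B x) \<in> borel_measurable lborel"
      by measurable
  qed
  also have "\<dots> \<le> ?c * (ennreal (((1 + e) / (1 - e)) ^ DIM(real^'n)) * (\<integral>\<^sup>+z. enn_powr (\<rho> z) \<alpha> \<partial>lborel))"
    using nn_integral_ball_average_le[OF enn_powr_measurable[OF \<rho>_meas] \<delta>_lip \<delta>_nonneg e(2)]
    by (rule mult_left_mono) simp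
  also have "(\<integral>\<^sup>+z. enn_powr (\<rho> z) \<alpha> \<partial>lborel) = (\<integral>\<^sup>+x. (\<Sum>i. ennreal (\<sigma> i powr \<alpha>) * indicator (?P i) x) * ?w (f x) \<partial>lebesgue)"
    by (simp add: \<rho>_powr nn_integral_completion)
  also have "?c * (ennreal (((1 + e) / (1 - e)) ^ DIM(real^'n)) * \<dots>)
    \<le> ?c * (ennreal (((1 + e) / (1 - e)) ^ DIM(real^'n)) * (ennreal C * ?I))"
    using PK K(2) by (intro mult_left_mono nn_integral_pieces_le_inverse_dilatation[OF D _ _ disjoint_family_disjointed w_meas _ Q])
      (auto intro: nearly_linear_on_subset[OF K(3)])
  also have "\<dots> = ennreal (((1 + e) / \<tau>) powr \<alpha> * ((1 + e) / (1 - e)) ^ CARD('n)) * (ennreal C * ?I)"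
    using e by (simp add: ennreal_mult mult.assoc)
  finally show ?thesis .
qed

section \<open>The inverse Poletsky inequality\<close>

text \<open>Admissible test functions are Borel while \<eta> is only Lebesgue measurable. Setting a
  Borel representative to 0 on a Borel null set makes it a minorant at every point, so that it can
  be composed with |y - y0| and compared pointwise.\<close>

lemma borel_minorant:
  fixes \<eta> :: "real \<Rightarrow> ennreal"
  assumes \<eta>: "\<eta> \<in> borel_measurable (lebesgue_on {r1<..<r2})"
  obtains \<eta>' where "\<eta>' \<in> borel_measurable borel" "\<And>r. \<eta>' r \<le> \<eta> r * indicator {r1<..<r2} r"
    "(\<integral>\<^sup>+r. \<eta>' r \<partial>lborel) = (\<integral>\<^sup>+r. \<eta> r * indicator {r1<..<r2} r \<partial>lebesgue)"
proof -
  have "(\<lambda>r. \<eta> r * indicator {r1<..<r2} r) \<in> borel_measurable lebesgue"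
    using \<eta> borel_measurable_restrict_space_iff_ennreal[of "{r1<..<r2}" lebesgue \<eta>] by simp
  then obtain g where g: "g \<in> borel_measurable lborel" "AE r in lborel. \<eta> r * indicator {r1<..<r2} r = g r"
    using completion_ex_borel_measurable by blast
  obtain N where N: "{r \<in> space lborel. \<not> \<eta> r * indicator {r1<..<r2} r = g r} \<subseteq> N" "N \<in> null_sets lborel"
    using g(2) by (auto elim: AE_E simp: null_sets_def)
  define \<eta>' where "\<eta>' r = (if r \<in> N then 0 else g r)" for r
  have Ns: "N \<in> sets borel" using N(2) by auto
  show thesis
  proof (rule that)
    show "\<eta>' \<in> borel_measurable borel"
      unfolding \<eta>'_def using g(1) Ns by (intro measurable_If_set) auto
    show "\<eta>' r \<le> \<eta> r * indicator {r1<..<r2} r" for r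
    proof (cases "r \<in> N")
      case False
      then have "\<eta> r * indicator {r1<..<r2} r = g r" using N(1) by auto
      then show ?thesis by (simp add: \<eta>'_def)
    qed (simp add: \<eta>'_def)
    have "AE r in lborel. r \<notin> N" using N(2) by (rule AE_not_in)
    then have "AE r in lborel. \<eta>' r = \<eta> r * indicator {r1<..<r2} r"
      using g(2) by eventually_elim (simp add: \<eta>'_def)
    then show "(\<integral>\<^sup>+r. \<eta>' r \<partial>lborel) = (\<integral>\<^sup>+r. \<eta> r * indicator {r1<..<r2} r \<partial>lebesgue)"
      by (simp add: nn_integral_completion cong: nn_integral_cong_AE)
  qed
qed

text \<open>Every value of \<open>f\<close> has a preimage; this yields the passage from Q to the
  majorant N^\<alpha> Q.\<close>

lemma one_le_enn_powr_multiplicity: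
  assumes "D \<noteq> {}" "0 < \<alpha>"
  shows "1 \<le> enn_powr (multiplicity_on D f) \<alpha>"
proof -
  obtain x where x: "x \<in> D" using assms(1) by blast
  have "1 = emeasure (count_space UNIV) {x}" by simp
  also have "\<dots> \<le> emeasure (count_space UNIV) {z\<in>D. f z = f x}"
    using x by (intro emeasure_mono) auto
  also have "\<dots> \<le> multiplicity_on D f"
    unfolding multiplicity_on_def by (rule SUP_upper) simp
  finally have "enn_powr 1 \<alpha> \<le> enn_powr (multiplicity_on D f) \<alpha>"
    using assms(2) by (intro enn_powr_mono) auto
  then show ?thesis by (simp add: enn_powr_def)
qed

text \<open>The product with an infinite \<open>R\<close> jumps at 0, hence the alternative.\<close>

lemma ennreal_le_of_tendsto:
  fixes M R :: ennreal
  assumes le: "\<And>j::nat. j0 \<le> j \<Longrightarrow> M \<le> ennreal (C j) * R" and C: "C \<longlonglongrightarrow> c"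
  shows "M \<le> ennreal c * R \<or> R = top"
proof (cases "R = top")
  case False
  have "(\<lambda>j. ennreal (C j) * R) \<longlonglongrightarrow> ennreal c * R"
    using False C by (intro tendsto_mult_ennreal tendsto_ennrealI tendsto_const) (auto simp: less_top)
  then show ?thesis
    using le by (intro disjI1 LIMSEQ_le_const) auto
qed simp

theorem theorem1p1:
  fixes f :: "real^'n \<Rightarrow> real^'n" and D :: "(real^'n) set" and y0 :: "real^'n"
    and \<alpha> :: real and r0 :: ereal
  assumes dim: "CARD('n) \<ge> 2"
    and D: "open D" "connected D" "D \<noteq> {}" "compact (closure D)"
    and \<alpha>: "real CARD('n) - 1 < \<alpha>" "\<alpha> \<le> real CARD('n)"
    and cont: "continuous_on D f"
    and opn: "open_map (top_of_set D) euclidean f"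
    and discr: "discrete_map_on D f"
    and clsd: "closed_map (top_of_set D) (top_of_set (f ` D)) f"
    and diff: "AE x in lebesgue. x \<in> D \<longrightarrow> f differentiable (at x)"
    and luzin: "N_Luzin D f"
    and y0: "y0 \<in> closure (f ` D)"
    and r0: "r0 = (SUP y\<in>f ` D. ereal (norm (y - y0)))" "r0 > 0"
    and crit: "f ` {x\<in>D. f differentiable (at x) \<and> jacobian_det f x = 0} \<in> null_sets lebesgue"
    and Ninv: "\<And>\<epsilon>::real. 0 < \<epsilon> \<Longrightarrow> ereal \<epsilon> < r0 \<Longrightarrow>
      (AE r in lebesgue. \<epsilon> < r \<and> ereal r < r0 \<longrightarrow> N_inverse_on (CARD('n) - 1) D f (sphere y0 r))"
    and Q_meas: "inverse_dilatation \<alpha> D f \<in> borel_measurable (lebesgue_on (f ` D))"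
    and Q_int: "(\<integral>\<^sup>+y\<in>f ` D. inverse_dilatation \<alpha> D f y \<partial>lebesgue) < top"
  shows "inverse_Poletsky_at \<alpha> D f
    (\<lambda>y. enn_powr (multiplicity_on D f) \<alpha> * inverse_dilatation \<alpha> D f y) y0"
proof -
  let ?N = "enn_powr (multiplicity_on D f) \<alpha>" and ?Q = "inverse_dilatation \<alpha> D f"
  define k where "k = CARD('n) - 1"
  have k: "CARD('n) = Suc k" "0 < k" using dim by (auto simp: k_def)
  have a1: "1 \<le> \<alpha>" using \<alpha>(1) dim by linarith
  have fD: "f ` D \<in> sets lebesgue"
  proof -
    have "open (f ` D)" using opn D(1) by (simp add: open_map_def openin_open_eq)
    then show ?thesis by simp
  qed
  have main: "path_modulus \<alpha> (lifted_paths f D y0 r1 r2 C1 C2)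
      \<le> (\<integral>\<^sup>+y\<in>annulus y0 r1 r2 \<inter> f ` D. (?N * ?Q y) * enn_powr (\<eta> (norm (y - y0))) \<alpha> \<partial>lebesgue)"
    if r: "0 < r1" "r1 < r2" and C1: "C1 \<subseteq> closure (ball y0 r1) \<inter> f ` D" and C2: "C2 \<subseteq> f ` D - ball y0 r2"
      and \<eta>: "\<eta> \<in> borel_measurable (lebesgue_on {r1<..<r2})" "1 \<le> (\<integral>\<^sup>+r\<in>{r1<..<r2}. \<eta> r \<partial>lebesgue)"
    for r1 r2 C1 C2 \<eta>
  proof -
    let ?M = "path_modulus \<alpha> (lifted_paths f D y0 r1 r2 C1 C2)"
    obtain \<eta>' where \<eta>': "\<eta>' \<in> borel_measurable borel" "\<And>r. \<eta>' r \<le> \<eta> r * indicator {r1<..<r2} r"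
      "(\<integral>\<^sup>+r. \<eta>' r \<partial>lborel) = (\<integral>\<^sup>+r. \<eta> r * indicator {r1<..<r2} r \<partial>lebesgue)"
      using borel_minorant[OF \<eta>(1)] by blast
    have \<eta>'_int: "1 \<le> (\<integral>\<^sup>+r. \<eta>' r \<partial>lborel)" using \<eta>(2) \<eta>'(3) by simp
    have \<eta>'_0: "\<eta>' r = 0" if "r \<notin> {r1<..<r2}" for r using \<eta>'(2)[of r] that by simp
    define R where "R = (\<integral>\<^sup>+y. ?Q y * enn_powr (\<eta>' (norm (y - y0))) \<alpha> * indicator (f ` D) y \<partial>lebesgue)"
    \<comment> \<open>\<open>s j\<close> is used as oscillation bound, as Lipschitz constant of the
      gauge and as q - 1; the summand 2 keeps it below 1.\<close>
    define s where "s j = 1 / (real j + 2)" for j :: nat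
    have s: "0 < s j" "s j < 1" for j by (auto simp: s_def)
    have s_lim: "s \<longlonglongrightarrow> 0"
    proof -
      have "(\<lambda>j. inverse (real (Suc (j + 1)))) \<longlonglongrightarrow> 0"
        using LIMSEQ_inverse_real_of_nat by (rule LIMSEQ_ignore_initial_segment)
      then show ?thesis by (simp add: s_def[abs_def] inverse_eq_divide add.commute)
    qed
    have s_anti: "s j \<le> s i" if "i \<le> j" for i j using that by (auto simp: s_def intro!: divide_left_mono)
    define I where "I j = (\<integral>\<^sup>+r. indicator {r1 + s j <..< r2 - s j} r * \<eta>' r \<partial>lborel)" for j
    have mono: "indicator {r1 + s i <..< r2 - s i} r * \<eta>' r \<le> indicator {r1 + s j <..< r2 - s j} r * \<eta>' r"
      if "i \<le> j" for i j r
      using s_anti[OF that] by (intro mult_right_mono) (auto simp: indicator_def)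
    have I_mono: "I i \<le> I j" if "i \<le> j" for i j
      unfolding I_def by (intro nn_integral_mono mono that)
    have I_SUP: "(SUP j. I j) = (\<integral>\<^sup>+r. \<eta>' r \<partial>lborel)"
    proof -
      have "(SUP j. I j) = (\<integral>\<^sup>+r. (SUP j. indicator {r1 + s j <..< r2 - s j} r * \<eta>' r) \<partial>lborel)"
        unfolding I_def
      proof (rule nn_integral_monotone_convergence_SUP[symmetric])
        show "incseq (\<lambda>j r. indicator {r1 + s j <..< r2 - s j} r * \<eta>' r)"
          unfolding incseq_def le_fun_def using mono by blast
      qed (use \<eta>'(1) in simp)
      also have "\<dots> = (\<integral>\<^sup>+r. \<eta>' r \<partial>lborel)"
      proof (rule nn_integral_cong)
        fix r
        show "(SUP j. indicator {r1 + s j <..< r2 - s j} r * \<eta>' r) = \<eta>' r"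
        proof (cases "r \<in> {r1<..<r2}")
          case True
          then have "0 < min (r - r1) (r2 - r)" by simp
          then have "eventually (\<lambda>j. s j < min (r - r1) (r2 - r)) sequentially"
            using s_lim by (intro order_tendstoD(2))
          then obtain j where j: "s j < min (r - r1) (r2 - r)" by (auto dest: eventually_happens)
          show ?thesis
          proof (rule antisym)
            show "(SUP j. indicator {r1 + s j <..< r2 - s j} r * \<eta>' r) \<le> \<eta>' r"
              by (rule SUP_least) (auto simp: indicator_def)
            show "\<eta>' r \<le> (SUP j. indicator {r1 + s j <..< r2 - s j} r * \<eta>' r)"
              using j by (intro SUP_upper2[of j]) (auto simp: indicator_def)
          qed
        qed (simp add: \<eta>'_0)
      qed
      finally show ?thesis .
    qed
    have bound: "?M \<le> ennreal (((1 + s j) / \<tau>) powr \<alpha> * ((1 + s j) / (1 - s j)) ^ CARD('n) * (1 + s j) powr (2 * \<alpha> + 1)) * R"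
      if \<tau>: "0 < \<tau>" "ennreal \<tau> \<le> I j" for \<tau> j
    proof -
      have "1 < 1 + s j" "0 < \<alpha>" using s a1 by auto
      then obtain K :: "nat \<Rightarrow> (real^'n) set" and \<sigma> b :: "nat \<Rightarrow> real"
        where K: "\<And>i. compact (K i)" "\<And>i. K i \<subseteq> D"
          "\<And>i. nearly_linear_on \<alpha> ((1 + s j) powr (2 * \<alpha> + 1)) f (K i) (\<sigma> i) (b i)"
          "negligible (f ` (D - (\<Union>i. K i)))"
        using linearization_pieces[OF D(1) cont diff luzin crit, of "1 + s j" \<alpha>] by blast
      have bad: "AE r in lborel. 0 < r \<longrightarrow> hausdorff_measure k ((D - (\<Union>i. K i)) \<inter> {x. norm (f x - y0) = r}) = 0"
        using k K(4) Ninv unfolding k_def[symmetric]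
        by (intro AE_level_set_null[OF _ r0(1)]) auto
      have "?M \<le> ennreal (((1 + s j) / \<tau>) powr \<alpha> * ((1 + s j) / (1 - s j)) ^ CARD('n)) *
          (ennreal ((1 + s j) powr (2 * \<alpha> + 1)) * R)"
        unfolding R_def
        by (rule path_modulus_lifted_paths_le[OF k D(1) cont a1 K(1-3) bad Q_meas fD r(1) _ _ \<eta>'(1) s])
          (use C1 C2 \<tau> in \<open>auto simp: I_def\<close>)
      also have "\<dots> = ennreal (((1 + s j) / \<tau>) powr \<alpha> * ((1 + s j) / (1 - s j)) ^ CARD('n) * (1 + s j) powr (2 * \<alpha> + 1)) * R"
        using s[of j] by (simp add: ennreal_mult mult.assoc)
      finally show ?thesis .
    qed
    have "?M \<le> R"
    proof (cases "R = top")
      case False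
      \<comment> \<open>First j tends to infinity with \<tau> < 1 fixed, because the truncated
        integrals may reach 1 only in the limit; afterwards \<tau> = 1 - s j tends to 1.\<close>
      have M_\<tau>: "?M \<le> ennreal ((1 / \<tau>) powr \<alpha>) * R" if \<tau>: "0 < \<tau>" "\<tau> < 1" for \<tau>
      proof -
        have "ennreal \<tau> < ennreal 1" using \<tau> by (intro ennreal_lessI) auto
        also have "\<dots> \<le> (SUP j. I j)" using \<eta>'_int by (simp only: I_SUP ennreal_1)
        finally obtain j0 where "ennreal \<tau> < I j0" by (auto simp: less_SUP_iff)
        then have I: "ennreal \<tau> \<le> I j" if "j0 \<le> j" for j
          using I_mono[OF that] by (meson less_imp_le order_trans)
        have "(\<lambda>j. ((1 + s j) / \<tau>) powr \<alpha> * ((1 + s j) / (1 - s j)) ^ CARD('n) * (1 + s j) powr (2 * \<alpha> + 1))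
          \<longlonglongrightarrow> ((1 + 0) / \<tau>) powr \<alpha> * ((1 + 0) / (1 - 0)) ^ CARD('n) * (1 + 0) powr (2 * \<alpha> + 1)"
          using \<tau> by (intro tendsto_intros s_lim) auto
        with bound[OF \<tau>(1) I]
        have "?M \<le> ennreal (((1 + 0) / \<tau>) powr \<alpha> * ((1 + 0) / (1 - 0)) ^ CARD('n) * (1 + 0) powr (2 * \<alpha> + 1)) * R \<or> R = top"
          by (rule ennreal_le_of_tendsto)
        then show ?thesis using False by simp
      qed
      have "?M \<le> ennreal ((1 / (1 - s j)) powr \<alpha>) * R" for j
        using s[of j] by (intro M_\<tau>) auto
      moreover have "(\<lambda>j. (1 / (1 - s j)) powr \<alpha>) \<longlonglongrightarrow> (1 / (1 - 0)) powr \<alpha>"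
        by (intro tendsto_intros s_lim) auto
      ultimately have "?M \<le> ennreal ((1 / (1 - 0)) powr \<alpha>) * R \<or> R = top"
        by (intro ennreal_le_of_tendsto)
      then show ?thesis using False by simp
    qed simp
    also have "R \<le> (\<integral>\<^sup>+y\<in>annulus y0 r1 r2 \<inter> f ` D. (?N * ?Q y) * enn_powr (\<eta> (norm (y - y0))) \<alpha> \<partial>lebesgue)"
      unfolding R_def
    proof (rule nn_integral_mono)
      fix y
      show "?Q y * enn_powr (\<eta>' (norm (y - y0))) \<alpha> * indicator (f ` D) y
        \<le> (?N * ?Q y) * enn_powr (\<eta> (norm (y - y0))) \<alpha> * indicator (annulus y0 r1 r2 \<inter> f ` D) y"
      proof (cases "norm (y - y0) \<in> {r1<..<r2}")
        case True
        then have "y \<in> annulus y0 r1 r2" by (simp add: annulus_def dist_norm norm_minus_commute)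
        then have ind: "indicator (annulus y0 r1 r2 \<inter> f ` D) y = (indicator (f ` D) y :: ennreal)"
          by (simp add: indicator_def)
        have "\<eta>' (norm (y - y0)) \<le> \<eta> (norm (y - y0))" using \<eta>'(2)[of "norm (y - y0)"] True by simp
        then have "enn_powr (\<eta>' (norm (y - y0))) \<alpha> \<le> enn_powr (\<eta> (norm (y - y0))) \<alpha>"
          using a1 by (intro enn_powr_mono) auto
        moreover have "?Q y \<le> ?N * ?Q y"
          using mult_right_mono[OF one_le_enn_powr_multiplicity[OF D(3), of \<alpha> f], of "?Q y"] a1 by simp
        ultimately show ?thesis unfolding ind by (intro mult_mono) auto
      qed (simp add: \<eta>'_0)
    qed
    finally show ?thesis .
  qed
  show ?thesis
    unfolding inverse_Poletsky_at_def
  \<comment> \<open>The estimate \<open>main\<close> holds for all \<open>0 < r1 < r2\<close>, so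
    any positive radius can serve as \<open>R0\<close>.\<close>
  proof (intro conjI exI[of _ 1] allI impI main)
    show "(\<lambda>y. ?N * ?Q y) \<in> borel_measurable (lebesgue_on (f ` D))"
      using Q_meas by measurable
  qed auto
qed

end
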